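(* Let $\gamma \in \mathcal{C}(T)$ be an essential curve on the once-punctured torus $T$. There exist $N \in \mathbb{Z}_{\geq 1}$, $(P_i, Q_i, K_i)_{i=1}^N \in (\mathbb{Z}_{\geq 1}^2 \times \mathbb{Z}_{\geq 0})^N$, $m\in\{2,4\}$, and $L_0 \in \mathbb{Z}_{\geq 1}$, and an (explicit) integer-valued periodic function $C$ of $L$ with period at most $\prod_{i=1}^N\mathrm{lcm}(P_i,Q_i)$ satisfying $|C(L)|\leq 2N$, such that, for all integers $L \geq L_0$, \[ \# \{ \alpha \in \mathrm{Mod}(T) \cdot \gamma \mid \ell(\alpha) = L \} = m\left(\sum_{i=1}^{N} \varphi_{P_i, Q_i}(L - 4 K_i) + C(L) \right), \] where \[ \varphi_{P, Q}(L) := \# \{ (x, y) \in \mathbb{Z}_{\geq1}^2 \mid Px + Qy = L, \ \gcd(x, y) = 1 \}. \] Moreover, $m=2$ if $\mathrm{Stab}_{\mathrm{Mod}(T)}(\gamma)$ has some non-trivial torsion element, and $m=4$ otherwise.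
   Context: $T$ is a once-punctured topological torus. A curve is a free homotopy class of an unoriented closed curve on $T$; $\mathcal{C}(T)$ is the set of curves. The fundamental group $\pi_1(T)$ is free of rank $2$ with fixed generators $\mathtt{a},\mathtt{b}$ (the loop around the puncture being represented by the commutator of $\mathtt a$ and $\mathtt b$); write $\mathtt{A}=\mathtt{a}^{-1}$, $\mathtt{B}=\mathtt{b}^{-1}$. $\mathcal{C}(T)$ is in bijection with conjugacy classes of $\pi_1(T)$ up to inversion. A curve is essential if it is neither null-homotopic nor a power of a loop around the puncture. The word length $\ell(\gamma)$ of a curve is the number of letters in a cyclically reduced word in $\{\mathtt{a},\mathtt{b},\mathtt{A},\mathtt{B}\}$ representing it. $\mathrm{Mod}(T)$ is the group of isotopy classes of orientation-preserving self-homeomorphisms of $T$, which acts on $\mathcal{C}(T)$. It is isomorphic to $\mathrm{SL}_2(\mathbb{Z})$ and generated by $L:\mathtt{a}\mapsto\mathtt{a},\ \mathtt{b}\mapsto\mathtt{ab}$ and $R:\mathtt{a}\mapsto\mathtt{ab},\ \mathtt{b}\mapsto\mathtt{b}$, corresponding to the matrices $\begin{pmatrix}1&1\\0&1\end{pmatrix}$ and $\begin{pmatrix}1&0\\1&1\end{pmatrix}$. (In the claim, the letter $L$ denotes an integer length.) *)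

theory Defs
  imports "HOL-Algebra.Algebra"
begin

section \<open>The free group of rank two as the fundamental group of the once-punctured torus\<close>

datatype letter = \<a> | \<b> | \<A> | \<B>

type_synonym word = "letter list"

fun inv_letter :: "letter \<Rightarrow> letter" where
  "inv_letter \<a> = \<A>"
| "inv_letter \<b> = \<B>"
| "inv_letter \<A> = \<a>"
| "inv_letter \<B> = \<b>"

definition inv_word :: "word \<Rightarrow> word" where
  "inv_word w = rev (map inv_letter w)"

definition reduced :: "word \<Rightarrow> bool" where
  "reduced w \<longleftrightarrow> successively (\<lambda>x y. y \<noteq> inv_letter x) w"

definition cyclically_reduced :: "word \<Rightarrow> bool" where
  "cyclically_reduced w \<longleftrightarrow> reduced w \<and> (w \<noteq> [] \<longrightarrow> hd w \<noteq> inv_letter (last w))"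

fun cons_reduce :: "letter \<Rightarrow> word \<Rightarrow> word" where
  "cons_reduce x [] = [x]"
| "cons_reduce x (y # w) = (if y = inv_letter x then w else x # y # w)"

definition reduce :: "word \<Rightarrow> word" where
  "reduce w = foldr cons_reduce w []"

definition F2 :: "word monoid" where
  "F2 = \<lparr>carrier = {w. reduced w}, monoid.mult = (\<lambda>u v. reduce (u @ v)), one = []\<rparr>"


section \<open>Curves\<close>

definition curve_of :: "word \<Rightarrow> word set" where
  "curve_of w =
    {g \<otimes>\<^bsub>F2\<^esub> w \<otimes>\<^bsub>F2\<^esub> inv\<^bsub>F2\<^esub> g | g. g \<in> carrier F2} \<union>
    {g \<otimes>\<^bsub>F2\<^esub> inv\<^bsub>F2\<^esub> w \<otimes>\<^bsub>F2\<^esub> inv\<^bsub>F2\<^esub> g | g. g \<in> carrier F2}"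

text \<open>Free homotopy classes of unoriented closed curves on the once-punctured torus are
  represented by the conjugacy classes of its fundamental group, taken up to inversion.\<close>
definition curves :: "word set set" where
  "curves = curve_of ` carrier F2"

text \<open>The loop around the puncture is represented by the commutator of the generators.\<close>
definition essential :: "word set \<Rightarrow> bool" where
  "essential c \<longleftrightarrow> c \<noteq> curve_of \<one>\<^bsub>F2\<^esub> \<and>
     (\<forall>n::nat. c \<noteq> curve_of ([\<a>, \<b>, \<A>, \<B>] [^]\<^bsub>F2\<^esub> n))"

text \<open>The cyclically reduced words in a conjugacy class are cyclic permutations of each other,
  so the length below is determined by the curve.\<close>
definition curve_length :: "word set \<Rightarrow> nat" where
  "curve_length c = (THE n. \<exists>w\<in>c. cyclically_reduced w \<and> length w = n)"


section \<open>The mapping class group and its action on curves\<close>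

fun subst_letter :: "word \<Rightarrow> word \<Rightarrow> letter \<Rightarrow> word" where
  "subst_letter u v \<a> = u"
| "subst_letter u v \<b> = v"
| "subst_letter u v \<A> = inv_word u"
| "subst_letter u v \<B> = inv_word v"

text \<open>The endomorphism of the free group sending the two generators to \<open>u\<close> and \<open>v\<close>.\<close>
definition endo :: "word \<Rightarrow> word \<Rightarrow> word \<Rightarrow> word" where
  "endo u v = (\<lambda>w\<in>carrier F2. reduce (concat (map (subst_letter u v) w)))"

definition aut_L :: "word \<Rightarrow> word" where
  "aut_L = endo [\<a>] [\<a>, \<b>]"

definition aut_R :: "word \<Rightarrow> word" where
  "aut_R = endo [\<a>, \<b>] [\<b>]"

definition inner_auts :: "(word \<Rightarrow> word) set" where
  "inner_auts =
    {\<lambda>w\<in>carrier F2. g \<otimes>\<^bsub>F2\<^esub> w \<otimes>\<^bsub>F2\<^esub> inv\<^bsub>F2\<^esub> g | g. g \<in> carrier F2}"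

definition Out_F2 :: "(word \<Rightarrow> word) set monoid" where
  "Out_F2 = AutoGroup F2 Mod inner_auts"

definition outer_class :: "(word \<Rightarrow> word) \<Rightarrow> (word \<Rightarrow> word) set" where
  "outer_class f = inner_auts #>\<^bsub>AutoGroup F2\<^esub> f"

text \<open>A homeomorphism of the punctured torus moves the base point and so acts on the fundamental
  group only up to inner automorphisms. The mapping class group acts faithfully in this way, and is
  identified with its image in the outer automorphism group, which is generated by the classes
  of \<open>aut_L\<close> and \<open>aut_R\<close>.\<close>
definition MCG :: "(word \<Rightarrow> word) set monoid" where
  "MCG = subgroup_generated Out_F2 {outer_class aut_L, outer_class aut_R}"

text \<open>Inner automorphisms fix every curve, so all members of an outer class have the same effect
  on a curve and the union below is the image of the curve under any one of them.\<close>
definition mcg_act :: "(word \<Rightarrow> word) set \<Rightarrow> word set \<Rightarrow> word set" where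
  "mcg_act F c = (\<Union>f\<in>F. f ` c)"

definition has_nontrivial_torsion :: "('g, 'm) monoid_scheme \<Rightarrow> 'g set \<Rightarrow> bool" where
  "has_nontrivial_torsion G H \<longleftrightarrow>
    (\<exists>g\<in>H. g \<noteq> \<one>\<^bsub>G\<^esub> \<and> (\<exists>n::nat. n \<ge> 1 \<and> g [^]\<^bsub>G\<^esub> n = \<one>\<^bsub>G\<^esub>))"


section \<open>The counting function\<close>

definition phi :: "int \<Rightarrow> int \<Rightarrow> int \<Rightarrow> nat" where
  "phi P Q L = card {(x, y). x \<ge> 1 \<and> y \<ge> 1 \<and> P * x + Q * y = L \<and> gcd x y = 1}"

end

theory Submission
  imports Defs
begin

text \<open>
  Let \<open>p\<close>, \<open>q\<close> be the numbers of letters \<open>a\<^sup>\<plusminus>\<^sup>1\<close>, \<open>b\<^sup>\<plusminus>\<^sup>1\<close> in a cyclically reduced word and \<open>t\<close> the number of its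
  cyclic changes from an inverse generator to a generator. The twist \<open>L\<close> preserves \<open>q\<close> and sends \<open>p\<close> to
  \<open>p + q - 2t\<close>, and symmetrically for \<open>R\<close>; moreover \<open>t\<close> never increases along the binary tree of products
  of twists, and a local analysis of words shows that it stabilizes: up to finitely many vertices, the tree
  is covered by finitely many subtrees on which \<open>t\<close> is equal to a constant \<open>\<tau>\<close> except at the powers of one
  twist. On such a subtree the lengths are \<open>P x + Q y + 4 \<tau>\<close>, with \<open>(x, y)\<close> ranging over the coprime pairs
  that label its vertices, except at the powers of one twist, where they form an arithmetic progression;
  this gives one summand \<open>\<phi>\<^sub>P\<^sub>,\<^sub>Q\<close> and the periodic correction.

  Every element of \<open>SL\<^sub>2(\<int>)\<close> is \<open>s\<^sup>k \<beta> s\<^sup>e\<close> with \<open>k < 4\<close>, \<open>e < 2\<close>, \<open>\<beta>\<close> a product of twists and \<open>s\<close> the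
  length-preserving rotation of order 4, uniquely unless \<open>\<beta>\<close> is trivial. If no curve of the orbit is fixed
  by \<open>L\<close>, then the stabilizer is finite cyclic, and the orbit is counted by dividing the number of matrices
  by its order. If \<open>L\<close> fixes the curve, its translates are indexed by the first columns of matrices, up to
  sign when \<open>-1\<close> acts trivially, which gives a single summand \<open>\<phi>\<^sub>P\<^sub>,\<^sub>P\<close>.
\<close>

section \<open>Counting along a binary tree\<close>

text \<open>A drop of \<open>t\<close> is a local event: \<open>L\<close> destroys a turn exactly at
  a cyclic subword \<open>BaB\<close> or \<open>bAb\<close>, and \<open>R\<close> at
  \<open>AbA\<close> or \<open>aBa\<close>. How few of these patterns a twist can create is what the
  inequalities and constancy statements assumed in \<open>curve_tree\<close> express. The obstacle
  is that branches are infinite, so induction on \<open>t\<close> alone does not end: along the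
  powers of one twist \<open>t\<close> may stay put while every side tree drops. A branch can be cut
  off once both \<open>t\<close> and the drop into its side trees have become constant; what remains
  is a leaf, whose spine obeys a formula of its own. The shift \<open>4 K\<close> comes from the
  fact that, for constant \<open>t\<close>, the twists act additively on \<open>p - 2 t\<close> and
  \<open>q - 2 t\<close>, whose sum is the length minus \<open>4 t\<close>. The matrices of a given
  length are counted by 4 times the sum of two trees, rooted at the curve and at its image under
  \<open>s\<close>. For a stabilizer of order 4 the trees coincide; for order 3 or 6 one count is
  eventually twice the other, giving 12 times a single count. Hence the factor is 2 even for order
  3, with the list of summands doubled.\<close>

fun walk :: "('c \<Rightarrow> 'c) \<Rightarrow> ('c \<Rightarrow> 'c) \<Rightarrow> bool list \<Rightarrow> 'c \<Rightarrow> 'c" where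
  "walk l r [] c = c"
| "walk l r (s # b) c = walk l r b (if s then l c else r c)"

lemma walk_append: "walk l r (b @ b') c = walk l r b' (walk l r b c)"
  by (induction b arbitrary: c) auto

lemma walk_replicate: "walk l r (replicate n True) c = (l ^^ n) c"
  "walk l r (replicate n False) c = (r ^^ n) c"
  by (induction n arbitrary: c) (auto simp: funpow_swap1)

lemma walk_swap: "walk r l (map Not b) c = walk l r b c"
  by (induction b arbitrary: c) auto

lemma replicate_TrueI: "False \<notin> set b \<Longrightarrow> b = replicate (length b) True"
  by (metis replicate_eqI)

text \<open>Walks correspond to coprime pairs as in the Stern--Brocot tree.\<close>
fun wt :: "bool list \<Rightarrow> int \<times> int" where
  "wt [] = (1, 1)"
| "wt (s # b) = (let (x, y) = wt b in if s then (x, x + y) else (x + y, y))"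

lemma wt_pos: "fst (wt b) \<ge> 1 \<and> snd (wt b) \<ge> 1"
  by (induction b) (auto simp: case_prod_unfold Let_def)

lemma wt_coprime: "gcd (fst (wt b)) (snd (wt b)) = 1"
proof (induction b)
  case (Cons s b)
  then show ?case by (cases s) (simp_all add: case_prod_unfold Let_def)
qed auto

text \<open>The larger coordinate reveals the first step, and (1, 1) is reached by no step, so a
  pair can be decoded by the subtractive Euclidean algorithm.\<close>

lemma inj_wt: "inj wt"
proof (rule injI)
  fix b b' show "wt b = wt b' \<Longrightarrow> b = b'"
  proof (induction b arbitrary: b')
    case Nil
    then show ?case using wt_pos[of "tl b'"] by (cases b') (auto simp: case_prod_unfold Let_def split: if_splits)
  next
    case (Cons s b)
    show ?case
    proof (cases b')
      case Nil
      then show ?thesis using Cons.prems wt_pos[of b]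
        by (auto simp: case_prod_unfold Let_def split: if_splits)
    next
      case (Cons s' b'')
      then have "wt b = wt b'' \<and> s = s'" using Cons.prems wt_pos[of b] wt_pos[of b'']
        by (auto simp: case_prod_unfold Let_def prod_eq_iff split: if_splits)
      then show ?thesis using Cons Cons.IH by auto
    qed
  qed
qed

text \<open>Existence of the decoding: subtracting the smaller coordinate from the larger undoes one
  step and keeps the gcd, while equal coprime coordinates are (1, 1).\<close>

lemma wt_surj:
  fixes x y :: int
  assumes "x \<ge> 1" "y \<ge> 1" "gcd x y = 1"
  shows "\<exists>b. wt b = (x, y)"
  using assms
proof (induction "nat (x + y)" arbitrary: x y rule: less_induct)
  case less
  consider "x = y" | "x < y" | "y < x" by linarith
  then show ?case
  proof cases
    case 1
    then have "wt [] = (x, y)" using less.prems by auto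
    then show ?thesis by blast
  next
    case 2
    have "gcd x (y - x) = 1" using less.prems(3) by (metis gcd.commute gcd_diff1)
    then obtain b where "wt b = (x, y - x)" using less.hyps[of x "y - x"] less.prems 2 by auto
    then have "wt (True # b) = (x, y)" by auto
    then show ?thesis by blast
  next
    case 3
    have "gcd (x - y) y = 1" using less.prems(3) by (metis gcd_diff1)
    then obtain b where "wt b = (x - y, y)" using less.hyps[of "x - y" y] less.prems 3 by auto
    then have "wt (False # b) = (x, y)" by auto
    then show ?thesis by blast
  qed
qed

text \<open>Singles out the powers of the first twist, the only walks that can violate the affine
  length formula of a leaf.\<close>

lemma fst_wt_eq_1_iff: "fst (wt b) = 1 \<longleftrightarrow> False \<notin> set b"
proof (induction b)
  case (Cons s b)
  then show ?case using wt_pos[of b] by (auto simp: case_prod_unfold Let_def)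
qed auto

lemma finite_positive_solutions:
  fixes P Q L :: int
  assumes "P \<ge> 1" "Q \<ge> 1"
  shows "finite {(x, y). x \<ge> 1 \<and> y \<ge> 1 \<and> P * x + Q * y = L}"
proof (rule finite_subset)
  show "{(x, y). x \<ge> 1 \<and> y \<ge> 1 \<and> P * x + Q * y = L} \<subseteq> {1..L} \<times> {1..L}"
  proof clarsimp
    fix x y :: int assume xy: "1 \<le> x" "1 \<le> y"
    have "x \<le> P * x" "y \<le> Q * y" "0 \<le> P * x" "0 \<le> Q * y" using xy assms by auto
    then show "x \<le> P * x + Q * y \<and> y \<le> P * x + Q * y" by linarith
  qed
qed auto

lemma phi_eq_card_wt:
  "phi P Q L = card {b. P * fst (wt b) + Q * snd (wt b) = L}"
proof -
  have "{(x, y). x \<ge> 1 \<and> y \<ge> 1 \<and> P * x + Q * y = L \<and> gcd x y = 1}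
     = wt ` {b. P * fst (wt b) + Q * snd (wt b) = L}" (is "?A = ?B")
  proof (intro equalityI subsetI)
    fix z assume "z \<in> ?A"
    moreover then obtain b where "wt b = z" using wt_surj by fastforce
    ultimately show "z \<in> ?B" by auto
  next
    fix z assume "z \<in> ?B"
    then obtain b where "z = wt b" "P * fst (wt b) + Q * snd (wt b) = L" by blast
    then show "z \<in> ?A" using wt_pos[of b] wt_coprime[of b] by (auto simp: case_prod_unfold)
  qed
  then show ?thesis unfolding phi_def
    by (metis (no_types, lifting) card_image inj_wt inj_on_subset subset_UNIV)
qed

lemma finite_wt_eq:
  fixes P Q L :: int
  assumes "P \<ge> 1" "Q \<ge> 1"
  shows "finite {b. P * fst (wt b) + Q * snd (wt b) = L}"
proof (rule finite_imageD)
  show "finite (wt ` {b. P * fst (wt b) + Q * snd (wt b) = L})"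
    by (rule finite_subset[OF _ finite_positive_solutions[OF assms, of L]])
      (use wt_pos in \<open>auto simp: case_prod_unfold\<close>)
qed (use inj_wt in \<open>auto intro: inj_on_subset\<close>)

section \<open>Eventual counting functions\<close>

definition lcm_prod :: "(int \<times> int \<times> int) list \<Rightarrow> int" where
  "lcm_prod ps = (\<Prod>(P, Q, K)\<leftarrow>ps. lcm P Q)"

definition phi_sum :: "(int \<times> int \<times> int) list \<Rightarrow> int \<Rightarrow> int" where
  "phi_sum ps L = (\<Sum>(P, Q, K)\<leftarrow>ps. int (phi P Q (L - 4 * K)))"

text \<open>The period is the whole product rather than some divisor, so that concatenating two
  lists makes it a multiple of both periods. \<open>C\<close> is periodic and bounded everywhere;
  only the equation is restricted to large \<open>L\<close>.\<close>

definition phi_like :: "(int \<Rightarrow> int) \<Rightarrow> bool" where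
  "phi_like F \<longleftrightarrow> (\<exists>ps C L\<^sub>0. ps \<noteq> [] \<and> (\<forall>(P, Q, K)\<in>set ps. P \<ge> 1 \<and> Q \<ge> 1 \<and> K \<ge> 0) \<and>
     (\<forall>L. C (L + lcm_prod ps) = C L) \<and> (\<forall>L. \<bar>C L\<bar> \<le> 2 * int (length ps)) \<and>
     (\<forall>L\<ge>L\<^sub>0. F L = phi_sum ps L + C L))"

lemma periodic_mult:
  fixes C :: "int \<Rightarrow> int"
  assumes "\<And>L. C (L + d) = C L" "k \<ge> 0"
  shows "C (L + k * d) = C L"
  using assms(2)
proof (induction k arbitrary: L rule: int_ge_induct)
  case (step k)
  have "C (L + (k + 1) * d) = C ((L + k * d) + d)" by (simp add: algebra_simps)
  then show ?case using assms(1) step by auto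
qed auto

lemma lcm_prod_pos:
  "(\<forall>(P, Q, K)\<in>set ps. P \<ge> 1 \<and> Q \<ge> 1 \<and> K \<ge> 0) \<Longrightarrow> lcm_prod ps \<ge> 1"
proof (induction ps)
  case (Cons x ps)
  obtain P Q K where x: "x = (P, Q, K)" by (cases x)
  have "lcm P Q \<ge> 1" using Cons.prems x
    by (simp add: int_one_le_iff_zero_less lcm_pos_int)
  moreover have "lcm_prod ps \<ge> 1" using Cons by auto
  moreover have "lcm_prod (x # ps) = lcm P Q * lcm_prod ps"
    by (simp add: lcm_prod_def x)
  ultimately show ?case using mult_mono[of 1 "lcm P Q" 1 "lcm_prod ps"] by auto
qed (auto simp: lcm_prod_def)

lemma phi_like_add:
  assumes "phi_like F" "phi_like G"
  shows "phi_like (\<lambda>L. F L + G L)"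
proof -
  obtain ps C L0 where 1: "ps \<noteq> []" "\<forall>(P, Q, K)\<in>set ps. P \<ge> 1 \<and> Q \<ge> 1 \<and> K \<ge> 0"
     "\<forall>L. C (L + lcm_prod ps) = C L" "\<forall>L. \<bar>C L\<bar> \<le> 2 * int (length ps)"
     "\<forall>L\<ge>L0. F L = phi_sum ps L + C L"
    using assms(1) unfolding phi_like_def by blast
  obtain qs D M0 where 2: "qs \<noteq> []" "\<forall>(P, Q, K)\<in>set qs. P \<ge> 1 \<and> Q \<ge> 1 \<and> K \<ge> 0"
     "\<forall>L. D (L + lcm_prod qs) = D L" "\<forall>L. \<bar>D L\<bar> \<le> 2 * int (length qs)"
     "\<forall>L\<ge>M0. G L = phi_sum qs L + D L"
    using assms(2) unfolding phi_like_def by blast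
  have prod: "lcm_prod (ps @ qs) = lcm_prod ps * lcm_prod qs"
    by (simp add: lcm_prod_def)
  have "C (L + lcm_prod (ps @ qs)) + D (L + lcm_prod (ps @ qs)) = C L + D L" for L
    using periodic_mult[of C "lcm_prod ps" "lcm_prod qs" L] periodic_mult[of D "lcm_prod qs" "lcm_prod ps" L]
      1(3) 2(3) lcm_prod_pos[OF 1(2)] lcm_prod_pos[OF 2(2)] by (simp add: prod mult.commute)
  moreover have "\<bar>C L + D L\<bar> \<le> 2 * int (length (ps @ qs))" for L
    using 1(4)[rule_format, of L] 2(4)[rule_format, of L] by auto
  moreover have "\<forall>L\<ge>max L0 M0. F L + G L = phi_sum (ps @ qs) L + (C L + D L)"
    using 1(5) 2(5) by (simp add: phi_sum_def)
  moreover have "\<forall>(P, Q, K)\<in>set (ps @ qs). P \<ge> 1 \<and> Q \<ge> 1 \<and> K \<ge> 0" using 1(2) 2(2) by auto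
  ultimately show ?thesis unfolding phi_like_def using 1(1)
    by (intro exI[of _ "ps @ qs"] exI[of _ "\<lambda>L. C L + D L"] exI[of _ "max L0 M0"]) auto
qed

lemma phi_like_cong:
  assumes "phi_like F" "\<And>L. L \<ge> M \<Longrightarrow> G L = F L"
  shows "phi_like G"
proof -
  obtain ps C L0 where 1: "ps \<noteq> []" "\<forall>(P, Q, K)\<in>set ps. P \<ge> 1 \<and> Q \<ge> 1 \<and> K \<ge> 0"
     "\<forall>L. C (L + lcm_prod ps) = C L" "\<forall>L. \<bar>C L\<bar> \<le> 2 * int (length ps)"
     "\<forall>L\<ge>L0. F L = phi_sum ps L + C L"
    using assms(1) unfolding phi_like_def by blast
  then have "\<forall>L\<ge>max M L0. G L = phi_sum ps L + C L" using assms(2) by auto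
  then show ?thesis unfolding phi_like_def using 1 by blast
qed

text \<open>Beyond its first term a progression is seen only through a residue class modulo
  \<open>Q\<close>. Such indicators are the source of the periodic correction.\<close>

lemma card_arith_progression:
  fixes s Q L :: int
  assumes "Q \<ge> 1" "L \<ge> s"
  shows "int (card {j::nat. s + int j * Q = L}) = of_bool (Q dvd L - s)"
proof (cases "Q dvd L - s")
  case True
  then obtain k where k: "L - s = Q * k" by blast
  then have "k \<ge> 0" using assms mult_pos_neg[of Q k] by linarith
  have "s + int j * Q = L \<longleftrightarrow> j = nat k" for j
  proof -
    have "s + int j * Q = L \<longleftrightarrow> Q * int j = Q * k"
      using mult.commute[of "int j" Q] k by linarith
    also have "\<dots> \<longleftrightarrow> int j = k" using assms(1) by auto
    finally show ?thesis using \<open>k \<ge> 0\<close> by linarith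
  qed
  then have "{j::nat. s + int j * Q = L} = {nat k}" by blast
  then show ?thesis using True by simp
next
  case False
  then have "{j::nat. s + int j * Q = L} = {}" by auto
  then show ?thesis using False by simp
qed

text \<open>For curves, \<open>p\<close> and \<open>q\<close> count the letters of the two generators and \<open>t\<close> counts the cyclic changes
  from an inverse generator to a generator.\<close>
locale curve_tree =
  fixes V :: "'c set" and l r :: "'c \<Rightarrow> 'c" and p q t :: "'c \<Rightarrow> int"
  assumes l_closed: "c \<in> V \<Longrightarrow> l c \<in> V" and r_closed: "c \<in> V \<Longrightarrow> r c \<in> V"
    and p_nonneg: "c \<in> V \<Longrightarrow> p c \<ge> 0" and q_nonneg: "c \<in> V \<Longrightarrow> q c \<ge> 0"
    and t_nonneg: "c \<in> V \<Longrightarrow> t c \<ge> 0"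
    and p_l: "c \<in> V \<Longrightarrow> p (l c) = p c + q c - 2 * t c" and q_l: "c \<in> V \<Longrightarrow> q (l c) = q c"
    and p_r: "c \<in> V \<Longrightarrow> p (r c) = p c" and q_r: "c \<in> V \<Longrightarrow> q (r c) = p c + q c - 2 * t c"
    and t_l: "c \<in> V \<Longrightarrow> t (l c) \<le> t c" and t_r: "c \<in> V \<Longrightarrow> t (r c) \<le> t c"
    and t_lr: "\<lbrakk>c \<in> V; t (l c) = t c\<rbrakk> \<Longrightarrow> t ((l ^^ n) (r c)) = t (r c)"
    and t_rl: "\<lbrakk>c \<in> V; t (r c) = t c\<rbrakk> \<Longrightarrow> t ((r ^^ n) (l c)) = t (l c)"
    and t_rrl: "\<lbrakk>c \<in> V; t (l c) = t c\<rbrakk> \<Longrightarrow> t ((r ^^ n) (r (l c))) = t (r (l c))"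
    and t_llr: "\<lbrakk>c \<in> V; t (r c) = t c\<rbrakk> \<Longrightarrow> t ((l ^^ n) (l (r c))) = t (l (r c))"
    and t_drop_l: "c \<in> V \<Longrightarrow> t (l c) - t (r (l c)) \<le> t c - t (r c)"
    and t_drop_r: "c \<in> V \<Longrightarrow> t (r c) - t (l (r c)) \<le> t c - t (l c)"
    and fix_l: "\<lbrakk>c \<in> V; \<And>n. p ((l ^^ n) c) + q ((l ^^ n) c) = p c + q c\<rbrakk> \<Longrightarrow> l c = c"
    and fix_r: "\<lbrakk>c \<in> V; \<And>n. p ((r ^^ n) c) + q ((r ^^ n) c) = p c + q c\<rbrakk> \<Longrightarrow> r c = c"

section \<open>Walks, monotonicity of \<open>t\<close> and linear growth along a branch\<close>

context curve_tree begin

text \<open>The axioms come in pairs exchanged by swapping \<open>l\<close> with \<open>r\<close>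
  and \<open>p\<close> with \<open>q\<close>, so everything proved for \<open>l\<close> holds for
  \<open>r\<close>.\<close>

lemma swapped: "curve_tree V r l q p t"
  by unfold_locales
    (use l_closed r_closed p_nonneg q_nonneg t_nonneg p_l q_l p_r q_r t_l t_r t_lr t_rl t_rrl t_llr
      t_drop_l t_drop_r fix_l fix_r in \<open>auto simp: algebra_simps\<close>)

definition len :: "'c \<Rightarrow> int" where "len c = p c + q c"

abbreviation "W \<equiv> walk l r"

text \<open>Excluding fixed vertices forces the slopes \<open>P\<close> and \<open>Q\<close> of the
  leaves to be positive, and with it the finiteness of the counts.\<close>

definition filling :: "'c \<Rightarrow> bool" where
  "filling c \<longleftrightarrow> (\<forall>b. l (W b c) \<noteq> W b c \<and> r (W b c) \<noteq> W b c)"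

text \<open>Walks are counted, not vertices: several walks may end in the same curve, and this
  multiplicity is removed only later through the stabilizer.\<close>

definition count :: "'c \<Rightarrow> int \<Rightarrow> int" where
  "count c L = int (card {b. len (W b c) = L})"

text \<open>Not countability in the sense of cardinals, but: every length has a finite count, and
  the counts have the required shape.\<close>

definition countable_tree :: "'c \<Rightarrow> bool" where
  "countable_tree c \<longleftrightarrow> (\<forall>L. finite {b. len (W b c) = L}) \<and> phi_like (count c)"

lemma W_closed: "c \<in> V \<Longrightarrow> W b c \<in> V"
  by (induction b arbitrary: c) (auto simp: l_closed r_closed)

lemma lpow_closed: "c \<in> V \<Longrightarrow> (l ^^ n) c \<in> V"
  by (induction n) (auto simp: l_closed)

lemma rpow_closed: "c \<in> V \<Longrightarrow> (r ^^ n) c \<in> V"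
  by (induction n) (auto simp: r_closed)

lemma W_funpow: "W (replicate n True) c = (l ^^ n) c" "W (replicate n False) c = (r ^^ n) c"
  by (rule walk_replicate)+

lemma filling_W: "filling c \<Longrightarrow> filling (W b c)"
  unfolding filling_def by (metis walk_append)

lemma filling_steps: "filling c \<Longrightarrow> filling (l c)" "filling c \<Longrightarrow> filling (r c)"
  using filling_W[of c "[True]"] filling_W[of c "[False]"] by auto

lemma filling_funpow: "filling c \<Longrightarrow> filling ((l ^^ n) c)" "filling c \<Longrightarrow> filling ((r ^^ n) c)"
  using filling_W[of c "replicate n True"] filling_W[of c "replicate n False"] by (auto simp: W_funpow)

lemma walks_step:
  "{b. len (W b c) = L} = (if len c = L then {[]} else {})
     \<union> ((#) True ` {b. len (W b (l c)) = L} \<union> (#) False ` {b. len (W b (r c)) = L})" (is "?A = ?B")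
proof -
  have "b \<in> ?A \<longleftrightarrow> b \<in> ?B" for b by (cases b) auto
  then show ?thesis by blast
qed

lemma count_step:
  assumes "finite {b. len (W b (l c)) = L}" "finite {b. len (W b (r c)) = L}" "L \<noteq> len c"
  shows "count c L = count (l c) L + count (r c) L"
proof -
  let ?C = "(#) True ` {b. len (W b (l c)) = L}" and ?D = "(#) False ` {b. len (W b (r c)) = L}"
  have "card {b. len (W b c) = L} = card ?C + card ?D"
    using card_Un_disjoint[of ?C ?D] assms unfolding walks_step[of c] by auto
  then show ?thesis unfolding count_def by (simp add: card_image)
qed

lemma countable_tree_step:
  assumes "countable_tree (l c)" "countable_tree (r c)"
  shows "countable_tree c"
proof -
  have fin: "finite {b. len (W b (l c)) = L}" "finite {b. len (W b (r c)) = L}" for L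
    using assms unfolding countable_tree_def by auto
  have "count c L = count (l c) L + count (r c) L" if "L \<ge> len c + 1" for L
    using count_step[OF fin] that by simp
  moreover have "phi_like (\<lambda>L. count (l c) L + count (r c) L)"
    using assms phi_like_add unfolding countable_tree_def by blast
  ultimately have "phi_like (count c)" using phi_like_cong by blast
  moreover have "finite {b. len (W b c) = L}" for L using fin unfolding walks_step[of c] by auto
  ultimately show ?thesis unfolding countable_tree_def by blast
qed

text \<open>Climbs back from \<open>(l ^^ n) c\<close> to \<open>c\<close>, gluing on one side tree
  at each step.\<close>

lemma countable_tree_lpow:
  assumes "countable_tree ((l ^^ n) c)" "\<And>i. i < n \<Longrightarrow> countable_tree (r ((l ^^ i) c))"
  shows "countable_tree c"
  using assms
proof (induction n)
  case (Suc n)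
  have "countable_tree ((l ^^ n) c)" by (rule countable_tree_step) (use Suc.prems in auto)
  then show ?case using Suc by auto
qed auto

definition stable :: "'c \<Rightarrow> bool" where
  "stable c \<longleftrightarrow> (\<forall>b. t (W b c) = t c)"

definition l_const :: "'c \<Rightarrow> bool" where
  "l_const c \<longleftrightarrow> (\<forall>n. t ((l ^^ n) c) = t c)"

definition r_const :: "'c \<Rightarrow> bool" where
  "r_const c \<longleftrightarrow> (\<forall>n. t ((r ^^ n) c) = t c)"

lemma t_W: "c \<in> V \<Longrightarrow> t (W b c) \<le> t c"
proof (induction b arbitrary: c)
  case (Cons s b)
  have "t (W b (l c)) \<le> t c" "t (W b (r c)) \<le> t c"
    using t_l[of c] t_r[of c] Cons.IH[of "l c"] Cons.IH[of "r c"] Cons.prems l_closed r_closed by fastforce+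
  then show ?case by simp
qed auto

lemma stable_step:
  assumes "stable c"
  shows "t (l c) = t c" "t (r c) = t c" "stable (l c)" "stable (r c)"
proof -
  have st: "t (W (s # b) c) = t c" for s b using assms unfolding stable_def by blast
  have *: "t (W b (l c)) = t c" "t (W b (r c)) = t c" for b using st[of True b] st[of False b] by auto
  show "t (l c) = t c" "t (r c) = t c" using *[of "[]"] by auto
  then show "stable (l c)" "stable (r c)" unfolding stable_def using * by auto
qed

lemma stable_imp_const: "stable c \<Longrightarrow> l_const c" "stable c \<Longrightarrow> r_const c"
  unfolding stable_def l_const_def r_const_def W_funpow[symmetric] by blast+

text \<open>By \<open>t_lr\<close>, a single \<open>l\<close>-step without a drop makes
  \<open>t\<close> constant on the \<open>l\<close>-branch of \<open>r c\<close>. So constancy along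
  \<open>l\<close>-branches is inherited by the whole tree.\<close>

lemma l_const_steps:
  assumes "c \<in> V" "l_const c"
  shows "t (l c) = t c" "l_const (l c)" "l_const (r c)"
proof -
  show 1: "t (l c) = t c" using assms(2)[unfolded l_const_def, rule_format, of 1] by simp
  show "l_const (l c)" unfolding l_const_def
    using assms(2)[unfolded l_const_def, rule_format, of "Suc _"] 1 by (auto simp: funpow_swap1)
  show "l_const (r c)" unfolding l_const_def using t_lr[OF assms(1) 1] by auto
qed

lemma l_const_W: "c \<in> V \<Longrightarrow> l_const c \<Longrightarrow> l_const (W b c)"
  by (induction b arbitrary: c) (auto simp: l_const_steps l_closed r_closed)

text \<open>With \<open>t\<close> constant, \<open>l\<close> and \<open>r\<close> add one of
  \<open>p - 2 t\<close>, \<open>q - 2 t\<close> to the other. \<open>wt\<close> performs the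
  transposed operations, with the first step outermost, which matches the recursion of the
  walk.\<close>

lemma len_stable:
  assumes "c \<in> V" "stable c"
  shows "len (W b c) = (p c - 2 * t c) * fst (wt b) + (q c - 2 * t c) * snd (wt b) + 4 * t c"
  using assms
proof (induction b arbitrary: c)
  case Nil
  then show ?case by (simp add: len_def)
next
  case (Cons s b)
  note st = stable_step[OF Cons.prems(2)]
  show ?case
  proof (cases s)
    case True
    then show ?thesis using Cons.IH[of "l c"] st Cons.prems
      by (simp add: l_closed p_l q_l case_prod_unfold Let_def algebra_simps)
  next
    case False
    then show ?thesis using Cons.IH[of "r c"] st Cons.prems
      by (simp add: r_closed p_r q_r case_prod_unfold Let_def algebra_simps)
  qed
qed

lemma l_const_formula:
  assumes "c \<in> V" "l_const c"
  shows "p ((l ^^ n) c) = p c + int n * (q c - 2 * t c)" "q ((l ^^ n) c) = q c"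
proof -
  have "p ((l ^^ n) c) = p c + int n * (q c - 2 * t c) \<and> q ((l ^^ n) c) = q c"
  proof (induction n)
    case (Suc n)
    then show ?case using assms(2)[unfolded l_const_def, rule_format, of n]
        p_l[OF lpow_closed[OF assms(1)], of n] q_l[OF lpow_closed[OF assms(1)], of n]
      by (simp add: algebra_simps)
  qed auto
  then show "p ((l ^^ n) c) = p c + int n * (q c - 2 * t c)" "q ((l ^^ n) c) = q c" by auto
qed

text \<open>A negative slope would make \<open>p\<close> negative after \<open>p c + 1\<close>
  steps; slope zero makes the lengths on the branch constant, so that \<open>fix_l\<close>
  applies.\<close>

lemma l_const_slope:
  assumes "c \<in> V" "l_const c"
  shows "q c - 2 * t c \<ge> 0" "l c \<noteq> c \<Longrightarrow> q c - 2 * t c \<ge> 1"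
proof -
  show nonneg: "q c - 2 * t c \<ge> 0"
  proof (rule ccontr)
    assume "\<not> ?thesis"
    then have "q c - 2 * t c \<le> -1" by linarith
    then have "int (nat (p c + 1)) * (q c - 2 * t c) \<le> int (nat (p c + 1)) * (-1)"
      by (intro mult_left_mono) auto
    then have "p ((l ^^ nat (p c + 1)) c) < 0"
      using l_const_formula(1)[OF assms, of "nat (p c + 1)"] p_nonneg[OF assms(1)] by auto
    then show False using p_nonneg[OF lpow_closed[OF assms(1)]] by (meson not_le)
  qed
  assume "l c \<noteq> c"
  then have "q c - 2 * t c \<noteq> 0"
    using fix_l[OF assms(1)] l_const_formula[OF assms] by auto
  then show "q c - 2 * t c \<ge> 1" using nonneg by linarith
qed

end

section \<open>Leaves and the counts they contribute\<close>

context curve_tree begin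

interpretation swap: curve_tree V r l q p t
  by (rule swapped)

lemma swap_len: "swap.len c = len c"
  by (simp add: len_def swap.len_def)

lemma swap_filling: "swap.filling c = filling c"
  unfolding filling_def swap.filling_def
  by (metis (no_types) walk_swap)

lemma swap_set: "{b. swap.len (walk r l b c) = L} = map Not ` {b. len (W b c) = L}"
proof -
  have inv: "map Not (map Not b) = b" for b by (induction b) auto
  have "b \<in> {b. swap.len (walk r l b c) = L} \<longleftrightarrow> b \<in> map Not ` {b. len (W b c) = L}" for b
  proof -
    have "walk r l b c = W (map Not b) c" by (rule walk_swap[symmetric])
    then show ?thesis unfolding swap_len using inv by (auto intro: image_eqI[of _ _ "map Not b"])
  qed
  then show ?thesis by blast
qed

lemma inj_map_Not: "inj_on (map Not) A"
  by (rule inj_on_subset[of _ UNIV]) (auto intro: inj_onI simp: inj_map_eq_map inj_def)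

lemma swap_countable_tree: "swap.countable_tree c = countable_tree c"
proof -
  have "swap.count c = count c"
    unfolding count_def swap.count_def swap_set by (simp add: card_image inj_map_Not)
  then show ?thesis unfolding countable_tree_def swap.countable_tree_def swap_set
    by (simp add: finite_image_iff inj_map_Not)
qed

lemma swap_const: "swap.l_const c = r_const c"
  unfolding r_const_def swap.l_const_def by simp

lemma r_const_steps:
  assumes "c \<in> V" "r_const c"
  shows "t (r c) = t c" "r_const (r c)" "r_const (l c)"
  using swap.l_const_steps assms unfolding swap_const by auto

lemmas r_const_slope = swap.l_const_slope[unfolded swap_const]

text \<open>Both kinds of constancy are inherited by every vertex, so no step of any walk changes
  \<open>t\<close>.\<close>

lemma stableI:
  assumes "c \<in> V" "l_const c" "r_const c"
  shows "stable c"
proof -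
  have "t (W b c) = t c" for b
    using assms
  proof (induction b arbitrary: c)
    case (Cons s b)
    then show ?case using l_const_steps[of c] r_const_steps[of c] l_closed r_closed by auto
  qed auto
  then show ?thesis unfolding stable_def by blast
qed

text \<open>Below a leaf, the number of sign changes only depends on whether the walk uses the second
  generator, so that lengths are affine in the weights.\<close>
definition leaf :: "'c \<Rightarrow> int \<Rightarrow> bool" where
  "leaf c \<tau> \<longleftrightarrow> l_const c \<and> (\<forall>b. False \<in> set b \<longrightarrow> t (W b c) = \<tau>)"

lemma leafD:
  assumes "leaf c \<tau>" "c \<in> V"
  shows "t (r c) = \<tau>" "stable (r c)" "leaf (l c) \<tau>" "l_const c"
proof -
  have *: "t (W b (r c)) = \<tau>" for b
    using assms(1)[unfolded leaf_def, THEN conjunct2, rule_format, of "False # b"] by simp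
  show "t (r c) = \<tau>" using *[of "[]"] by simp
  then show "stable (r c)" unfolding stable_def using * by simp
  show "l_const c" using assms leaf_def by blast
  show "leaf (l c) \<tau>" unfolding leaf_def
  proof (intro conjI allI impI)
    show "l_const (l c)" using l_const_steps \<open>l_const c\<close> assms by blast
  next
    fix b assume "False \<in> set b"
    then show "t (W b (l c)) = \<tau>"
      using assms(1)[unfolded leaf_def, THEN conjunct2, rule_format, of "True # b"] by simp
  qed
qed

text \<open>The step \<open>r\<close> that leaves the spine still uses the old value
  \<open>t c\<close>, while the subtree below is measured against \<open>\<tau>\<close>; hence the
  two slopes refer to different values of \<open>t\<close>. On the spine itself the formula is off
  by \<open>2 (t c - \<tau>)\<close>.\<close>

lemma len_leaf:
  assumes "c \<in> V" "leaf c \<tau>" "False \<in> set b"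
  shows "len (W b c) = (p c - 2 * \<tau>) * fst (wt b) + (q c - 2 * t c) * snd (wt b) + 4 * \<tau>"
  using assms
proof (induction b arbitrary: c)
  case Nil
  then show ?case by simp
next
  case (Cons s b)
  note st = leafD[OF Cons.prems(2,1)]
  show ?case
  proof (cases s)
    case True
    then show ?thesis using Cons.IH[of "l c"] st Cons.prems l_const_steps(1)[of c]
      by (simp add: l_closed p_l q_l case_prod_unfold Let_def algebra_simps)
  next
    case False
    then show ?thesis using len_stable[of "r c" b] st Cons.prems
      by (simp add: r_closed p_r q_r case_prod_unfold Let_def algebra_simps)
  qed
qed

text \<open>This number is the slope of the \<open>r\<close>-branch starting at \<open>r c\<close>,
  where \<open>p\<close> is unchanged and \<open>t\<close> is already \<open>\<tau>\<close>.\<close>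

lemma leaf_first_slope:
  assumes "c \<in> V" "leaf c \<tau>"
  shows "p c - 2 * \<tau> \<ge> 0" "r (r c) \<noteq> r c \<Longrightarrow> p c - 2 * \<tau> \<ge> 1"
  using r_const_slope[of "r c"] leafD[OF assms(2,1)] assms(1)
  by (auto simp: r_closed p_r stable_imp_const)

text \<open>Off the spine the walks match the pairs counted by \<open>phi\<close>. On the spine both
  the predicted and the true lengths form progressions of difference \<open>Q\<close>, with
  different starting points, so the correction is a difference of two indicators modulo
  \<open>Q\<close>.\<close>

lemma leaf_countable_tree:
  assumes "c \<in> V" "leaf c \<tau>" "filling c"
  shows "countable_tree c"
proof -
  define P where "P = p c - 2 * \<tau>"
  define Q where "Q = q c - 2 * t c"
  have P: "P \<ge> 1" unfolding P_def using leaf_first_slope(2)[OF assms(1,2)] filling_steps[OF assms(3)]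
    by (metis filling_def walk.simps(1))
  have Q: "Q \<ge> 1" unfolding Q_def using l_const_slope(2)[OF assms(1)] leafD[OF assms(2,1)] assms(3)
    by (metis filling_def walk.simps(1))
  have "\<tau> \<ge> 0" using leafD(1)[OF assms(2,1)] t_nonneg r_closed assms(1) by metis
  let ?f = "\<lambda>b. P * fst (wt b) + Q * snd (wt b)"
  \<comment> \<open>\<open>A\<close> and \<open>B\<close> split the walks counted by
    \<open>phi\<close> into those off and on the spine; \<open>J\<close> indexes the true lengths on
    the spine, which replace \<open>B\<close>.\<close>
  define A where "A L = {b. False \<in> set b \<and> ?f b = L - 4 * \<tau>}" for L
  define B where "B L = {b. False \<notin> set b \<and> ?f b = L - 4 * \<tau>}" for L
  define J where "J L = {j. len c + int j * Q = L}" for L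
  have fAB: "A L \<union> B L = {b. ?f b = L - 4 * \<tau>}" for L by (auto simp: A_def B_def)
  have finAB: "finite (A L)" "finite (B L)" for L
    using finite_wt_eq[OF P Q, of "L - 4 * \<tau>"] unfolding fAB[symmetric] by auto
  have finJ: "finite (J L)" for L
  proof (rule finite_subset)
    show "J L \<subseteq> {..nat (L - len c)}"
    proof
      fix j assume "j \<in> J L"
      then have "len c + int j * Q = L" by (simp add: J_def)
      moreover have "int j * 1 \<le> int j * Q" using Q by (intro mult_left_mono) auto
      ultimately show "j \<in> {..nat (L - len c)}" by auto
    qed
  qed auto
  have lenl: "len (W (replicate j True) c) = len c + int j * Q" for j
    using l_const_formula[OF assms(1) leafD(4)[OF assms(2,1)], of j] by (simp add: W_funpow len_def Q_def)
  have eq: "{b. len (W b c) = L} = A L \<union> (\<lambda>j. replicate j True) ` J L" for L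
  proof (rule Set.set_eqI)
    fix b
    show "b \<in> {b. len (W b c) = L} \<longleftrightarrow> b \<in> A L \<union> (\<lambda>j. replicate j True) ` J L"
    proof (cases "False \<in> set b")
      case True
      then have "len (W b c) = ?f b + 4 * \<tau>" using len_leaf[OF assms(1,2)] by (simp add: P_def Q_def)
      then show ?thesis using True by (auto simp: A_def)
    next
      case False
      then have b: "b = replicate (length b) True" by (rule replicate_TrueI)
      have "len (W b c) = len c + int (length b) * Q" using lenl[of "length b"] b by simp
      then show ?thesis using False b unfolding A_def J_def by (auto simp: image_iff)
    qed
  qed
  have fin: "finite {b. len (W b c) = L}" for L unfolding eq using finAB finJ by auto
  have cardA: "int (card (A L)) = int (phi P Q (L - 4 * \<tau>)) - int (card (B L))" for L
  proof -
    have "phi P Q (L - 4 * \<tau>) = card (A L \<union> B L)" unfolding phi_eq_card_wt fAB ..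
    also have "\<dots> = card (A L) + card (B L)"
      by (rule card_Un_disjoint[OF finAB]) (auto simp: A_def B_def)
    finally show ?thesis by simp
  qed
  have cardB: "card (B L) = card {j::nat. (4 * \<tau> + P + Q) + int j * Q = L}" for L
  proof -
    have wt1: "wt (replicate j True) = (1, 1 + int j)" for j by (induction j) auto
    have "B L = (\<lambda>j. replicate j True) ` {j::nat. (4 * \<tau> + P + Q) + int j * Q = L}" (is "_ = ?R")
    proof (rule Set.set_eqI)
      fix b show "b \<in> B L \<longleftrightarrow> b \<in> ?R"
      proof (cases "False \<in> set b")
        case False
        then have b: "b = replicate (length b) True" by (rule replicate_TrueI)
        then have "?f b = P + Q * (1 + int (length b))" using wt1[of "length b"] by simp
        then have "b \<in> B L \<longleftrightarrow> (4 * \<tau> + P + Q) + int (length b) * Q = L"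
          using False by (auto simp: B_def algebra_simps)
        then show ?thesis using b by (auto simp: image_iff)
      qed (auto simp: B_def)
    qed
    then show ?thesis by (simp add: card_image inj_on_def)
  qed
  have cnt: "count c L = int (phi P Q (L - 4 * \<tau>)) - int (card (B L)) + int (card (J L))" for L
  proof -
    have "card {b. len (W b c) = L} = card (A L) + card ((\<lambda>j. replicate j True) ` J L)"
      unfolding eq by (rule card_Un_disjoint) (use finAB finJ in \<open>auto simp: A_def\<close>)
    also have "\<dots> = card (A L) + card (J L)" by (simp add: card_image inj_on_def)
    finally show ?thesis unfolding count_def using cardA by simp
  qed
  \<comment> \<open>The spine really starts at \<open>len c\<close>, but \<open>phi\<close> places
    it at the value \<open>4 \<tau> + P + Q\<close> of the pair (1, 1). The difference takes values
    in -1, 0, 1.\<close>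
  define C :: "int \<Rightarrow> int" where "C L = of_bool (Q dvd L - len c) - of_bool (Q dvd L - (4 * \<tau> + P + Q))" for L
  have dvd: "Q dvd (L + lcm P Q - s) \<longleftrightarrow> Q dvd L - s" for L s
  proof -
    have "L + lcm P Q - s = (L - s) + lcm P Q" by simp
    then show ?thesis by (metis dvd_add_left_iff dvd_lcm2)
  qed
  have per: "C (L + lcm_prod [(P, Q, \<tau>)]) = C L" for L
    unfolding C_def lcm_prod_def by (simp add: dvd)
  have "count c L = phi_sum [(P, Q, \<tau>)] L + C L" if "L \<ge> max (len c) (4 * \<tau> + P + Q)" for L
    using cnt[of L] that card_arith_progression[OF Q, of "len c" L]
      card_arith_progression[OF Q, of "4 * \<tau> + P + Q" L]
    unfolding cardB J_def phi_sum_def C_def by simp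
  then have "phi_like (count c)" unfolding phi_like_def
    using P Q \<open>\<tau> \<ge> 0\<close> per
    by (intro exI[of _ "[(P, Q, \<tau>)]"] exI[of _ C] exI[of _ "max (len c) (4 * \<tau> + P + Q)"])
      (auto simp: C_def)
  then show ?thesis using fin unfolding countable_tree_def by blast
qed

lemma stable_leaf: "stable c \<Longrightarrow> leaf c (t c)"
  using stable_imp_const(1) unfolding leaf_def stable_def by blast

lemma stable_countable_tree: "c \<in> V \<Longrightarrow> stable c \<Longrightarrow> filling c \<Longrightarrow> countable_tree c"
  using leaf_countable_tree stable_leaf by blast

lemma decreasing_eventually_const:
  fixes f :: "nat \<Rightarrow> int"
  assumes "\<And>n. f (Suc n) \<le> f n" "\<And>n. f n \<ge> 0"
  shows "\<exists>m. \<forall>n\<ge>m. f n = f m"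
proof -
  have dec: "f n \<le> f m" if "m \<le> n" for m n using that by (rule lift_Suc_antimono_le[of f, rotated]) (rule assms(1))
  obtain m where "\<forall>n. nat (f m) \<le> nat (f n)" using ex_has_least_nat[of "\<lambda>_. True" 0 "\<lambda>n. nat (f n)"] by auto
  then have "f m \<le> f n" for n using assms(2) by (metis nat_le_eq_zle order_refl le_nat_iff nat_0_le)
  then show ?thesis using dec by (meson order_antisym)
qed

text \<open>The \<open>l\<close>-branch is constant by inheritance; the \<open>r\<close>-branch is
  constant by \<open>t_rrl\<close>, because the step \<open>l\<close> from \<open>c\<close> caused
  no drop.\<close>

lemma stable_r_l:
  assumes "c \<in> V" "l_const c"
  shows "stable (r (l c))"
proof (rule stableI)
  show "l_const (r (l c))" using l_const_steps assms l_closed by metis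
  show "r_const (r (l c))" unfolding r_const_def using t_rrl l_const_steps(1) assms by blast
qed (simp add: assms l_closed r_closed)

text \<open>Two nonnegative integer sequences on the spine are nonincreasing and hence eventually
  constant: \<open>t\<close>, and then the drop from the spine to the side tree, by
  \<open>t_drop_l\<close>. From there on all side trees have the same \<open>t\<close>.\<close>

lemma ex_leaf:
  assumes "c \<in> V"
  shows "\<exists>n \<tau>. leaf ((l ^^ n) c) \<tau>"
proof -
  obtain m where m: "\<forall>n\<ge>m. t ((l ^^ n) c) = t ((l ^^ m) c)"
    using decreasing_eventually_const[of "\<lambda>n. t ((l ^^ n) c)"] t_l t_nonneg lpow_closed[OF assms] by auto
  have lc: "l_const ((l ^^ n) c)" if "n \<ge> m" for n
    unfolding l_const_def using m that by (metis (no_types, lifting) funpow_add o_apply trans_le_add2)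
  define D where "D n = t ((l ^^ (m + n)) c) - t (r ((l ^^ (m + n)) c))" for n
  obtain k where k: "\<forall>n\<ge>k. D n = D k"
  proof -
    have "D (Suc n) \<le> D n" for n using t_drop_l[OF lpow_closed[OF assms], of "m + n"] by (simp add: D_def)
    moreover have "D n \<ge> 0" for n using t_r[OF lpow_closed[OF assms], of "m + n"] by (simp add: D_def)
    ultimately show ?thesis using decreasing_eventually_const[of D] that by blast
  qed
  \<comment> \<open>The extra step gives every later spine vertex a predecessor at which
    \<open>t\<close> is already constant, as \<open>stable_r_l\<close> requires.\<close>
  define N where "N = m + k + 1"
  define \<tau> where "\<tau> = t (r ((l ^^ N) c))"
  have tau: "t (r ((l ^^ n) c)) = \<tau>" if "n \<ge> N" for n
  proof -
    have "D (n - m) = D k" "D (N - m) = D k" using that k[rule_format, of "n - m"] k[rule_format, of "N - m"] unfolding N_def by linarith+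
    moreover have "t ((l ^^ n) c) = t ((l ^^ N) c)" using that m[rule_format, of n] m[rule_format, of N] unfolding N_def by linarith
    moreover have "m + (n - m) = n" "m + (N - m) = N" using that unfolding N_def by linarith+
    ultimately show ?thesis unfolding D_def \<tau>_def by (simp only:)
  qed
  have st: "stable (r ((l ^^ n) c))" if n: "n \<ge> N" for n
  proof -
    obtain n' where "n = Suc n'" "n' \<ge> m" using n unfolding N_def by (cases n) auto
    then show ?thesis using stable_r_l[OF lpow_closed[OF assms] lc] by auto
  qed
  have "t (W b ((l ^^ n) c)) = \<tau>" if "False \<in> set b" "n \<ge> N" for b n
    using that
  proof (induction b arbitrary: n)
    case (Cons s b)
    show ?case
    proof (cases s)
      case True
      then show ?thesis using Cons.IH[of "Suc n"] Cons.prems by simp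
    next
      case False
      then show ?thesis using st[OF Cons.prems(2)] tau[OF Cons.prems(2)] by (simp add: stable_def)
    qed
  qed auto
  moreover have "m \<le> N" unfolding N_def by simp
  ultimately have "leaf ((l ^^ N) c) \<tau>" unfolding leaf_def using lc by blast
  then show ?thesis by blast
qed

text \<open>Far down the spine there is a leaf, so only finitely many side trees have to be treated
  separately.\<close>

lemma countable_tree_l:
  assumes "c \<in> V" "filling c" "\<And>i. countable_tree (r ((l ^^ i) c))"
  shows "countable_tree c"
proof -
  obtain n \<tau> where "leaf ((l ^^ n) c) \<tau>" using ex_leaf[OF assms(1)] by blast
  then have "countable_tree ((l ^^ n) c)"
    using leaf_countable_tree lpow_closed filling_funpow assms by blast
  then show ?thesis using countable_tree_lpow assms(3) by blast
qed

end

section \<open>The counting theorem for filling trees\<close>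

context curve_tree begin

interpretation swap: curve_tree V r l q p t
  by (rule swapped)

lemmas countable_tree_r = swap.countable_tree_l[unfolded swap_countable_tree swap_filling]

text \<open>Follow the \<open>r\<close>-spine and then, in each side tree, the
  \<open>l\<close>-spine. The side trees met there have the form \<open>r (l d)\<close> with
  \<open>d\<close> constant along \<open>l\<close>, so they are stable.\<close>

lemma l_const_countable_tree:
  assumes "c \<in> V" "filling c" "l_const c"
  shows "countable_tree c"
proof (rule countable_tree_r[OF assms(1,2)])
  fix i
  let ?d = "(r ^^ i) c"
  have d: "?d \<in> V" "filling ?d" "l_const ?d"
    using assms rpow_closed filling_funpow l_const_W[of c "replicate i False"] by (auto simp: W_funpow)
  show "countable_tree (l ?d)"
  proof (rule countable_tree_l)
    fix j
    have "(l ^^ j) (l ?d) = l ((l ^^ j) ?d)" by (simp add: funpow_swap1)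
    moreover have "l_const ((l ^^ j) ?d)" using l_const_W[of ?d "replicate j True"] d by (auto simp: W_funpow)
    ultimately have "stable (r ((l ^^ j) (l ?d)))" using stable_r_l lpow_closed d by simp
    moreover have "r ((l ^^ j) (l ?d)) \<in> V" "filling (r ((l ^^ j) (l ?d)))"
      by (intro r_closed lpow_closed l_closed d(1), intro filling_steps filling_funpow d(2))
    ultimately show "countable_tree (r ((l ^^ j) (l ?d)))" using stable_countable_tree by blast
  qed (use d l_closed filling_steps in auto)
qed

text \<open>Induction on \<open>t c\<close>, with an \<open>l\<close>-spine followed by an
  \<open>r\<close>-spine. A side tree \<open>l (r e)\<close> either has smaller \<open>t\<close>, or
  the step to \<open>r e\<close> caused no drop; in the latter case \<open>t_llr\<close> makes its
  \<open>l\<close>-branch constant and the previous lemma applies.\<close>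

theorem filling_countable_tree:
  assumes "c \<in> V" "filling c"
  shows "countable_tree c"
  using assms
proof (induction "nat (t c)" arbitrary: c rule: less_induct)
  case less
  show ?case
  proof (rule countable_tree_l[OF less.prems])
    fix i
    define d where "d = (l ^^ i) c"
    have d: "d \<in> V" "filling d" "t d \<le> t c"
      using lpow_closed[OF less.prems(1)] filling_funpow(1)[OF less.prems(2)]
        t_W[OF less.prems(1), of "replicate i True"] unfolding d_def W_funpow by blast+
    have IH: "countable_tree e" if "e \<in> V" "filling e" "t e < t c" for e
    proof -
      have "nat (t e) < nat (t c)" using that(3) t_nonneg[OF that(1)] by linarith
      then show ?thesis using less.hyps that by blast
    qed
    have "countable_tree (r d)"
    proof (cases "t (r d) = t c")
      case False
      then have "t (r d) < t c" using t_r[OF d(1)] d(3) by linarith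
      then show ?thesis using IH d r_closed filling_steps by blast
    next
      case True
      show ?thesis
      proof (rule countable_tree_r)
        fix j
        define e where "e = (r ^^ j) d"
        have e: "e \<in> V" "filling e" "t e \<le> t d"
          using rpow_closed[OF d(1)] filling_funpow(2)[OF d(2)]
            t_W[OF d(1), of "replicate j False"] unfolding e_def W_funpow by blast+
        have re: "(r ^^ j) (r d) = r e" by (simp add: e_def funpow_swap1)
        have "countable_tree (l (r e))"
        proof (cases "t (r e) = t c")
          case True
          then have "t (r e) = t e" using e d t_r[OF e(1)] by linarith
          then have "l_const (l (r e))" unfolding l_const_def using t_llr[OF e(1)] by blast
          then show ?thesis using l_const_countable_tree e l_closed r_closed filling_steps by blast
        next
          case False
          then have "t (l (r e)) < t c" using t_r[OF e(1)] t_l[OF r_closed[OF e(1)]] e d by linarith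
          then show ?thesis using IH e l_closed r_closed filling_steps by blast
        qed
        then show "countable_tree (l ((r ^^ j) (r d)))" using re by simp
      qed (use d r_closed filling_steps in auto)
    qed
    then show "countable_tree (r ((l ^^ i) c))" by (simp add: d_def)
  qed
qed

end

section \<open>The free group\<close>

lemma inv_letter_inv [simp]: "inv_letter (inv_letter x) = x"
  by (cases x) auto

lemma inv_letter_neq [simp]: "inv_letter x \<noteq> x" "x \<noteq> inv_letter x"
  by (cases x; simp)+

lemma inv_letter_eq_iff: "inv_letter x = y \<longleftrightarrow> x = inv_letter y"
  by (cases x; cases y; simp)

lemma inv_word_simps [simp]:
  "inv_word [] = []" "inv_word (x # w) = inv_word w @ [inv_letter x]"
  "inv_word (u @ v) = inv_word v @ inv_word u" "inv_word (inv_word w) = w"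
  "inv_word w = [] \<longleftrightarrow> w = []" "length (inv_word w) = length w"
  by (simp_all add: inv_word_def rev_map o_def)

lemma reduced_Nil [simp]: "reduced []"
  by (simp add: reduced_def)

lemma reduced_Cons: "reduced (x # w) \<longleftrightarrow> reduced w \<and> (w = [] \<or> hd w \<noteq> inv_letter x)"
  by (cases w) (auto simp: reduced_def)

lemma reduced_append:
  "reduced (u @ v) \<longleftrightarrow> reduced u \<and> reduced v \<and> (u = [] \<or> v = [] \<or> hd v \<noteq> inv_letter (last u))"
  by (auto simp: reduced_def successively_append_iff)

lemma reduced_inv_word: "reduced w \<Longrightarrow> reduced (inv_word w)"
proof (induction w)
  case (Cons x w)
  then show ?case
    by (cases w) (auto simp: reduced_append reduced_Cons inv_letter_eq_iff)
qed auto

lemma reduced_cons_reduce: "reduced w \<Longrightarrow> reduced (cons_reduce x w)"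
  by (cases w) (auto simp: reduced_Cons)

text \<open>Each letter permutes the reduced words, with the inverse letter acting as the inverse
  permutation. This is van der Waerden's device for well-definedness of the free group without a
  confluence argument.\<close>

lemma cons_reduce_cancel: "reduced w \<Longrightarrow> cons_reduce x (cons_reduce (inv_letter x) w) = w"
  by (cases w; cases "tl w") (auto simp: reduced_Cons)

lemma reduced_foldr: "reduced v \<Longrightarrow> reduced (foldr cons_reduce u v)"
  by (induction u) (auto simp: reduced_cons_reduce)

lemma reduced_reduce [simp]: "reduced (reduce w)"
  by (simp add: reduce_def reduced_foldr)

lemma reduce_reduced: "reduced w \<Longrightarrow> reduce w = w"
proof (induction w)
  case (Cons x w)
  then show ?case by (cases w) (auto simp: reduce_def reduced_Cons)
qed (auto simp: reduce_def)

lemma reduce_Nil [simp]: "reduce [] = []"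
  by (simp add: reduce_def)

lemma reduce_reduce [simp]: "reduce (reduce w) = reduce w"
  by (simp add: reduce_reduced)

lemma foldr_cons_reduce:
  assumes "reduced v"
  shows "foldr cons_reduce (cons_reduce x w) v = cons_reduce x (foldr cons_reduce w v)"
proof (cases w)
  case (Cons y u)
  then show ?thesis using cons_reduce_cancel[OF reduced_foldr[OF assms, of u], of x] by auto
qed auto

lemma foldr_reduce: "reduced v \<Longrightarrow> foldr cons_reduce (reduce u) v = foldr cons_reduce u v"
proof (induction u)
  case (Cons x u)
  have "reduce (x # u) = cons_reduce x (reduce u)" by (simp add: reduce_def)
  then show ?case using Cons foldr_cons_reduce by simp
qed auto

lemma reduce_append: "reduce (u @ v) = foldr cons_reduce u (reduce v)"
  by (simp add: reduce_def)

lemma reduce_append_left [simp]: "reduce (reduce u @ v) = reduce (u @ v)"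
  by (simp add: reduce_append foldr_reduce)

lemma reduce_append_right [simp]: "reduce (u @ reduce v) = reduce (u @ v)"
  by (simp add: reduce_append)

text \<open>Having equal reduced forms is a congruence, so group identities can be checked on
  unreduced words.\<close>

lemma reduce_cong:
  "\<lbrakk>reduce u = reduce u'; reduce v = reduce v'\<rbrakk> \<Longrightarrow> reduce (u @ v) = reduce (u' @ v')"
  by (metis reduce_append_left reduce_append_right)

lemma reduce_cancel_Cons [simp]:
  "reduce (x # inv_letter x # w) = reduce w" "reduce (inv_letter x # x # w) = reduce w"
  using cons_reduce_cancel[of "reduce w" x] cons_reduce_cancel[of "reduce w" "inv_letter x"]
  by (auto simp: reduce_def reduced_foldr)

lemma reduce_cancel [simp]:
  "reduce (u @ inv_word u @ w) = reduce w" "reduce (inv_word u @ u @ w) = reduce w"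
proof -
  show *: "reduce (u @ inv_word u @ w) = reduce w" for u
  proof (induction u arbitrary: w)
    case (Cons x u)
    have "reduce ([x] @ u @ inv_word u @ (inv_letter x # w)) = reduce ([x] @ inv_letter x # w)"
      by (rule reduce_cong) (simp_all only: Cons.IH)
    then show ?case by simp
  qed auto
  show "reduce (inv_word u @ u @ w) = reduce w" using *[of "inv_word u"] by simp
qed

lemma reduce_cancel_end [simp]:
  "reduce (u @ inv_word u) = []" "reduce (inv_word u @ u) = []"
  using reduce_cancel[of u "[]"] by simp_all

text \<open>Uniqueness of inverses: the product of \<open>inv_word (reduce w)\<close>,
  \<open>w\<close> and \<open>inv_word w\<close> is evaluated by cancelling on either side.\<close>

lemma reduce_inv_word: "reduce (inv_word w) = inv_word (reduce w)"
proof -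
  have "reduce (inv_word (reduce w) @ w @ inv_word w) = reduce (inv_word (reduce w))"
    using reduce_cong[of "inv_word (reduce w)" _ "w @ inv_word w" "[]"] by simp
  moreover have "reduce (inv_word (reduce w) @ w @ inv_word w) = reduce (inv_word w)"
  proof -
    have "reduce (inv_word (reduce w) @ w) = []"
      by (metis reduce_append_right reduce_cancel_end(2))
    then have "reduce ((inv_word (reduce w) @ w) @ inv_word w) = reduce ([] @ inv_word w)"
      by (intro reduce_cong) simp_all
    then show ?thesis by simp
  qed
  ultimately show ?thesis using reduce_reduced reduced_inv_word reduced_reduce by metis
qed

lemma length_reduce: "length (reduce w) \<le> length w"
proof (induction w)
  case (Cons x w)
  have "length (cons_reduce x v) \<le> Suc (length v)" for v by (cases v) auto
  then have "length (cons_reduce x (reduce w)) \<le> Suc (length (reduce w))" .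
  then show ?case using Cons by (simp add: reduce_def)
qed auto

lemma carrier_F2 [simp]: "x \<in> carrier F2 \<longleftrightarrow> reduced x"
  by (simp add: F2_def)

lemma mult_F2 [simp]: "u \<otimes>\<^bsub>F2\<^esub> v = reduce (u @ v)"
  by (simp add: F2_def)

lemma one_F2 [simp]: "\<one>\<^bsub>F2\<^esub> = []"
  by (simp add: F2_def)

interpretation F2: group F2
proof (rule groupI)
  fix x assume "x \<in> carrier F2"
  then show "\<exists>y\<in>carrier F2. y \<otimes>\<^bsub>F2\<^esub> x = \<one>\<^bsub>F2\<^esub>"
    by (intro bexI[of _ "inv_word x"]) (auto simp: reduced_inv_word)
qed (auto simp: reduce_reduced)

lemma inv_F2: "reduced w \<Longrightarrow> inv\<^bsub>F2\<^esub> w = inv_word w"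
  by (rule F2.inv_equality) (auto simp: reduced_inv_word)

subsection \<open>Substitutions\<close>

text \<open>The unreduced form of \<open>endo\<close>, defined on all words so that compositions
  carry no carrier conditions.\<close>

definition subst :: "word \<Rightarrow> word \<Rightarrow> word \<Rightarrow> word" where
  "subst u v w = concat (map (subst_letter u v) w)"

lemma subst_simps [simp]:
  "subst u v [] = []" "subst u v (x # w) = subst_letter u v x @ subst u v w"
  "subst u v (w @ w') = subst u v w @ subst u v w'"
  by (auto simp: subst_def)

lemma subst_letter_inv: "subst_letter u v (inv_letter x) = inv_word (subst_letter u v x)"
  by (cases x) auto

lemma subst_inv_word: "subst u v (inv_word w) = inv_word (subst u v w)"
  by (induction w) (auto simp: subst_letter_inv)

lemma reduce_subst_reduce [simp]: "reduce (subst u v (reduce w)) = reduce (subst u v w)"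
proof (induction w)
  case (Cons x w)
  have "reduce (subst u v (cons_reduce x z)) = reduce (subst_letter u v x @ subst u v z)" for z
    by (cases z) (auto simp: subst_letter_inv)
  then have "reduce (subst u v (reduce (x # w))) = reduce (subst_letter u v x @ subst u v (reduce w))"
    by (simp add: reduce_def)
  also have "\<dots> = reduce (subst_letter u v x @ subst u v w)"
    by (rule reduce_cong) (auto simp: Cons)
  finally show ?case by simp
qed auto

lemma subst_subst: "subst u v (subst u' v' w) = subst (subst u v u') (subst u v v') w"
proof (induction w)
  case (Cons x w)
  then show ?case by (cases x) (auto simp: subst_inv_word)
qed auto

lemma subst_id: "subst [\<a>] [\<b>] w = w"
proof (induction w)
  case (Cons x w)
  then show ?case by (cases x) auto
qed auto

lemma subst_reduce_gens: "reduce (subst u v w) = reduce (subst (reduce u) (reduce v) w)"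
proof (induction w)
  case (Cons x w)
  have "reduce (subst_letter u v x) = reduce (subst_letter (reduce u) (reduce v) x)"
    by (cases x) (auto simp: reduce_inv_word)
  then show ?case using Cons by (auto intro: reduce_cong)
qed auto

lemma endo_eq: "reduced w \<Longrightarrow> endo u v w = reduce (subst u v w)"
  by (simp add: endo_def subst_def)

lemma endo_hom: "endo u v \<in> hom F2 F2"
  by (rule homI) (auto simp: endo_eq)

lemma hom_eq_subst:
  assumes "f \<in> hom F2 F2" "reduced w"
  shows "f w = reduce (subst (f [\<a>]) (f [\<b>]) w)"
  using assms(2)
proof (induction w)
  case Nil
  then show ?case using hom_one[OF assms(1) F2.is_group F2.is_group] by simp
next
  case (Cons x w)
  have w: "reduced w" "reduced [x]" using Cons.prems by (auto simp: reduced_Cons)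
  have red: "reduced (f v)" if "reduced v" for v using assms(1) that by (auto simp: hom_def Pi_def)
  have inv: "f (inv_word v) = inv_word (f v)" if "reduced v" for v
  proof -
    interpret group_hom F2 F2 f by unfold_locales (rule assms(1))
    show ?thesis using hom_inv[of v] that by (simp add: inv_F2 red)
  qed
  have "f ([x] \<otimes>\<^bsub>F2\<^esub> w) = f [x] \<otimes>\<^bsub>F2\<^esub> f w"
    by (rule hom_mult[OF assms(1)]) (use w in auto)
  moreover have "reduce ([x] @ w) = x # w" using reduce_reduced[OF Cons.prems] by simp
  ultimately have "f (x # w) = reduce (f [x] @ f w)" by simp
  moreover have "f [x] = subst_letter (f [\<a>]) (f [\<b>]) x"
    using inv[of "[\<a>]"] inv[of "[\<b>]"] by (cases x) (auto simp: reduced_Cons)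
  ultimately show ?case using Cons.IH[OF w(1)] by simp
qed

lemma hom_ext:
  assumes "f \<in> hom F2 F2" "g \<in> hom F2 F2" "f \<in> extensional (carrier F2)" "g \<in> extensional (carrier F2)"
    "f [\<a>] = g [\<a>]" "f [\<b>] = g [\<b>]"
  shows "f = g"
proof (rule extensionalityI[OF assms(3,4)])
  fix x assume "x \<in> carrier F2"
  then show "f x = g x" using hom_eq_subst assms by (metis carrier_F2)
qed

text \<open>\<open>u'\<close> and \<open>v'\<close> are the images of the generators under the
  inverse; both composites need checking only on the generators.\<close>

lemma endo_auto:
  assumes "reduce (subst u v u') = [\<a>]" "reduce (subst u v v') = [\<b>]"
    "reduce (subst u' v' u) = [\<a>]" "reduce (subst u' v' v) = [\<b>]"
  shows "endo u v \<in> auto F2"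
proof -
  have id: "reduce (subst u v (subst u' v' w)) = w" "reduce (subst u' v' (subst u v w)) = w"
    if "reduced w" for w
  proof -
    have "reduce (subst u v (subst u' v' w)) = reduce (subst [\<a>] [\<b>] w)"
      unfolding subst_subst using assms subst_reduce_gens by metis
    then show "reduce (subst u v (subst u' v' w)) = w" using that by (simp add: subst_id reduce_reduced)
    have "reduce (subst u' v' (subst u v w)) = reduce (subst [\<a>] [\<b>] w)"
      unfolding subst_subst using assms subst_reduce_gens by metis
    then show "reduce (subst u' v' (subst u v w)) = w" using that by (simp add: subst_id reduce_reduced)
  qed
  have "bij_betw (endo u v) (carrier F2) (carrier F2)"
    by (rule bij_betw_byWitness[where f' = "endo u' v'"]) (auto simp: endo_eq id)
  moreover have "endo u v \<in> extensional (carrier F2)" by (simp add: endo_def)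
  ultimately show ?thesis unfolding auto_def Bij_def using endo_hom by auto
qed

subsection \<open>Conjugacy classes up to inversion\<close>

text \<open>\<open>curve_of\<close> freed from the carrier: neither the representative nor the
  conjugating word has to be reduced.\<close>

definition conj_class :: "word \<Rightarrow> word set" where
  "conj_class w = (\<Union>g. {reduce (g @ w @ inv_word g), reduce (g @ inv_word w @ inv_word g)})"

lemma conj_class_reduce: "conj_class (reduce w) = conj_class w"
proof -
  have "reduce (g @ reduce w @ inv_word g) = reduce (g @ w @ inv_word g)"
    "reduce (g @ inv_word (reduce w) @ inv_word g) = reduce (g @ inv_word w @ inv_word g)" for g
    by (auto intro!: reduce_cong simp flip: reduce_inv_word)
  then show ?thesis by (simp add: conj_class_def)
qed

lemma curve_of_eq: "reduced w \<Longrightarrow> curve_of w = conj_class w"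
proof (intro equalityI subsetI)
  fix x assume w: "reduced w" and "x \<in> curve_of w"
  then obtain g where "reduced g" "x = reduce (g @ w @ inv_word g) \<or> x = reduce (g @ inv_word w @ inv_word g)"
    unfolding curve_of_def by (auto simp: inv_F2)
  then show "x \<in> conj_class w" by (auto simp: conj_class_def)
next
  fix x assume w: "reduced w" and "x \<in> conj_class w"
  then obtain g where g: "x = reduce (g @ w @ inv_word g) \<or> x = reduce (g @ inv_word w @ inv_word g)"
    unfolding conj_class_def by auto
  have "reduce (reduce g @ v @ inv_word (reduce g)) = reduce (g @ v @ inv_word g)" for v
    by (intro reduce_cong) (auto simp flip: reduce_inv_word)
  then have "x = reduce (reduce g @ w @ inv_word (reduce g)) \<or> x = reduce (reduce g @ inv_word w @ inv_word (reduce g))"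
    using g by simp
  then show "x \<in> curve_of w" unfolding curve_of_def using w
    by (auto simp: inv_F2) (metis inv_F2 reduced_reduce reduce_append_left append_assoc)+
qed

lemma curves_eq: "curves = range conj_class"
proof -
  have "range conj_class = conj_class ` {w. reduced w}"
    by (auto simp: image_iff) (metis conj_class_reduce reduced_reduce)
  then show ?thesis unfolding curves_def using curve_of_eq by (auto simp: F2_def)
qed

lemma reduce_in_conj_class: "reduce w \<in> conj_class w"
  by (auto simp: conj_class_def intro!: exI[of _ "[]"])

lemma conj_class_conj: "conj_class (g @ w @ inv_word g) = conj_class w"
proof -
  have 1: "conj_class (g @ w @ inv_word g) \<subseteq> conj_class w" for g w
  proof
    fix x assume "x \<in> conj_class (g @ w @ inv_word g)"
    then obtain h where "x = reduce ((h @ g) @ w @ inv_word (h @ g)) \<or> x = reduce ((h @ g) @ inv_word w @ inv_word (h @ g))"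
      by (auto simp: conj_class_def)
    then show "x \<in> conj_class w" unfolding conj_class_def by blast
  qed
  have "conj_class w = conj_class (reduce (inv_word g @ (g @ w @ inv_word g) @ inv_word (inv_word g)))"
    by (simp add: conj_class_reduce) (metis append_assoc conj_class_reduce inv_word_simps(4) reduce_append_right reduce_cancel_end(2) append_Nil2)
  then show ?thesis using 1 unfolding conj_class_reduce by blast
qed

lemma conj_class_inv: "conj_class (inv_word w) = conj_class w"
  by (auto simp: conj_class_def)

lemma conj_class_rotate: "conj_class (u @ v) = conj_class (v @ u)"
proof -
  have "conj_class (v @ u) = conj_class (u @ (v @ u) @ inv_word u)" by (rule conj_class_conj[symmetric])
  also have "\<dots> = conj_class (reduce (u @ v @ u @ inv_word u))" by (simp add: conj_class_reduce)
  also have "reduce (u @ v @ u @ inv_word u) = reduce (u @ v)"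
    using reduce_cong[of "u @ v" _ "u @ inv_word u" "[]"] by simp
  finally show ?thesis by (simp add: conj_class_reduce)
qed

lemma conj_class_cong: "reduce w = reduce w' \<Longrightarrow> conj_class w = conj_class w'"
  by (metis conj_class_reduce)

lemma conj_class_eqD:
  assumes "conj_class w = conj_class w'"
  shows "\<exists>g. reduce w = reduce (g @ w' @ inv_word g) \<or> reduce w = reduce (g @ inv_word w' @ inv_word g)"
  using reduce_in_conj_class[of w] unfolding assms by (auto simp: conj_class_def)

section \<open>Cyclically reduced representatives and the length of a curve\<close>

lemma ex_cyclically_reduced: "\<exists>v. cyclically_reduced v \<and> conj_class v = conj_class w"
proof (induction "length w" arbitrary: w rule: less_induct)
  case less
  show ?case
  proof (cases "cyclically_reduced (reduce w)")
    case True
    then show ?thesis using conj_class_reduce by blast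
  next
    case False
    let ?v = "reduce w"
    have v: "?v \<noteq> []" "hd ?v = inv_letter (last ?v)" using False by (auto simp: cyclically_reduced_def)
    then obtain x m where xm: "?v = x # m" by (cases ?v) auto
    have "m \<noteq> []" using v xm by auto
    then obtain m' y where "m = m' @ [y]" by (meson rev_exhaust)
    then have eq: "?v = [inv_letter y] @ m' @ inv_word [inv_letter y]" using v xm by auto
    have "length m' < length w" using arg_cong[OF eq, of length] length_reduce[of w] by simp
    then obtain u where "cyclically_reduced u" "conj_class u = conj_class m'" using less by blast
    moreover have "conj_class m' = conj_class w"
      using conj_class_conj[of "[inv_letter y]" m'] conj_class_reduce[of w] eq by metis
    ultimately show ?thesis by auto
  qed
qed

lemma reduced_power:
  assumes "cyclically_reduced w"
  shows "reduced (concat (replicate n w))"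
proof (cases "w = []")
  case False
  have "reduced (concat (replicate n w)) \<and> (n > 0 \<longrightarrow> hd (concat (replicate n w)) = hd w)"
  proof (induction n)
    case (Suc n)
    have "concat (replicate n w) \<noteq> []" if "n > 0" using that False by (cases n) auto
    then show ?case using Suc assms False
      by (cases "n = 0") (auto simp: reduced_append cyclically_reduced_def)
  qed auto
  then show ?thesis by blast
qed auto

lemma reduce_power_conj:
  "reduce (concat (replicate n (g @ w @ inv_word g))) = reduce (g @ concat (replicate n w) @ inv_word g)"
proof (induction n)
  case (Suc n)
  have "reduce (concat (replicate (Suc n) (g @ w @ inv_word g)))
      = reduce ((g @ w @ inv_word g) @ (g @ concat (replicate n w) @ inv_word g))"
    using Suc by (auto intro!: reduce_cong)
  also have "\<dots> = reduce ((g @ w) @ (inv_word g @ g @ concat (replicate n w) @ inv_word g))" by simp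
  also have "\<dots> = reduce ((g @ w) @ (concat (replicate n w) @ inv_word g))"
    by (rule reduce_cong) (simp_all only: reduce_cancel)
  finally show ?case by simp
qed auto

lemma reduce_power_cong: "reduce u = reduce v \<Longrightarrow> reduce (concat (replicate n u)) = reduce (concat (replicate n v))"
  by (induction n) (auto intro: reduce_cong)

text \<open>Comparing the lengths of large powers shows that conjugation cannot shorten a cyclically
  reduced word.\<close>
lemma cyclically_reduced_length_le:
  assumes "cyclically_reduced w'" "reduce w' = reduce (g @ w @ inv_word g)"
  shows "length w' \<le> length w"
proof (rule ccontr)
  assume "\<not> ?thesis"
  then have lt: "Suc (length w) \<le> length w'" by simp
  define n where "n = Suc (2 * length g)"
  have "n * length w' = length (reduce (concat (replicate n w')))"
    using reduced_power[OF assms(1), of n] by (simp add: reduce_reduced length_concat sum_list_replicate)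
  also have "\<dots> = length (reduce (g @ concat (replicate n w) @ inv_word g))"
    using reduce_power_cong[OF assms(2)] reduce_power_conj by metis
  also have "\<dots> \<le> length (g @ concat (replicate n w) @ inv_word g)" by (rule length_reduce)
  also have "\<dots> = n * length w + 2 * length g" by (simp add: length_concat sum_list_replicate)
  finally have "n * length w' \<le> n * length w + 2 * length g" .
  moreover have "n * length w + n \<le> n * length w'" using mult_le_mono2[OF lt, of n] by simp
  ultimately show False by (simp add: n_def)
qed

lemma cyclically_reduced_length_unique:
  assumes "cyclically_reduced w" "cyclically_reduced w'" "conj_class w = conj_class w'"
  shows "length w = length w'"
proof -
  have "length u \<le> length v" if "cyclically_reduced u" "conj_class u = conj_class v" for u v
    using conj_class_eqD[OF that(2)] cyclically_reduced_length_le[OF that(1)] by force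
  then show ?thesis using assms by (metis order_antisym)
qed

lemma conj_class_member:
  assumes "v \<in> conj_class w"
  shows "conj_class v = conj_class w"
proof -
  obtain g where "v = reduce (g @ w @ inv_word g) \<or> v = reduce (g @ inv_word w @ inv_word g)"
    using assms by (auto simp: conj_class_def)
  then show ?thesis by (auto simp: conj_class_reduce conj_class_conj conj_class_inv)
qed

text \<open>Resolves the definite description: all cyclically reduced members of the class have the
  same length.\<close>

lemma curve_length_eq:
  assumes "cyclically_reduced w"
  shows "curve_length (conj_class w) = length w"
proof -
  have "w \<in> conj_class w" using reduce_in_conj_class[of w] assms
    by (simp add: reduce_reduced cyclically_reduced_def)
  then show ?thesis unfolding curve_length_def
    using assms cyclically_reduced_length_unique[OF _ assms] conj_class_member
    by (intro the_equality) blast+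
qed

text \<open>Surjectivity of \<open>f\<close> enters in the second inclusion, where the conjugating
  element is pulled back.\<close>

lemma auto_conj_class:
  assumes "f \<in> auto F2"
  shows "f ` conj_class w = conj_class (subst (f [\<a>]) (f [\<b>]) w)"
proof -
  let ?s = "subst (f [\<a>]) (f [\<b>])"
  have hom: "f \<in> hom F2 F2" and bij: "bij_betw f (carrier F2) (carrier F2)"
    using assms by (auto simp: auto_def Bij_def)
  have f: "f (reduce v) = reduce (?s v)" for v using hom_eq_subst[OF hom, of "reduce v"] by simp
  have fg: "f (reduce (g @ v @ inv_word g)) = reduce (reduce (?s g) @ ?s v @ inv_word (reduce (?s g)))" for g v
  proof -
    have "reduce (?s g @ ?s v @ inv_word (?s g)) = reduce (reduce (?s g) @ ?s v @ inv_word (reduce (?s g)))"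
      by (intro reduce_cong) (auto simp flip: reduce_inv_word)
    then show ?thesis by (simp add: f subst_inv_word)
  qed
  show ?thesis
  proof (intro equalityI subsetI)
    fix x assume "x \<in> f ` conj_class w"
    then obtain g where "x = f (reduce (g @ w @ inv_word g)) \<or> x = f (reduce (g @ inv_word w @ inv_word g))"
      by (auto simp: conj_class_def)
    then show "x \<in> conj_class (?s w)" unfolding fg subst_inv_word conj_class_def by blast
  next
    fix x assume "x \<in> conj_class (?s w)"
    then obtain h where h: "x = reduce (h @ ?s w @ inv_word h) \<or> x = reduce (h @ inv_word (?s w) @ inv_word h)"
      by (auto simp: conj_class_def)
    obtain g where g: "reduced g" "f g = reduce h"
      using bij unfolding bij_betw_def by (metis carrier_F2 imageE reduced_reduce)
    have "reduce (?s g) = reduce h" using f[of g] g by (simp add: reduce_reduced)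
    moreover have "reduce (h @ v @ inv_word h) = reduce (reduce h @ v @ inv_word (reduce h))" for v
      by (intro reduce_cong) (auto simp flip: reduce_inv_word)
    ultimately have "x = f (reduce (g @ w @ inv_word g)) \<or> x = f (reduce (g @ inv_word w @ inv_word g))"
      using h fg[of g w] fg[of g "inv_word w"] by (simp add: subst_inv_word)
    then show "x \<in> f ` conj_class w" unfolding conj_class_def by blast
  qed
qed

section \<open>Cyclic words\<close>

definition cyc :: "'x list \<Rightarrow> nat \<Rightarrow> 'x" where
  "cyc xs i = xs ! (i mod length xs)"

text \<open>Windows of three letters see patterns such as \<open>BaB\<close>. On words shorter than
  three letters a window wraps around and repeats letters, which is the correct count on the cyclic
  word.\<close>

definition cyc_sum :: "('x \<Rightarrow> 'x \<Rightarrow> 'x \<Rightarrow> int) \<Rightarrow> 'x list \<Rightarrow> int" where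
  "cyc_sum f xs = (\<Sum>i<length xs. f (cyc xs i) (cyc xs (i + 1)) (cyc xs (i + 2)))"

text \<open>The same count without wrap-around; unlike the cyclic one it can be cut, at an overlap
  of two letters, and so admits induction.\<close>

fun lin_sum :: "('x \<Rightarrow> 'x \<Rightarrow> 'x \<Rightarrow> int) \<Rightarrow> 'x list \<Rightarrow> int" where
  "lin_sum f (x # y # z # r) = f x y z + lin_sum f (y # z # r)"
| "lin_sum f _ = 0"

lemma lin_sum_append: "lin_sum f (u @ y # z # v) = lin_sum f (u @ [y, z]) + lin_sum f (y # z # v)"
proof (induction u)
  case (Cons x u)
  then show ?case by (cases u; cases "tl u") auto
qed auto

lemma lin_sum_eq: "lin_sum f xs = (\<Sum>i<length xs - 2. f (xs ! i) (xs ! (i + 1)) (xs ! (i + 2)))"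
proof (induction f xs rule: lin_sum.induct)
  case (1 f x y z r)
  then show ?case by (simp add: sum.lessThan_Suc_shift del: sum.lessThan_Suc)
qed auto

lemma cyc_sum_eq_lin_sum:
  assumes "xs \<noteq> []"
  shows "cyc_sum f xs = lin_sum f (xs @ [cyc xs 0, cyc xs 1])"
proof -
  let ?ys = "xs @ [cyc xs 0, cyc xs 1]"
  have "?ys ! j = cyc xs j" if "j < length xs + 2" for j
  proof -
    consider "j < length xs" | "j = length xs" | "j = length xs + 1" using \<open>j < length xs + 2\<close> by linarith
    then show ?thesis
    proof cases
      case 3
      then have "j mod length xs = 1 mod length xs" using mod_add_self2[of 1 "length xs"] by (simp add: add.commute)
      then show ?thesis using 3 by (simp add: cyc_def nth_append)
    qed (auto simp: cyc_def nth_append)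
  qed
  then show ?thesis unfolding cyc_sum_def lin_sum_eq by (intro sum.cong) auto
qed

lemma cyc_periodic: "cyc xs (i + length xs) = cyc xs i"
  by (simp add: cyc_def)

lemma cyc_shift_sum:
  fixes h :: "nat \<Rightarrow> int"
  assumes "h n = h 0"
  shows "(\<Sum>i<n. h (i + 1)) = (\<Sum>i<n. h i)"
proof -
  have "h 0 + (\<Sum>i<n. h (i + 1)) = (\<Sum>i<n. h i) + h n"
    using sum.lessThan_Suc_shift[of h n] sum.lessThan_Suc[of h n] by simp
  then show ?thesis using assms by simp
qed

lemma cyc_rotate1:
  assumes "xs \<noteq> []"
  shows "cyc (rotate1 xs) i = cyc xs (i + 1)"
proof -
  have "i mod length xs < length xs" using assms by simp
  then show ?thesis unfolding cyc_def by (simp add: nth_rotate1 mod_Suc_eq)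
qed

lemma cyc_sum_rotate1: "cyc_sum f (rotate1 xs) = cyc_sum f xs"
proof -
  define h where "h i = f (cyc xs i) (cyc xs (i + 1)) (cyc xs (i + 2))" for i
  have "h (length xs) = h 0"
    using cyc_periodic[of xs 0] cyc_periodic[of xs 1] cyc_periodic[of xs 2] by (simp add: h_def numeral_2_eq_2)
  then have "(\<Sum>i<length xs. h (i + 1)) = (\<Sum>i<length xs. h i)" by (rule cyc_shift_sum)
  then show ?thesis by (cases "xs = []") (simp_all add: cyc_sum_def h_def cyc_rotate1)
qed

lemma cyc_sum_rotate: "cyc_sum f (u @ v) = cyc_sum f (v @ u)"
proof -
  have "cyc_sum f (rotate n xs) = cyc_sum f xs" for n xs
    by (induction n) (auto simp: cyc_sum_rotate1)
  then show ?thesis by (metis rotate_append)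
qed

lemma cyc_map: "xs \<noteq> [] \<Longrightarrow> cyc (map g xs) i = g (cyc xs i)"
  by (simp add: cyc_def)

lemma cyc_sum_map: "cyc_sum f (map g xs) = cyc_sum (\<lambda>x y z. f (g x) (g y) (g z)) xs"
  by (cases "xs = []") (simp_all add: cyc_sum_def cyc_map)

lemma cyc_sum_nonneg: "(\<And>x y z. f x y z \<ge> 0) \<Longrightarrow> cyc_sum f xs \<ge> 0"
  unfolding cyc_sum_def by (intro sum_nonneg) auto

lemma cyc_sum_eq_0_iff:
  assumes "\<And>x y z. f x y z \<ge> 0" "xs \<noteq> []"
  shows "cyc_sum f xs = 0 \<longleftrightarrow> (\<forall>i. f (cyc xs i) (cyc xs (i + 1)) (cyc xs (i + 2)) = 0)"
proof -
  have "cyc_sum f xs = 0 \<longleftrightarrow> (\<forall>i<length xs. f (cyc xs i) (cyc xs (i + 1)) (cyc xs (i + 2)) = 0)"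
    unfolding cyc_sum_def using assms(1) by (subst sum_nonneg_eq_0_iff) auto
  also have "\<dots> \<longleftrightarrow> (\<forall>i. f (cyc xs i) (cyc xs (i + 1)) (cyc xs (i + 2)) = 0)"
  proof (intro iffI allI)
    fix i
    assume *: "\<forall>i<length xs. f (cyc xs i) (cyc xs (i + 1)) (cyc xs (i + 2)) = 0"
    have "cyc xs (i mod length xs + j) = cyc xs (i + j)" for j
      by (simp add: cyc_def mod_add_left_eq)
    from this[of 0] this[of 1] this[of 2]
    show "f (cyc xs i) (cyc xs (i + 1)) (cyc xs (i + 2)) = 0"
      using *[rule_format, of "i mod length xs"] assms(2) by simp
  qed auto
  finally show ?thesis .
qed

definition backtracks :: "letter \<Rightarrow> letter \<Rightarrow> letter \<Rightarrow> int" where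
  "backtracks x y z = of_bool (y = inv_letter x)"

text \<open>As the vanishing of a window count, cyclic reducedness is visibly invariant under
  rotation and compatible with letter permutations.\<close>

lemma cyclically_reduced_iff: "cyclically_reduced w \<longleftrightarrow> cyc_sum backtracks w = 0"
proof (cases "w = []")
  case True
  then show ?thesis by (simp add: cyclically_reduced_def cyc_sum_def)
next
  case False
  have lin: "lin_sum backtracks (u @ [y, z]) \<ge> 0 \<and>
      (lin_sum backtracks (u @ [y, z]) = 0 \<longleftrightarrow> reduced (u @ [y]))" for u y z
  proof (induction u)
    case (Cons x u)
    then show ?case by (cases u; cases "tl u") (auto simp: backtracks_def reduced_Cons)
  qed (auto simp: reduced_Cons)
  have "cyclically_reduced w \<longleftrightarrow> reduced (w @ [cyc w 0])"
    using False by (auto simp: cyclically_reduced_def reduced_append reduced_Cons cyc_def hd_conv_nth)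
  then show ?thesis unfolding cyc_sum_eq_lin_sum[OF False] using lin[of w] by auto
qed

lemma cyclically_reduced_rotate: "cyclically_reduced (u @ v) \<longleftrightarrow> cyclically_reduced (v @ u)"
  unfolding cyclically_reduced_iff by (simp add: cyc_sum_rotate[of _ u v])

subsection \<open>Block decomposition\<close>

definition bpow :: "bool \<Rightarrow> letter" where
  "bpow e = (if e then \<b> else \<B>)"

definition asgn :: "int \<Rightarrow> letter" where
  "asgn k = (if k > 0 then \<a> else \<A>)"

definition apow :: "int \<Rightarrow> word" where
  "apow k = replicate (nat \<bar>k\<bar>) (asgn k)"

text \<open>A block \<open>(e, k)\<close> stands for \<open>b\<^sup>\<plusminus>\<^sup>1 a\<^sup>k\<close>; every cyclic word containing the letter \<open>b\<close> is a cyclic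
  product of blocks.\<close>
definition blocks :: "(bool \<times> int) list \<Rightarrow> word" where
  "blocks xs = concat (map (\<lambda>(e, k). bpow e # apow k) xs)"

lemma blocks_simps [simp]: "blocks [] = []" "blocks ((e, k) # xs) = bpow e # apow k @ blocks xs"
  by (auto simp: blocks_def)

lemma apow_0 [simp]: "apow 0 = []"
  by (simp add: apow_def)

text \<open>The two letters that begin block \<open>x\<close> when block \<open>y\<close> follows;
  after an exponent 0 the second letter already belongs to \<open>y\<close>.\<close>

definition two_letters :: "bool \<times> int \<Rightarrow> bool \<times> int \<Rightarrow> word" where
  "two_letters x y = [bpow (fst x), if snd x = 0 then bpow (fst y) else asgn (snd x)]"

text \<open>The windows starting inside block \<open>x\<close>. They reach at most two letters
  further, so two following blocks determine them.\<close>

definition block_sum :: "(letter \<Rightarrow> letter \<Rightarrow> letter \<Rightarrow> int) \<Rightarrow> bool \<times> int \<Rightarrow> bool \<times> int \<Rightarrow> bool \<times> int \<Rightarrow> int" where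
  "block_sum f x y z = lin_sum f (bpow (fst x) # apow (snd x) @ two_letters y z)"

lemma blocks_two_letters:
  "\<exists>v. blocks xs @ two_letters y z @ u = two_letters ((xs @ [y, z]) ! 0) ((xs @ [y, z]) ! 1) @ v"
proof (cases xs)
  case (Cons x xs')
  obtain e k where x: "x = (e, k)" by (cases x)
  show ?thesis
  proof (cases "k = 0")
    case True
    have "\<exists>v. blocks xs' @ two_letters y z @ u = bpow (fst ((xs' @ [y, z]) ! 0)) # v"
      by (cases xs') (auto simp: two_letters_def)
    then show ?thesis using Cons x True by (auto simp: two_letters_def)
  next
    case False
    then obtain n where "nat \<bar>k\<bar> = Suc n" by (metis abs_le_zero_iff not0_implies_Suc not_le nat_eq_iff2 zless_nat_eq_int_zless int_ops(1) nat_0_iff)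
    then show ?thesis using Cons x False by (auto simp: two_letters_def apow_def)
  qed
qed auto

lemma lin_sum_blocks:
  "lin_sum f (blocks xs @ two_letters y z) = lin_sum (block_sum f) (xs @ [y, z])"
proof (induction xs)
  case Nil
  then show ?case by (simp add: two_letters_def)
next
  case (Cons x xs)
  obtain e k where x: "x = (e, k)" by (cases x)
  define y' z' where "y' = (xs @ [y, z]) ! 0" and "z' = (xs @ [y, z]) ! 1"
  obtain v where v: "blocks xs @ two_letters y z = two_letters y' z' @ v"
    using blocks_two_letters[of xs y z "[]"] unfolding y'_def z'_def by auto
  have "lin_sum f (blocks (x # xs) @ two_letters y z) = lin_sum f ((bpow e # apow k) @ two_letters y' z' @ v)"
    by (simp add: x v)
  also have "\<dots> = lin_sum f ((bpow e # apow k) @ two_letters y' z') + lin_sum f (two_letters y' z' @ v)"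
  proof -
    obtain y1 z1 where "two_letters y' z' = [y1, z1]" by (auto simp: two_letters_def)
    then show ?thesis using lin_sum_append[of f "bpow e # apow k" y1 z1 v] by simp
  qed
  also have "\<dots> = block_sum f x y' z' + lin_sum (block_sum f) (xs @ [y, z])"
    using Cons v by (simp add: x block_sum_def[of f "(e, k)" y' z'])
  also have "\<dots> = lin_sum (block_sum f) (x # xs @ [y, z])"
    unfolding y'_def z'_def by (cases xs; cases "tl xs") auto
  finally show ?case by simp
qed

text \<open>A window count over letters becomes a window count over blocks, so identities between
  counts can be verified block by block.\<close>

lemma cyc_sum_blocks:
  assumes "xs \<noteq> []"
  shows "cyc_sum f (blocks xs) = cyc_sum (block_sum f) xs"
proof -
  let ?y = "cyc xs 0" and ?z = "cyc xs 1"
  have ne: "blocks xs \<noteq> []" using assms by (cases xs) auto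
  obtain v where v: "blocks xs @ two_letters ?y ?z @ [] =
      two_letters ((xs @ [?y, ?z]) ! 0) ((xs @ [?y, ?z]) ! 1) @ v"
    using blocks_two_letters by blast
  have "(xs @ [?y, ?z]) ! 0 = ?y" "(xs @ [?y, ?z]) ! 1 = ?z"
    using assms by (cases xs; cases "tl xs"; simp add: cyc_def)+
  then have v: "blocks xs @ two_letters ?y ?z = two_letters ?y ?z @ v" using v by simp
  have "[cyc (blocks xs) 0, cyc (blocks xs) 1] = two_letters ?y ?z"
  proof (cases "length (blocks xs) \<ge> 2")
    case True
    then have "(blocks xs) ! 0 = two_letters ?y ?z ! 0" "(blocks xs) ! 1 = two_letters ?y ?z ! 1"
      using arg_cong[OF v, of "\<lambda>l. l ! 0"] arg_cong[OF v, of "\<lambda>l. l ! 1"] ne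
      by (auto simp: nth_append two_letters_def)
    then show ?thesis using True by (simp add: cyc_def two_letters_def)
  next
    case False
    \<comment> \<open>A word of one letter is a single block of exponent 0, whose successor is
      itself.\<close>
    then obtain x where x: "blocks xs = [x]" using ne by (cases "blocks xs"; cases "tl (blocks xs)") auto
    obtain e k xs' where xs: "xs = (e, k) # xs'" using assms by (cases xs) auto
    then have "apow k = []" "blocks xs' = []" "x = bpow e" using x by auto
    then have "k = 0" "xs' = []" "x = bpow e" by (auto simp: apow_def) (cases xs'; auto)
    then show ?thesis unfolding x xs by (simp add: cyc_def two_letters_def)
  qed
  then show ?thesis
    using lin_sum_blocks[of f xs ?y ?z] cyc_sum_eq_lin_sum[OF ne] cyc_sum_eq_lin_sum[OF assms] by simp
qed

lemma lin_sum_replicate: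
  "lin_sum f (x # replicate n s @ [y, z]) =
    (if n = 0 then f x y z else if n = 1 then f x s y + f s y z
     else f x s s + int (n - 2) * f s s s + f s s y + f s y z)"
proof (cases n)
  case (Suc m)
  have *: "lin_sum f (replicate (Suc m) s @ [y, z]) =
     (if m = 0 then f s y z else int (m - 1) * f s s s + f s s y + f s y z)" for m
  proof (induction m)
    case (Suc m)
    then show ?case by (cases m) (auto simp: algebra_simps)
  qed auto
  have "lin_sum f (x # replicate (Suc m) s @ [y, z]) =
     (if m = 0 then f x s y else f x s s) + lin_sum f (replicate (Suc m) s @ [y, z])"
    by (cases m) auto
  then show ?thesis unfolding Suc * by auto
qed auto

lemma block_sum_eq:
  "block_sum f (e, k) (e', k') z =
    (let x = bpow e; s = asgn k; y = bpow e'; w = (if k' = 0 then bpow (fst z) else asgn k') in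
     if k = 0 then f x y w else if \<bar>k\<bar> = 1 then f x s y + f s y w
     else f x s s + (\<bar>k\<bar> - 2) * f s s s + f s s y + f s y w)"
proof -
  have "nat \<bar>k\<bar> = 0 \<longleftrightarrow> k = 0" "nat \<bar>k\<bar> = 1 \<longleftrightarrow> \<bar>k\<bar> = 1" by auto
  moreover have "int (nat \<bar>k\<bar> - 2) = \<bar>k\<bar> - 2" if "k \<noteq> 0" "\<bar>k\<bar> \<noteq> 1" using that by linarith
  ultimately show ?thesis
    unfolding block_sum_def two_letters_def apow_def fst_conv snd_conv lin_sum_replicate Let_def
    by auto
qed

section \<open>Letter counts and local patterns\<close>

definition num_a :: "letter \<Rightarrow> letter \<Rightarrow> letter \<Rightarrow> int" where
  "num_a x y z = of_bool (x \<in> {\<a>, \<A>})"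

definition num_b :: "letter \<Rightarrow> letter \<Rightarrow> letter \<Rightarrow> int" where
  "num_b x y z = of_bool (x \<in> {\<b>, \<B>})"

definition turns :: "letter \<Rightarrow> letter \<Rightarrow> letter \<Rightarrow> int" where
  "turns x y z = of_bool (x \<in> {\<A>, \<B>} \<and> y \<in> {\<a>, \<b>})"

text \<open>The turns destroyed by the first twist: \<open>BaB\<close> goes to \<open>BAaBA\<close>
  and \<open>bAb\<close> to \<open>abAab\<close>, where the letters \<open>a\<close> and
  \<open>A\<close> cancel.\<close>

definition bab :: "letter \<Rightarrow> letter \<Rightarrow> letter \<Rightarrow> int" where
  "bab x y z = of_bool ((x, y, z) \<in> {(\<B>, \<a>, \<B>), (\<b>, \<A>, \<b>)})"

text \<open>These mark exponents that the first twist may shrink towards a \<open>bab\<close>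
  pattern, so that a turn may be lost under a later power.\<close>

definition baa :: "letter \<Rightarrow> letter \<Rightarrow> letter \<Rightarrow> int" where
  "baa x y z = of_bool ((x, y, z) \<in> {(\<B>, \<a>, \<a>), (\<b>, \<A>, \<A>)})"

definition aba :: "letter \<Rightarrow> letter \<Rightarrow> letter \<Rightarrow> int" where
  "aba x y z = of_bool ((x, y, z) \<in> {(\<A>, \<b>, \<A>), (\<a>, \<B>, \<a>)})"

definition abb :: "letter \<Rightarrow> letter \<Rightarrow> letter \<Rightarrow> int" where
  "abb x y z = of_bool ((x, y, z) \<in> {(\<A>, \<b>, \<b>), (\<a>, \<B>, \<B>)})"

lemma functional_nonneg:
  "num_a x y z \<ge> 0" "num_b x y z \<ge> 0" "turns x y z \<ge> 0" "bab x y z \<ge> 0" "baa x y z \<ge> 0"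
  "aba x y z \<ge> 0" "abb x y z \<ge> 0"
  by (auto simp: num_a_def num_b_def turns_def bab_def baa_def aba_def abb_def)

lemma length_eq_cyc_sum: "int (length w) = cyc_sum num_a w + cyc_sum num_b w"
proof -
  have "num_a x y z + num_b x y z = 1" for x y z
    by (cases x) (auto simp: num_a_def num_b_def)
  then show ?thesis by (simp add: cyc_sum_def flip: sum.distrib)
qed

lemma block_sum_num_a: "block_sum num_a (e, k) y z = \<bar>k\<bar>"
  by (cases y) (auto simp: block_sum_eq Let_def num_a_def bpow_def asgn_def)

lemma block_sum_num_b: "block_sum num_b (e, k) y z = 1"
  by (cases y) (auto simp: block_sum_eq Let_def num_b_def bpow_def asgn_def)

lemma block_sum_turns:
  "block_sum turns (e, k) (e', k') z = of_bool (if e then e' \<and> k < 0 else e' \<or> k > 0)"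
  by (auto simp: block_sum_eq Let_def turns_def bpow_def asgn_def)

lemma block_sum_bab:
  "block_sum bab (e, k) (e', k') z = of_bool (e = e' \<and> k = (if e then - 1 else 1))"
  by (auto simp: block_sum_eq Let_def bab_def bpow_def asgn_def)

lemma block_sum_baa:
  "block_sum baa (e, k) (e', k') z = of_bool (if e then k \<le> - 2 else k \<ge> 2)"
  by (auto simp: block_sum_eq Let_def baa_def bpow_def asgn_def)

lemma block_sum_aba:
  "block_sum aba (e, k) (e', k') z = of_bool (if e' then k < 0 \<and> k' < 0 else k > 0 \<and> k' > 0)"
  by (auto simp: block_sum_eq Let_def aba_def bpow_def asgn_def)

lemma block_sum_abb:
  "block_sum abb (e, k) (e', k') (e'', k'') =
    of_bool (k' = 0 \<and> (if e' then k < 0 \<and> e'' else k > 0 \<and> \<not> e''))"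
  by (auto simp: block_sum_eq Let_def abb_def bpow_def asgn_def)

lemma block_sum_backtracks:
  "block_sum backtracks (e, k) (e', k') z = of_bool (k = 0 \<and> e \<noteq> e')"
  by (auto simp: block_sum_eq Let_def backtracks_def bpow_def asgn_def)

lemmas block_sums = block_sum_num_a block_sum_num_b block_sum_turns block_sum_bab block_sum_baa
  block_sum_aba block_sum_abb block_sum_backtracks

definition sg :: "(bool \<times> int) list \<Rightarrow> nat \<Rightarrow> bool" where "sg xs i = fst (cyc xs i)"
definition ex :: "(bool \<times> int) list \<Rightarrow> nat \<Rightarrow> int" where "ex xs i = snd (cyc xs i)"

lemma cyc_sg_ex: "cyc xs i = (sg xs i, ex xs i)"
  by (simp add: sg_def ex_def)

lemma cyc_sum_blocks':
  "xs \<noteq> [] \<Longrightarrow> cyc_sum f (blocks xs) = (\<Sum>i<length xs. block_sum f (sg xs i, ex xs i)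
     (sg xs (i + 1), ex xs (i + 1)) (sg xs (i + 2), ex xs (i + 2)))"
  unfolding cyc_sg_ex[symmetric] cyc_sum_def[of "block_sum f", symmetric] by (rule cyc_sum_blocks)

lemma block_sum_nonneg:
  assumes "\<And>x y z. f x y z \<ge> 0"
  shows "block_sum f x y z \<ge> 0"
  unfolding block_sum_def lin_sum_eq by (intro sum_nonneg) (use assms in auto)

lemma cyc_sum_blocks_eq_0:
  assumes "\<And>x y z. f x y z \<ge> 0" "xs \<noteq> []"
  shows "cyc_sum f (blocks xs) = 0 \<longleftrightarrow> (\<forall>i. block_sum f (sg xs i, ex xs i)
     (sg xs (i + 1), ex xs (i + 1)) (sg xs (i + 2), ex xs (i + 2)) = 0)"
  unfolding cyc_sum_blocks[OF assms(2)] cyc_sg_ex[symmetric]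
  by (rule cyc_sum_eq_0_iff) (use assms block_sum_nonneg in auto)

lemma cyclically_reduced_blocks:
  assumes "xs \<noteq> []"
  shows "cyclically_reduced (blocks xs) \<longleftrightarrow> (\<forall>i. ex xs i = 0 \<longrightarrow> sg xs (i + 1) = sg xs i)"
  unfolding cyclically_reduced_iff
  by (subst cyc_sum_blocks_eq_0) (auto simp: backtracks_def assms block_sums)

subsection \<open>The action of the first twist on blocks\<close>

text \<open>Since \<open>L\<close> sends \<open>b\<close> to \<open>ab\<close> and \<open>B\<close>
  to \<open>BA\<close>, the exponent after \<open>b^e\<close> receives an \<open>a\<close> from a
  following \<open>b\<close> and an \<open>A\<close> from its own \<open>B\<close>.\<close>

definition gain :: "bool \<Rightarrow> bool \<Rightarrow> int" where
  "gain e e' = of_bool e' - of_bool (\<not> e)"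

text \<open>The twist keeps the signs of the blocks, hence also the gains, so its m-th power is a
  shift of the exponents linear in \<open>m\<close>.\<close>

definition twist :: "int \<Rightarrow> (bool \<times> int) list \<Rightarrow> (bool \<times> int) list" where
  "twist m xs = map (\<lambda>i. (sg xs i, ex xs i + m * gain (sg xs i) (sg xs (i + 1)))) [0..<length xs]"

lemma length_twist [simp]: "length (twist m xs) = length xs"
  by (simp add: twist_def)

lemma twist_eq_Nil [simp]: "twist m xs = [] \<longleftrightarrow> xs = []"
  by (simp add: twist_def)

lemma sg_mod: "sg xs (i mod length xs) = sg xs i" "sg xs (Suc (i mod length xs)) = sg xs (Suc i)"
  by (simp_all add: sg_def cyc_def mod_Suc_eq)

lemma ex_mod: "ex xs (i mod length xs) = ex xs i"
  by (simp add: ex_def cyc_def)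

lemma cyc_twist:
  assumes "xs \<noteq> []"
  shows "cyc (twist m xs) i = (sg xs i, ex xs i + m * gain (sg xs i) (sg xs (i + 1)))"
proof -
  have "i mod length xs < length xs" using assms by simp
  then show ?thesis unfolding cyc_def[of "twist m xs"] length_twist by (simp add: twist_def sg_mod ex_mod)
qed

lemma sg_twist: "xs \<noteq> [] \<Longrightarrow> sg (twist m xs) i = sg xs i"
  by (simp add: sg_def[of "twist m xs"] cyc_twist)

lemma ex_twist: "xs \<noteq> [] \<Longrightarrow> ex (twist m xs) i = ex xs i + m * gain (sg xs i) (sg xs (i + 1))"
  by (simp add: ex_def[of "twist m xs"] cyc_twist)

lemma twist_0: "twist 0 xs = xs"
proof (cases "xs = []")
  case False
  show ?thesis by (rule nth_equalityI) (auto simp: twist_def sg_def ex_def cyc_def)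
qed (simp add: twist_def)

lemma twist_twist: "twist m (twist m' xs) = twist (m + m') xs"
proof (cases "xs = []")
  case False
  show ?thesis by (rule nth_equalityI)
      (auto simp: twist_def[of m] twist_def[of "m + m'"] sg_twist ex_twist False algebra_simps)
qed (simp add: twist_def)

text \<open>Between blocks of opposite sign the gain is 0, so their nonzero exponent persists and no
  new cancellation arises.\<close>

lemma cyclically_reduced_twist:
  assumes "xs \<noteq> []" "cyclically_reduced (blocks xs)"
  shows "cyclically_reduced (blocks (twist m xs))"
  using assms by (auto simp: cyclically_reduced_blocks sg_twist ex_twist gain_def split: if_splits)

text \<open>A version of \<open>twist 1\<close> for induction: the sign of the block after the list
  is the parameter \<open>e'\<close> instead of being read cyclically.\<close>

fun twist_lin :: "(bool \<times> int) list \<Rightarrow> bool \<Rightarrow> (bool \<times> int) list" where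
  "twist_lin [] e' = []"
| "twist_lin ((e, k) # xs) e' = (e, k + gain e (case xs of [] \<Rightarrow> e' | x # _ \<Rightarrow> fst x)) # twist_lin xs e'"

lemma length_twist_lin [simp]: "length (twist_lin xs e') = length xs"
  by (induction xs e' rule: twist_lin.induct) auto

lemma nth_twist_lin:
  "i < length xs \<Longrightarrow> twist_lin xs e' ! i =
    (fst (xs ! i), snd (xs ! i) + gain (fst (xs ! i)) (if Suc i < length xs then fst (xs ! Suc i) else e'))"
proof (induction xs e' arbitrary: i rule: twist_lin.induct)
  case (2 e k xs e')
  then show ?case by (cases i; cases xs) auto
qed auto

lemma twist_lin_eq_twist:
  assumes "xs \<noteq> []"
  shows "twist_lin xs (fst (hd xs)) = twist 1 xs"
proof (rule nth_equalityI)
  fix i assume i: "i < length (twist_lin xs (fst (hd xs)))"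
  then have "sg xs (Suc i) = (if Suc i < length xs then fst (xs ! Suc i) else fst (hd xs))"
    by (auto simp: sg_def cyc_def hd_conv_nth assms not_less le_Suc_eq)
  then show "twist_lin xs (fst (hd xs)) ! i = twist 1 xs ! i"
    using i by (simp add: nth_twist_lin twist_def sg_def[of xs i] ex_def cyc_def)
qed auto

abbreviation L_subst :: "word \<Rightarrow> word" where "L_subst \<equiv> subst [\<a>] [\<a>, \<b>]"

text \<open>The letter \<open>a\<close> that \<open>L\<close> puts in front of a leading
  \<open>b\<close> and that the last block absorbs after rotation.\<close>

definition lead :: "bool \<Rightarrow> word" where "lead e = (if e then [\<a>] else [])"

lemma apow_Suc: "k \<ge> 0 \<Longrightarrow> apow (k + 1) = \<a> # apow k" "k \<le> 0 \<Longrightarrow> apow (k - 1) = \<A> # apow k"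
proof -
  assume "k \<ge> 0"
  then have "nat \<bar>k + 1\<bar> = Suc (nat \<bar>k\<bar>)" by simp
  then show "apow (k + 1) = \<a> # apow k" using \<open>k \<ge> 0\<close> by (cases "k = 0") (auto simp: apow_def asgn_def)
next
  assume "k \<le> 0"
  then have "nat \<bar>k - 1\<bar> = Suc (nat \<bar>k\<bar>)" by simp
  then show "apow (k - 1) = \<A> # apow k" using \<open>k \<le> 0\<close> by (cases "k = 0") (auto simp: apow_def asgn_def)
qed

lemma reduce_apow_a: "reduce (\<a> # apow k @ u) = reduce (apow (k + 1) @ u)"
proof (cases "k \<ge> 0")
  case False
  then have "apow k = \<A> # apow (k + 1)" using apow_Suc(2)[of "k + 1"] by simp
  then show ?thesis using reduce_cancel_Cons(1)[of \<a>] by simp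
qed (simp add: apow_Suc)

lemma reduce_apow_A: "reduce (\<A> # apow k @ u) = reduce (apow (k - 1) @ u)"
proof (cases "k \<le> 0")
  case False
  then have "apow k = \<a> # apow (k - 1)" using apow_Suc(1)[of "k - 1"] by simp
  then show ?thesis using reduce_cancel_Cons(1)[of \<A>] by simp
qed (simp add: apow_Suc)

lemma apow_comm: "x \<in> {\<a>, \<A>} \<Longrightarrow> reduce (apow k @ x # u) = reduce (x # apow k @ u)"
proof -
  assume x: "x \<in> {\<a>, \<A>}"
  have "reduce (replicate n y @ x # u) = reduce (x # replicate n y @ u)" if "y \<in> {\<a>, \<A>}" for n y
  proof (induction n)
    case (Suc n)
    have "reduce ([y] @ replicate n y @ x # u) = reduce ([y] @ x # replicate n y @ u)"
      by (rule reduce_cong) (use Suc in auto)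
    also have "\<dots> = reduce (x # y # replicate n y @ u)"
    proof (cases "x = y")
      case False
      then have "y = inv_letter x" using x that by auto
      then show ?thesis by simp
    qed auto
    finally show ?case by simp
  qed auto
  then show ?thesis unfolding apow_def asgn_def by auto
qed

lemma L_subst_apow: "L_subst (apow k) = apow k"
proof -
  have "L_subst (replicate n x) = replicate n x" if "x \<in> {\<a>, \<A>}" for n x
    using that by (induction n) auto
  then show ?thesis unfolding apow_def asgn_def by auto
qed

lemma reduce_Cons_cong: "reduce u = reduce v \<Longrightarrow> reduce (x # u) = reduce (x # v)"
  using reduce_cong[of "[x]" "[x]" u v] by simp

text \<open>Each block hands the \<open>a\<close> in front of its \<open>b\<close> to the block on
  its left. The two occurrences of \<open>lead\<close> are the letters entering at the right end and
  leaving at the left end.\<close>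

lemma reduce_L_subst_blocks:
  "reduce (L_subst (blocks xs) @ lead e') =
   reduce (lead (case xs of [] \<Rightarrow> e' | x # _ \<Rightarrow> fst x) @ blocks (twist_lin xs e'))"
proof (induction xs)
  case (Cons x xs)
  obtain e k where x: "x = (e, k)" by (cases x)
  define e1 where "e1 = (case xs of [] \<Rightarrow> e' | x # _ \<Rightarrow> fst x)"
  let ?r = "blocks (twist_lin xs e')"
  have IH: "reduce (L_subst (blocks xs) @ lead e') = reduce (lead e1 @ ?r)"
    using Cons unfolding e1_def .
  have 1: "reduce (apow k @ L_subst (blocks xs) @ lead e') = reduce (apow (k + of_bool e1) @ ?r)"
  proof -
    have "reduce (apow k @ L_subst (blocks xs) @ lead e') = reduce (apow k @ lead e1 @ ?r)"
      by (rule reduce_cong[OF refl IH])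
    also have "\<dots> = reduce (apow (k + of_bool e1) @ ?r)"
      by (auto simp: lead_def apow_comm reduce_apow_a)
    finally show ?thesis .
  qed
  have tl: "twist_lin (x # xs) e' = (e, k + of_bool e1 - of_bool (\<not> e)) # twist_lin xs e'"
    by (simp add: x gain_def e1_def)
  show ?case
  proof (cases e)
    case True
    have "reduce (L_subst (blocks (x # xs)) @ lead e') =
        reduce (\<a> # \<b> # apow k @ L_subst (blocks xs) @ lead e')"
      by (simp add: x True bpow_def L_subst_apow)
    also have "\<dots> = reduce (\<a> # \<b> # apow (k + of_bool e1) @ ?r)"
      by (intro reduce_Cons_cong 1)
    finally show ?thesis unfolding tl using True by (simp add: x lead_def bpow_def)
  next
    case False
    have "reduce (L_subst (blocks (x # xs)) @ lead e') =
        reduce (\<B> # \<A> # apow k @ L_subst (blocks xs) @ lead e')"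
      by (simp add: x False bpow_def L_subst_apow)
    also have "\<dots> = reduce (\<B> # \<A> # apow (k + of_bool e1) @ ?r)"
      by (intro reduce_Cons_cong 1)
    also have "\<dots> = reduce (\<B> # apow (k + of_bool e1 - 1) @ ?r)"
      by (intro reduce_Cons_cong reduce_apow_A)
    finally show ?thesis unfolding tl using False by (simp add: x lead_def bpow_def)
  qed
qed auto

lemma conj_class_L_subst_blocks:
  assumes "xs \<noteq> []"
  shows "conj_class (L_subst (blocks xs)) = conj_class (blocks (twist 1 xs))"
proof -
  define e where "e = fst (hd xs)"
  have "reduce (L_subst (blocks xs) @ lead e) = reduce (lead e @ blocks (twist 1 xs))"
    using reduce_L_subst_blocks[of xs e] assms twist_lin_eq_twist[OF assms]
    by (cases xs) (auto simp: e_def)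
  then have "reduce (L_subst (blocks xs)) = reduce (lead e @ blocks (twist 1 xs) @ inv_word (lead e))"
    using reduce_cong[of "L_subst (blocks xs) @ lead e" _ "inv_word (lead e)" "inv_word (lead e)"]
      reduce_cong[of "L_subst (blocks xs)" _ "lead e @ inv_word (lead e)" "[]"] by auto
  then show ?thesis using conj_class_cong conj_class_conj by metis
qed

text \<open>Rotate to an occurrence of \<open>b\<close> or \<open>B\<close> and parse from the
  right; reducedness makes a new letter \<open>a\<close> or \<open>A\<close> agree in sign with the
  power that it extends.\<close>

lemma ex_blocks:
  assumes "cyclically_reduced w" "\<b> \<in> set w \<or> \<B> \<in> set w"
  shows "\<exists>xs u v. xs \<noteq> [] \<and> w = u @ v \<and> blocks xs = v @ u"
proof -
  obtain u x v where w: "w = u @ x # v" and x: "x \<in> {\<b>, \<B>}"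
    using assms(2) by (metis insert_iff split_list)
  have parse: "\<exists>k xs. z = apow k @ blocks xs" if "reduced z" for z
    using that
  proof (induction z)
    case Nil
    show ?case by (intro exI[of _ 0] exI[of _ "[]"]) auto
  next
    case (Cons y z)
    then obtain k xs where z: "z = apow k @ blocks xs" by (auto simp: reduced_Cons)
    consider (b) "y \<in> {\<b>, \<B>}" | (a) "y = \<a>" | (A) "y = \<A>" by (cases y) auto
    then show ?case
    proof cases
      case b
      then show ?thesis using z
        by (intro exI[of _ 0] exI[of _ "(y = \<b>, k) # xs"]) (auto simp: bpow_def)
    next
      case a
      have "k \<ge> 0"
      proof (rule ccontr)
        assume "\<not> ?thesis"
        then have "apow k = \<A> # apow (k + 1)" using apow_Suc(2)[of "k + 1"] by simp
        then show False using Cons.prems z a by (auto simp: reduced_Cons)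
      qed
      then show ?thesis using z a apow_Suc(1) by (intro exI[of _ "k + 1"] exI[of _ xs]) auto
    next
      case A
      have "k \<le> 0"
      proof (rule ccontr)
        assume "\<not> ?thesis"
        then have "apow k = \<a> # apow (k - 1)" using apow_Suc(1)[of "k - 1"] by simp
        then show False using Cons.prems z A by (auto simp: reduced_Cons)
      qed
      then show ?thesis using z A apow_Suc(2) by (intro exI[of _ "k - 1"] exI[of _ xs]) auto
    qed
  qed
  have "cyclically_reduced ((x # v) @ u)" using assms(1) cyclically_reduced_rotate[of u "x # v"] w by simp
  then have "reduced (v @ u)" by (auto simp: cyclically_reduced_def reduced_Cons)
  then obtain k xs where "v @ u = apow k @ blocks xs" using parse by blast
  then have "blocks ((x = \<b>, k) # xs) = (x # v) @ u" using x by (auto simp: bpow_def)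
  then show ?thesis using w by blast
qed

section \<open>Changes of the pattern counts under twisting\<close>

abbreviation bsum :: "(letter \<Rightarrow> letter \<Rightarrow> letter \<Rightarrow> int) \<Rightarrow> (bool \<times> int) list \<Rightarrow> int" where
  "bsum f xs \<equiv> cyc_sum f (blocks xs)"

context
  fixes xs :: "(bool \<times> int) list"
  assumes ne: "xs \<noteq> []" and red: "cyclically_reduced (blocks xs)"
begin

lemma sg_eqI: "ex xs i = 0 \<Longrightarrow> sg xs (Suc i) = sg xs i"
  using red by (simp add: cyclically_reduced_blocks ne)

lemma bsum_num_b_twist: "bsum num_b (twist m xs) = bsum num_b xs"
  by (simp add: cyc_sum_blocks' ne block_sums)

text \<open>In each block the absolute exponent grows by 1, minus 2 if the block contains a turn,
  plus the difference of the sign indicators \<open>?h\<close> of the next block and its own. These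
  differences telescope around the cycle.\<close>

lemma bsum_num_a_twist:
  "bsum num_a (twist 1 xs) = bsum num_a xs + bsum num_b xs - 2 * bsum turns xs"
proof -
  let ?h = "\<lambda>i. of_bool (sg xs i) :: int"
  have "(\<Sum>i<length xs. ?h (i + 1)) = (\<Sum>i<length xs. ?h i)"
    by (rule cyc_shift_sum) (simp add: sg_def cyc_def)
  then have shift: "(\<Sum>i<length xs. ?h (i + 1) - ?h i) = 0" by (simp add: sum_subtractf)
  have "bsum num_a (twist 1 xs) = (\<Sum>i<length xs. \<bar>ex xs i\<bar> + 1
      - 2 * of_bool (if sg xs i then sg xs (i + 1) \<and> ex xs i < 0 else sg xs (i + 1) \<or> ex xs i > 0)
      + (?h (i + 1) - ?h i))"
    unfolding cyc_sum_blocks'[OF iffD2[OF arg_cong[OF twist_eq_Nil, of Not] ne]] block_sums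
      length_twist sg_twist[OF ne] ex_twist[OF ne]
  proof (rule sum.cong[OF refl])
    fix i
    show "\<bar>ex xs i + 1 * gain (sg xs i) (sg xs (i + 1))\<bar> = \<bar>ex xs i\<bar> + 1
      - 2 * of_bool (if sg xs i then sg xs (i + 1) \<and> ex xs i < 0 else sg xs (i + 1) \<or> ex xs i > 0)
      + (?h (i + 1) - ?h i)"
      using sg_eqI[of i] by (cases "sg xs i"; cases "sg xs (i + 1)") (auto simp: gain_def)
  qed
  also have "\<dots> = bsum num_a xs + bsum num_b xs - 2 * bsum turns xs"
    unfolding cyc_sum_blocks'[OF ne] block_sums sum.distrib sum_subtractf shift
    using shift by (simp add: sum_distrib_left sum_subtractf)
  finally show ?thesis .
qed

text \<open>Turns between blocks of different sign are unaffected; between equal signs a turn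
  disappears exactly when its exponent reaches 0.\<close>

lemma bsum_turns_twist: "bsum turns (twist 1 xs) = bsum turns xs - bsum bab xs"
  unfolding cyc_sum_blocks'[OF ne] cyc_sum_blocks'[OF iffD2[OF arg_cong[OF twist_eq_Nil, of Not] ne]]
    block_sums length_twist sg_twist[OF ne] ex_twist[OF ne] sum_subtractf[symmetric]
  by (rule sum.cong) (auto simp: gain_def of_bool_def)

text \<open>The exponents on both sides of a \<open>b\<close> never decrease, those around a
  \<open>B\<close> never increase, so no \<open>AbA\<close> or \<open>aBa\<close> is
  created.\<close>

lemma bsum_aba_twist: "bsum aba (twist 1 xs) \<le> bsum aba xs"
  unfolding cyc_sum_blocks'[OF ne] cyc_sum_blocks'[OF iffD2[OF arg_cong[OF twist_eq_Nil, of Not] ne]]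
    block_sums length_twist sg_twist[OF ne] ex_twist[OF ne]
  by (rule sum_mono) (auto simp: gain_def of_bool_def)

text \<open>The zero exponent in a new \<open>abb\<close> was 1 or -1 before the twist. There a
  \<open>bab\<close> and an \<open>aba\<close> pattern overlapped, and one of them is assumed
  absent.\<close>

lemma bsum_abb_twist:
  assumes "bsum bab xs = 0 \<or> bsum aba xs = 0"
  shows "bsum abb (twist 1 xs) = 0"
proof -
  have A: "\<not> (sg xs i = sg xs (Suc i) \<and> ex xs i = (if sg xs i then - 1 else 1))" if "bsum bab xs = 0" for i
    using that unfolding cyc_sum_blocks_eq_0[OF functional_nonneg(4) ne] block_sums by auto
  have B: "\<not> (if sg xs (Suc i) then ex xs i < 0 \<and> ex xs (Suc i) < 0 else ex xs i > 0 \<and> ex xs (Suc i) > 0)"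
    if "bsum aba xs = 0" for i
    using spec[OF iffD1[OF cyc_sum_blocks_eq_0[OF functional_nonneg(6) ne] that], of i]
    unfolding block_sums by auto
  show ?thesis
    unfolding cyc_sum_blocks_eq_0[OF functional_nonneg(7) iffD2[OF arg_cong[OF twist_eq_Nil, of Not] ne]]
      block_sums sg_twist[OF ne] ex_twist[OF ne]
  proof
    fix i
    show "of_bool (ex xs (i + 1) + 1 * gain (sg xs (i + 1)) (sg xs (i + 1 + 1)) = 0 \<and>
          (if sg xs (i + 1) then ex xs i + 1 * gain (sg xs i) (sg xs (i + 1)) < 0 \<and> sg xs (i + 2)
           else 0 < ex xs i + 1 * gain (sg xs i) (sg xs (i + 1)) \<and> \<not> sg xs (i + 2))) = (0::int)"
      using assms A[of "Suc i"] B[of i] by (auto simp: gain_def split: if_splits)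
  qed
qed

text \<open>Without \<open>baa\<close> an exponent opposing its gain has absolute value at most 1,
  so after one twist no exponent opposes its gain any more; if \<open>bab\<close> is absent too,
  none does from the start.\<close>

lemma bsum_turns_twist_pow:
  assumes "bsum baa xs = 0"
  shows "bsum turns (twist (1 + int n) xs) = bsum turns (twist 1 xs)"
    "bsum bab xs = 0 \<Longrightarrow> bsum turns (twist (int n) xs) = bsum turns xs"
proof -
  have B: "\<not> (if sg xs i then ex xs i \<le> - 2 else ex xs i \<ge> 2)" for i
    using assms unfolding cyc_sum_blocks_eq_0[OF functional_nonneg(5) ne] block_sums by auto
  show "bsum turns (twist (1 + int n) xs) = bsum turns (twist 1 xs)"
    unfolding cyc_sum_blocks'[OF iffD2[OF arg_cong[OF twist_eq_Nil, of Not] ne]]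
      block_sums length_twist sg_twist[OF ne] ex_twist[OF ne]
  proof (rule sum.cong[OF refl])
    fix i
    show "of_bool (if sg xs i then sg xs (i + 1) \<and> ex xs i + (1 + int n) * gain (sg xs i) (sg xs (i + 1)) < 0
             else sg xs (i + 1) \<or> 0 < ex xs i + (1 + int n) * gain (sg xs i) (sg xs (i + 1))) =
         (of_bool (if sg xs i then sg xs (i + 1) \<and> ex xs i + 1 * gain (sg xs i) (sg xs (i + 1)) < 0
             else sg xs (i + 1) \<or> 0 < ex xs i + 1 * gain (sg xs i) (sg xs (i + 1))) :: int)"
      using B[of i] by (auto simp: gain_def)
  qed
  assume "bsum bab xs = 0"
  then have A: "\<not> (sg xs i = sg xs (Suc i) \<and> ex xs i = (if sg xs i then - 1 else 1))" for i
    unfolding cyc_sum_blocks_eq_0[OF functional_nonneg(4) ne] block_sums by auto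
  show "bsum turns (twist (int n) xs) = bsum turns xs"
    unfolding cyc_sum_blocks'[OF ne] cyc_sum_blocks'[OF iffD2[OF arg_cong[OF twist_eq_Nil, of Not] ne]]
      block_sums length_twist sg_twist[OF ne] ex_twist[OF ne]
  proof (rule sum.cong[OF refl])
    fix i
    show "of_bool (if sg xs i then sg xs (i + 1) \<and> ex xs i + int n * gain (sg xs i) (sg xs (i + 1)) < 0
             else sg xs (i + 1) \<or> 0 < ex xs i + int n * gain (sg xs i) (sg xs (i + 1))) =
         (of_bool (if sg xs i then sg xs (i + 1) \<and> ex xs i < 0 else sg xs (i + 1) \<or> 0 < ex xs i) :: int)"
      using A[of i] B[of i] by (cases "sg xs i"; cases "sg xs (i + 1)") (auto simp: gain_def)
  qed
qed

text \<open>A nonzero gain would make one exponent unbounded; \<open>n\<close> is chosen so that it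
  alone exceeds the number of letters \<open>a\<close> and \<open>A\<close>. With all gains zero the
  twist does nothing.\<close>

lemma twist_bounded:
  assumes "\<And>n::nat. bsum num_a (twist (int n) xs) = bsum num_a xs"
  shows "gain (sg xs i) (sg xs (Suc i)) = 0" "twist m xs = xs"
proof -
  have gain0: "gain (sg xs i) (sg xs (Suc i)) = 0" for i
  proof (rule ccontr)
    let ?j = "i mod length xs"
    assume "\<not> ?thesis"
    then have g: "\<bar>gain (sg xs ?j) (sg xs (Suc ?j))\<bar> \<ge> 1" by (simp add: sg_mod)
    have j: "?j < length xs" using ne by simp
    define n where "n = nat (bsum num_a xs + \<bar>ex xs ?j\<bar> + 1)"
    have "bsum num_a (twist (int n) xs) =
        (\<Sum>i<length xs. \<bar>ex xs i + int n * gain (sg xs i) (sg xs (Suc i))\<bar>)"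
      unfolding cyc_sum_blocks'[OF iffD2[OF arg_cong[OF twist_eq_Nil, of Not] ne]]
        block_sums length_twist sg_twist[OF ne] ex_twist[OF ne] by simp
    also have "\<dots> \<ge> \<bar>ex xs ?j + int n * gain (sg xs ?j) (sg xs (Suc ?j))\<bar>"
      by (rule member_le_sum) (use j in auto)
    finally have "\<bar>ex xs ?j + int n * gain (sg xs ?j) (sg xs (Suc ?j))\<bar> \<le> bsum num_a xs"
      using assms by simp
    moreover have "int n \<le> \<bar>int n * gain (sg xs ?j) (sg xs (Suc ?j))\<bar>"
      using mult_left_mono[OF g, of "int n"] by (simp add: abs_mult)
    moreover have "int n = bsum num_a xs + \<bar>ex xs ?j\<bar> + 1"
      using cyc_sum_nonneg[of num_a "blocks xs"] functional_nonneg(1) unfolding n_def by simp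
    ultimately show False by linarith
  qed
  then show "gain (sg xs i) (sg xs (Suc i)) = 0" .
  show "twist m xs = xs" using gain0 twist_0[of xs] unfolding twist_def by simp
qed

end

section \<open>The two twists as maps of curves\<close>

definition curve_L :: "word set \<Rightarrow> word set" where "curve_L c = aut_L ` c"
definition curve_R :: "word set \<Rightarrow> word set" where "curve_R c = aut_R ` c"

abbreviation R_subst :: "word \<Rightarrow> word" where "R_subst \<equiv> subst [\<a>, \<b>] [\<b>]"

lemma reduce_single [simp]: "reduce [x] = [x]"
  by (rule reduce_reduced) (simp add: reduced_Cons)

lemma aut_L_auto: "aut_L \<in> auto F2" and aut_R_auto: "aut_R \<in> auto F2"
proof -
  show "aut_L \<in> auto F2" unfolding aut_L_def
    by (rule endo_auto[where u' = "[\<a>]" and v' = "[\<A>, \<b>]"]) (simp_all add: reduce_def)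
  show "aut_R \<in> auto F2" unfolding aut_R_def
    by (rule endo_auto[where u' = "[\<a>, \<B>]" and v' = "[\<b>]"]) (simp_all add: reduce_def)
qed

lemma endo_gens: "endo u v [\<a>] = reduce u" "endo u v [\<b>] = reduce v"
  by (simp_all add: endo_eq reduced_Cons)

lemma endo_conj_class: "endo u v \<in> auto F2 \<Longrightarrow> endo u v ` conj_class w = conj_class (subst u v w)"
  by (simp add: auto_conj_class endo_gens) (metis conj_class_cong subst_reduce_gens)

lemma curve_L_conj_class: "curve_L (conj_class w) = conj_class (L_subst w)"
  unfolding curve_L_def using aut_L_auto unfolding aut_L_def by (rule endo_conj_class)

lemma curve_R_conj_class: "curve_R (conj_class w) = conj_class (R_subst w)"
  unfolding curve_R_def using aut_R_auto unfolding aut_R_def by (rule endo_conj_class)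

text \<open>The orientation reversing symmetry exchanging the two generators conjugates the first twist
  into the second one.\<close>
fun swap_letter :: "letter \<Rightarrow> letter" where
  "swap_letter \<a> = \<b>" | "swap_letter \<b> = \<a>" | "swap_letter \<A> = \<B>" | "swap_letter \<B> = \<A>"

abbreviation swap_word :: "word \<Rightarrow> word" where "swap_word \<equiv> map swap_letter"

lemma swap_letter_swap [simp]: "swap_letter (swap_letter x) = x"
  by (cases x) auto

lemma swap_letter_comp [simp]: "swap_letter \<circ> swap_letter = id"
  by (simp add: fun_eq_iff)

lemma swap_word_swap [simp]: "swap_word (swap_word w) = w"
  by simp

lemma swap_word_eq_subst: "swap_word w = subst [\<b>] [\<a>] w"
proof (induction w)
  case (Cons x w)
  then show ?case by (cases x) auto
qed auto

lemma swap_conj_class: "conj_class u = conj_class v \<Longrightarrow> conj_class (swap_word u) = conj_class (swap_word v)"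
proof -
  have "endo [\<b>] [\<a>] \<in> auto F2" by (rule endo_auto[where u' = "[\<b>]" and v' = "[\<a>]"]) simp_all
  then show "conj_class u = conj_class v \<Longrightarrow> conj_class (swap_word u) = conj_class (swap_word v)"
    unfolding swap_word_eq_subst using endo_conj_class by metis
qed

lemma subst_conj: "reduce (subst (g @ u @ inv_word g) (g @ v @ inv_word g) w) = reduce (g @ subst u v w @ inv_word g)"
proof (induction w)
  case (Cons x w)
  have "subst_letter (g @ u @ inv_word g) (g @ v @ inv_word g) x = g @ subst_letter u v x @ inv_word g"
    by (cases x) auto
  then have "reduce (subst (g @ u @ inv_word g) (g @ v @ inv_word g) (x # w)) =
      reduce ((g @ subst_letter u v x @ inv_word g) @ (g @ subst u v w @ inv_word g))"
    using Cons by (auto intro!: reduce_cong)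
  also have "\<dots> = reduce ((g @ subst_letter u v x) @ (inv_word g @ g @ subst u v w @ inv_word g))" by simp
  also have "\<dots> = reduce ((g @ subst_letter u v x) @ (subst u v w @ inv_word g))"
    by (rule reduce_cong) (simp_all only: reduce_cancel)
  finally show ?case by simp
qed auto

text \<open>Exchanging the generators turns \<open>L\<close> into the map sending \<open>a\<close>
  to \<open>ba\<close> and fixing \<open>b\<close>, which agrees with \<open>R\<close> up to
  conjugation by \<open>b\<close>.\<close>

lemma conj_class_R_subst: "conj_class (R_subst w) = conj_class (swap_word (L_subst (swap_word w)))"
proof -
  have "reduce (subst ([\<b>] @ [\<a>, \<b>] @ inv_word [\<b>]) ([\<b>] @ [\<b>] @ inv_word [\<b>]) w) = reduce (subst [\<b>, \<a>] [\<b>] w)"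
    by (subst (1 2) subst_reduce_gens) (simp add: reduce_def)
  then have "conj_class (subst [\<b>, \<a>] [\<b>] w) = conj_class (R_subst w)"
    using subst_conj[of "[\<b>]" "[\<a>, \<b>]" "[\<b>]" w] conj_class_conj conj_class_cong by metis
  moreover have "swap_word (L_subst (swap_word w)) = subst [\<b>, \<a>] [\<b>] w"
    unfolding swap_word_eq_subst subst_subst by simp
  ultimately show ?thesis by simp
qed

text \<open>The words \<open>V n\<close> represent the images of the curve of \<open>w\<close> under the powers of the twist \<open>tw\<close>.
  For the first twist, \<open>na\<close> and \<open>nb\<close> count the letters, \<open>x\<close> and \<open>xx\<close> the subwords \<open>BaB\<close> and \<open>Baa\<close> up to
  inversion of all letters, and \<open>y\<close> and \<open>yy\<close> the same subwords with the generators exchanged.\<close>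
definition twist_seq where
  "twist_seq tw na nb x xx y yy w V \<longleftrightarrow>
     (\<forall>n. cyclically_reduced (V n)) \<and> (\<forall>f. cyc_sum f (V 0) = cyc_sum f w) \<and>
     (\<forall>n::nat. conj_class (V n) = (tw ^^ n) (conj_class w)) \<and>
     (\<forall>n. cyc_sum nb (V n) = cyc_sum nb w) \<and>
     cyc_sum na (V 1) = cyc_sum na w + cyc_sum nb w - 2 * cyc_sum turns w \<and>
     cyc_sum turns (V 1) = cyc_sum turns w - cyc_sum x w \<and>
     cyc_sum y (V 1) \<le> cyc_sum y w \<and>
     (cyc_sum x w = 0 \<or> cyc_sum y w = 0 \<longrightarrow> cyc_sum yy (V 1) = 0) \<and>
     (cyc_sum xx w = 0 \<longrightarrow> (\<forall>n. cyc_sum turns (V (Suc n)) = cyc_sum turns (V 1))) \<and>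
     (cyc_sum xx w = 0 \<and> cyc_sum x w = 0 \<longrightarrow> (\<forall>n. cyc_sum turns (V n) = cyc_sum turns w)) \<and>
     ((\<forall>n. cyc_sum na (V n) = cyc_sum na w) \<longrightarrow> conj_class (V 1) = conj_class w)"

text \<open>Words containing \<open>b\<close> or \<open>B\<close> are treated in block form. A power
  of \<open>a\<close> is fixed by \<open>L\<close> and contains none of the patterns, so a constant
  sequence serves.\<close>

lemma twist_seq_L:
  assumes "cyclically_reduced w"
  shows "\<exists>V. twist_seq curve_L num_a num_b bab baa aba abb w V"
proof (cases "\<b> \<in> set w \<or> \<B> \<in> set w")
  case True
  obtain xs u v where xs: "xs \<noteq> []" "w = u @ v" "blocks xs = v @ u" using ex_blocks[OF assms True] by blast
  have cs: "cyc_sum f (blocks xs) = cyc_sum f w" for f using xs cyc_sum_rotate[of f u v] by simp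
  have cl: "conj_class (blocks xs) = conj_class w" using xs conj_class_rotate by metis
  have red: "cyclically_reduced (blocks xs)" using xs assms cyclically_reduced_rotate by metis
  define V where "V n = blocks (twist (int n) xs)" for n :: nat
  have cls: "conj_class (V n) = (curve_L ^^ n) (conj_class w)" for n
  proof (induction n)
    case 0
    then show ?case by (simp add: V_def twist_0 cl)
  next
    case (Suc n)
    have "conj_class (V (Suc n)) = conj_class (blocks (twist 1 (twist (int n) xs)))"
      by (simp add: V_def twist_twist)
    also have "\<dots> = curve_L (conj_class (V n))"
      unfolding curve_L_conj_class V_def by (rule conj_class_L_subst_blocks[symmetric]) (simp add: xs)
    finally show ?case using Suc by simp
  qed
  note facts = bsum_num_b_twist[OF xs(1) red] bsum_num_a_twist[OF xs(1) red] bsum_turns_twist[OF xs(1) red]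
    bsum_aba_twist[OF xs(1) red] bsum_abb_twist[OF xs(1) red] bsum_turns_twist_pow[OF xs(1) red]
    twist_bounded(2)[OF xs(1) red, of 1]
  have "twist_seq curve_L num_a num_b bab baa aba abb w V"
    unfolding twist_seq_def
  proof (intro conjI allI impI)
    show "cyclically_reduced (V n)" for n unfolding V_def by (rule cyclically_reduced_twist[OF xs(1) red])
    show "conj_class (V n) = (curve_L ^^ n) (conj_class w)" for n by (rule cls)
    show "cyc_sum num_b (V n) = cyc_sum num_b w" for n unfolding V_def using facts(1) cs by simp
    show "cyc_sum f (V 0) = cyc_sum f w" for f by (simp add: V_def twist_0 cs)
    show "cyc_sum num_a (V 1) = cyc_sum num_a w + cyc_sum num_b w - 2 * cyc_sum turns w"
      unfolding V_def using facts(2) cs by simp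
    show "cyc_sum turns (V 1) = cyc_sum turns w - cyc_sum bab w" unfolding V_def using facts(3) cs by simp
    show "cyc_sum aba (V 1) \<le> cyc_sum aba w" unfolding V_def using facts(4) cs by simp
    show "cyc_sum abb (V 1) = 0" if "cyc_sum bab w = 0 \<or> cyc_sum aba w = 0"
      unfolding V_def using facts(5) cs that by simp
    show "cyc_sum turns (V (Suc n)) = cyc_sum turns (V 1)" if "cyc_sum baa w = 0" for n
      unfolding V_def using facts(6)[of n] cs that by simp
    show "cyc_sum turns (V n) = cyc_sum turns w" if "cyc_sum baa w = 0 \<and> cyc_sum bab w = 0" for n
      unfolding V_def using facts(7)[of n] cs that by simp
    show "conj_class (V 1) = conj_class w" if "\<forall>n. cyc_sum num_a (V n) = cyc_sum num_a w"
      using facts(8) that unfolding V_def by (simp add: cs cl)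
  qed
  then show ?thesis by blast
next
  case False
  then have sub: "x \<in> {\<a>, \<A>}" if "x \<in> set w" for x using that by (cases x) auto
  have "\<forall>x\<in>set w. subst_letter [\<a>] [\<a>, \<b>] x = [x]" using sub by fastforce
  then have id: "L_subst w = w" by (induction w) auto
  have cls: "(curve_L ^^ n) (conj_class w) = conj_class w" for n
    by (induction n) (auto simp: curve_L_conj_class id)
  have z: "cyc_sum f w = 0" if "f \<in> {num_b, turns, bab, baa, aba, abb}" for f
  proof (cases "w = []")
    case ne: False
    have A: "cyc w i \<in> {\<a>, \<A>}" for i using sub[of "cyc w i"] ne by (simp add: cyc_def)
    have B: "\<not> (cyc w (i + 1) = inv_letter (cyc w i))" for i
      using assms ne unfolding cyclically_reduced_iff
      by (subst (asm) cyc_sum_eq_0_iff) (auto simp: backtracks_def)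
    have "f (cyc w i) (cyc w (i + 1)) (cyc w (i + 2)) = 0" for i
      using that A[of i] A[of "i + 1"] B[of i]
      by (auto simp: num_b_def turns_def bab_def baa_def aba_def abb_def)
    then show ?thesis by (simp add: cyc_sum_def)
  qed (simp add: cyc_sum_def)
  have "twist_seq curve_L num_a num_b bab baa aba abb w (\<lambda>_. w)"
    unfolding twist_seq_def using assms by (simp add: cls z)
  then show ?thesis by blast
qed

lemma cyc_sum_swap:
  "cyc_sum num_a (swap_word w) = cyc_sum num_b w" "cyc_sum num_b (swap_word w) = cyc_sum num_a w"
  "cyc_sum turns (swap_word w) = cyc_sum turns w"
  "cyc_sum bab (swap_word w) = cyc_sum aba w" "cyc_sum aba (swap_word w) = cyc_sum bab w"
  "cyc_sum baa (swap_word w) = cyc_sum abb w" "cyc_sum abb (swap_word w) = cyc_sum baa w"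
proof -
  have "num_a (swap_letter x) (swap_letter y) (swap_letter z) = num_b x y z"
    "num_b (swap_letter x) (swap_letter y) (swap_letter z) = num_a x y z"
    "turns (swap_letter x) (swap_letter y) (swap_letter z) = turns x y z"
    "bab (swap_letter x) (swap_letter y) (swap_letter z) = aba x y z"
    "aba (swap_letter x) (swap_letter y) (swap_letter z) = bab x y z"
    "baa (swap_letter x) (swap_letter y) (swap_letter z) = abb x y z"
    "abb (swap_letter x) (swap_letter y) (swap_letter z) = baa x y z" for x y z
    by (cases x; cases y; cases z; simp add: num_a_def num_b_def turns_def bab_def aba_def baa_def abb_def)+
  then show
    "cyc_sum num_a (swap_word w) = cyc_sum num_b w" "cyc_sum num_b (swap_word w) = cyc_sum num_a w"
    "cyc_sum turns (swap_word w) = cyc_sum turns w"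
    "cyc_sum bab (swap_word w) = cyc_sum aba w" "cyc_sum aba (swap_word w) = cyc_sum bab w"
    "cyc_sum baa (swap_word w) = cyc_sum abb w" "cyc_sum abb (swap_word w) = cyc_sum baa w"
    unfolding cyc_sum_map by simp_all
qed

lemma cyclically_reduced_swap: "cyclically_reduced (swap_word w) \<longleftrightarrow> cyclically_reduced w"
proof -
  have "backtracks (swap_letter x) (swap_letter y) (swap_letter z) = backtracks x y z" for x y z
    by (cases x; cases y; simp add: backtracks_def)
  then show ?thesis unfolding cyclically_reduced_iff cyc_sum_map by simp
qed

lemma twist_seq_R:
  assumes "cyclically_reduced w"
  shows "\<exists>V. twist_seq curve_R num_b num_a aba abb bab baa w V"
proof -
  obtain V where V: "twist_seq curve_L num_a num_b bab baa aba abb (swap_word w) V"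
    using twist_seq_L cyclically_reduced_swap assms by metis
  define U where "U n = swap_word (V n)" for n
  have cls: "conj_class (U n) = (curve_R ^^ n) (conj_class w)" for n
  proof (induction n)
    case 0
    have "conj_class (V 0) = conj_class (swap_word w)" using V unfolding twist_seq_def by simp
    then have "conj_class (swap_word (V 0)) = conj_class w"
      using swap_conj_class[of "V 0" "swap_word w"] by simp
    then show ?case by (simp add: U_def)
  next
    case (Suc n)
    have "conj_class (V (Suc n)) = curve_L (conj_class (V n))" using V unfolding twist_seq_def by simp
    also have "\<dots> = conj_class (L_subst (swap_word (U n)))"
      unfolding U_def curve_L_conj_class by simp
    finally have "conj_class (U (Suc n)) = conj_class (swap_word (L_subst (swap_word (U n))))"
      unfolding U_def by (rule swap_conj_class)
    also have "\<dots> = curve_R (conj_class (U n))" unfolding curve_R_conj_class conj_class_R_subst ..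
    finally show ?case using Suc by simp
  qed
  \<comment> \<open>The block form is only a rotation of the word, so \<open>V 0\<close> is compared
    through all window counts rather than by equality.\<close>
  have "cyc_sum f (V 0) = cyc_sum f (swap_word w)" for f using V unfolding twist_seq_def by blast
  then have U0: "cyc_sum f (U 0) = cyc_sum f w" for f
    unfolding U_def cyc_sum_map[of f swap_letter "V 0"] by (simp add: cyc_sum_map)
  have red: "cyclically_reduced (U n)" for n
    using V unfolding twist_seq_def U_def cyclically_reduced_swap by blast
  have fix1: "conj_class (V 1) = conj_class (swap_word w) \<Longrightarrow> curve_R (conj_class w) = conj_class w"
    using cls[of 1] swap_conj_class[of "V 1" "swap_word w"] by (simp add: U_def)
  have "(\<forall>n. cyc_sum num_a (V n) = cyc_sum num_a (swap_word w)) \<longrightarrow> conj_class (V 1) = conj_class (swap_word w)"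
    using V unfolding twist_seq_def by blast
  then have fix2: "(\<forall>n. cyc_sum num_a (V n) = cyc_sum num_b w) \<longrightarrow> curve_R (conj_class w) = conj_class w"
    using fix1 cyc_sum_swap(1) by simp
  have "twist_seq curve_R num_b num_a aba abb bab baa w U"
    using V fix2 unfolding twist_seq_def U_def[symmetric]
    by (simp add: cls red U0) (use cyc_sum_swap cyclically_reduced_swap in \<open>simp add: U_def\<close>)
  then show ?thesis by blast
qed

definition len_c :: "word set \<Rightarrow> int" where "len_c c = int (curve_length c)"

text \<open>The images under \<open>L\<close> and \<open>R\<close> have lengths
  \<open>p + 2 q - 2 t\<close> and \<open>2 p + q - 2 t\<close>, with sum three times the length
  minus \<open>4 t\<close>. Solving for \<open>t\<close>, then \<open>p\<close> and
  \<open>q\<close>, defines them on curves without choosing a word.\<close>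

definition turns_c :: "word set \<Rightarrow> int" where
  "turns_c c = (3 * len_c c - len_c (curve_L c) - len_c (curve_R c)) div 4"

definition num_a_c :: "word set \<Rightarrow> int" where
  "num_a_c c = len_c (curve_R c) - len_c c + 2 * turns_c c"

definition num_b_c :: "word set \<Rightarrow> int" where
  "num_b_c c = len_c (curve_L c) - len_c c + 2 * turns_c c"

lemma len_c_conj_class:
  "cyclically_reduced w \<Longrightarrow> len_c (conj_class w) = cyc_sum num_a w + cyc_sum num_b w"
  by (simp add: len_c_def curve_length_eq length_eq_cyc_sum)

lemma twist_seqD:
  assumes "twist_seq tw na nb x xx y yy w V"
  shows "cyclically_reduced (V n)" "conj_class (V n) = (tw ^^ n) (conj_class w)"
    "conj_class (V 1) = tw (conj_class w)"
    "cyc_sum nb (V n) = cyc_sum nb w"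
    "cyc_sum na (V 1) = cyc_sum na w + cyc_sum nb w - 2 * cyc_sum turns w"
    "cyc_sum turns (V 1) = cyc_sum turns w - cyc_sum x w"
    "cyc_sum y (V 1) \<le> cyc_sum y w"
    "cyc_sum x w = 0 \<or> cyc_sum y w = 0 \<Longrightarrow> cyc_sum yy (V 1) = 0"
    "cyc_sum xx w = 0 \<Longrightarrow> cyc_sum turns (V (Suc n)) = cyc_sum turns (V 1)"
    "cyc_sum xx w = 0 \<Longrightarrow> cyc_sum x w = 0 \<Longrightarrow> cyc_sum turns (V n) = cyc_sum turns w"
    "(\<And>n. cyc_sum na (V n) = cyc_sum na w) \<Longrightarrow> tw (conj_class w) = conj_class w"
proof -
  note V = assms[unfolded twist_seq_def]
  show "conj_class (V 1) = tw (conj_class w)" using V[THEN conjunct2, THEN conjunct2, THEN conjunct1, rule_format, of 1] by simp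
  then show "(\<And>n. cyc_sum na (V n) = cyc_sum na w) \<Longrightarrow> tw (conj_class w) = conj_class w"
    using V by presburger
qed (use assms[unfolded twist_seq_def] in blast)+

lemma class_functions:
  assumes "cyclically_reduced w"
  shows "turns_c (conj_class w) = cyc_sum turns w" "num_a_c (conj_class w) = cyc_sum num_a w"
    "num_b_c (conj_class w) = cyc_sum num_b w"
proof -
  obtain V where V: "twist_seq curve_L num_a num_b bab baa aba abb w V" using twist_seq_L[OF assms] by blast
  obtain U where U: "twist_seq curve_R num_b num_a aba abb bab baa w U" using twist_seq_R[OF assms] by blast
  have L: "len_c (curve_L (conj_class w)) = cyc_sum num_a w + 2 * cyc_sum num_b w - 2 * cyc_sum turns w"
    using len_c_conj_class[OF twist_seqD(1)[OF V, of 1]] twist_seqD(3-5)[OF V] by simp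
  have R: "len_c (curve_R (conj_class w)) = 2 * cyc_sum num_a w + cyc_sum num_b w - 2 * cyc_sum turns w"
    using len_c_conj_class[OF twist_seqD(1)[OF U, of 1]] twist_seqD(3-5)[OF U] by simp
  show "turns_c (conj_class w) = cyc_sum turns w"
    unfolding turns_c_def L R len_c_conj_class[OF assms] by simp
  then show "num_a_c (conj_class w) = cyc_sum num_a w" "num_b_c (conj_class w) = cyc_sum num_b w"
    unfolding num_a_c_def num_b_c_def L R len_c_conj_class[OF assms] by auto
qed

lemma curveE:
  assumes "c \<in> curves"
  obtains w where "cyclically_reduced w" "c = conj_class w"
  using assms ex_cyclically_reduced unfolding curves_eq by (metis imageE)

lemma curve_closed: "c \<in> curves \<Longrightarrow> curve_L c \<in> curves" "c \<in> curves \<Longrightarrow> curve_R c \<in> curves"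
  unfolding curves_eq by (auto simp: curve_L_conj_class curve_R_conj_class)

text \<open>This covers both twists: the patterns of the second are those of the first with the
  generators exchanged.\<close>
lemma twist_laws:
  assumes tw: "\<forall>w. cyclically_reduced w \<longrightarrow> (\<exists>V. twist_seq tw na nb x xx y yy w V)"
    and tw': "\<forall>w. cyclically_reduced w \<longrightarrow> (\<exists>V. twist_seq tw' nb na y yy x xx w V)"
    and p: "\<forall>w. cyclically_reduced w \<longrightarrow> p (conj_class w) = cyc_sum na w"
    and q: "\<forall>w. cyclically_reduced w \<longrightarrow> q (conj_class w) = cyc_sum nb w"
    and nonneg: "\<And>u v z. na u v z \<ge> 0" "\<And>u v z. x u v z \<ge> 0"
    and c: "c \<in> curves"
  shows "p c \<ge> 0" "turns_c c \<ge> 0"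
    "p (tw c) = p c + q c - 2 * turns_c c" "q (tw c) = q c" "turns_c (tw c) \<le> turns_c c"
    "turns_c (tw c) = turns_c c \<Longrightarrow> turns_c ((tw ^^ n) (tw' c)) = turns_c (tw' c)"
    "turns_c (tw c) = turns_c c \<Longrightarrow> turns_c ((tw' ^^ n) (tw' (tw c))) = turns_c (tw' (tw c))"
    "turns_c (tw c) - turns_c (tw' (tw c)) \<le> turns_c c - turns_c (tw' c)"
    "(\<And>n. p ((tw ^^ n) c) + q ((tw ^^ n) c) = p c + q c) \<Longrightarrow> tw c = c"
proof -
  note seqs = tw[rule_format] tw'[rule_format] and f = p[rule_format] q[rule_format]
  obtain w where w: "cyclically_reduced w" "c = conj_class w" using curveE[OF c] .
  obtain V where V: "twist_seq tw na nb x xx y yy w V" using seqs(1)[OF w(1)] by blast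
  obtain U where U: "twist_seq tw' nb na y yy x xx w U" using seqs(2)[OF w(1)] by blast
  note VD = twist_seqD[OF V] and UD = twist_seqD[OF U]
  note t = class_functions(1)
  have tc: "turns_c c = cyc_sum turns w" "turns_c (tw c) = cyc_sum turns (V 1)"
     "turns_c (tw' c) = cyc_sum turns (U 1)"
    using t[OF w(1)] t[OF VD(1), of 1] t[OF UD(1), of 1] VD(3) UD(3) w by auto
  show "p c \<ge> 0" using f w nonneg cyc_sum_nonneg by metis
  show "turns_c c \<ge> 0" using tc functional_nonneg(3) cyc_sum_nonneg by metis
  show "p (tw c) = p c + q c - 2 * turns_c c" "q (tw c) = q c"
    using f[OF w(1)] f[OF VD(1), of 1] VD(3,5) VD(4)[of 1] tc w by auto
  show "turns_c (tw c) \<le> turns_c c" using tc VD(6) cyc_sum_nonneg[of x w, OF nonneg(2)] by simp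
  {
    assume "turns_c (tw c) = turns_c c"
    \<comment> \<open>The drop of \<open>t\<close> is the number of \<open>x\<close>-patterns, so no
      drop means no such pattern; the other twist then creates neither \<open>x\<close> nor
      \<open>xx\<close>.\<close>
    then have x0: "cyc_sum x w = 0" using tc VD(6) by simp
    obtain V' where V': "twist_seq tw na nb x xx y yy (U 1) V'" using seqs(1)[OF UD(1)] by blast
    have "cyc_sum x (U 1) = 0" using UD(7) x0 cyc_sum_nonneg[of x "U 1", OF nonneg(2)] by simp
    moreover have "cyc_sum xx (U 1) = 0" using UD(8) x0 by blast
    ultimately have "cyc_sum turns (V' n) = cyc_sum turns (U 1)" using twist_seqD(10)[OF V'] by blast
    moreover have "conj_class (V' n) = (tw ^^ n) (tw' c)" using twist_seqD(2)[OF V'] UD(3) w by simp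
    ultimately show "turns_c ((tw ^^ n) (tw' c)) = turns_c (tw' c)"
      using t[OF twist_seqD(1)[OF V'], of n] tc by simp
    obtain U' where U': "twist_seq tw' nb na y yy x xx (V 1) U'" using seqs(2)[OF VD(1)] by blast
    have "cyc_sum yy (V 1) = 0" using VD(8) x0 by blast
    then have "cyc_sum turns (U' (Suc n)) = cyc_sum turns (U' 1)" using twist_seqD(9)[OF U'] by blast
    moreover have "conj_class (U' (Suc n)) = (tw' ^^ n) (tw' (tw c))" "conj_class (U' 1) = tw' (tw c)"
      using twist_seqD(2)[OF U', of "Suc n"] twist_seqD(3)[OF U'] VD(3) w by (simp_all add: funpow_swap1)
    ultimately show "turns_c ((tw' ^^ n) (tw' (tw c))) = turns_c (tw' (tw c))"
      using t[OF twist_seqD(1)[OF U'], of "Suc n"] t[OF twist_seqD(1)[OF U'], of 1] by simp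
  }
  obtain U' where U': "twist_seq tw' nb na y yy x xx (V 1) U'" using seqs(2)[OF VD(1)] by blast
  have "conj_class (U' 1) = tw' (tw c)" using twist_seqD(3)[OF U'] VD(3) w by simp
  then have "turns_c (tw' (tw c)) = cyc_sum turns (V 1) - cyc_sum y (V 1)"
    using t[OF twist_seqD(1)[OF U'], of 1] twist_seqD(6)[OF U'] by simp
  then show "turns_c (tw c) - turns_c (tw' (tw c)) \<le> turns_c c - turns_c (tw' c)"
    using tc UD(6) VD(7) by simp
  assume len: "\<And>n. p ((tw ^^ n) c) + q ((tw ^^ n) c) = p c + q c"
  have "cyc_sum na (V n) = cyc_sum na w" for n
    using len[of n] VD(2)[of n] VD(4)[of n] f[OF VD(1), of n] f[OF w(1)] w by simp
  then show "tw c = c" using VD(11) w by blast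
qed

lemma class_data:
  "\<forall>w. cyclically_reduced w \<longrightarrow> (\<exists>V. twist_seq curve_L num_a num_b bab baa aba abb w V)"
  "\<forall>w. cyclically_reduced w \<longrightarrow> (\<exists>V. twist_seq curve_R num_b num_a aba abb bab baa w V)"
  "\<forall>w. cyclically_reduced w \<longrightarrow> num_a_c (conj_class w) = cyc_sum num_a w"
  "\<forall>w. cyclically_reduced w \<longrightarrow> num_b_c (conj_class w) = cyc_sum num_b w"
  using twist_seq_L twist_seq_R class_functions by simp_all

lemmas laws_L = twist_laws[OF class_data(1,2,3,4) functional_nonneg(1,4)]
lemmas laws_R = twist_laws[OF class_data(2,1,4,3) functional_nonneg(2,6)]

interpretation torus: curve_tree curves curve_L curve_R num_a_c num_b_c turns_c
proof
  fix c assume c: "c \<in> curves"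
  show "num_b_c (curve_R c) = num_a_c c + num_b_c c - 2 * turns_c c" using laws_R(3)[OF c] by simp
  show "curve_R c = c" if "\<And>n. num_a_c ((curve_R ^^ n) c) + num_b_c ((curve_R ^^ n) c) = num_a_c c + num_b_c c"
    using laws_R(9)[OF c] that by (simp add: add.commute)
qed (erule laws_L laws_R curve_closed; assumption?)+

lemma torus_len: "c \<in> curves \<Longrightarrow> torus.len c = len_c c"
  unfolding torus.len_def by (metis class_functions(2,3) curveE len_c_conj_class)

subsection \<open>Curves fixed by both twists\<close>

text \<open>In a power of the commutator the two neighbours of each letter are inverse to each
  other; the counts \<open>same_b\<close> and \<open>same_a\<close> measure violations of
  this.\<close>

definition same_b :: "letter \<Rightarrow> letter \<Rightarrow> letter \<Rightarrow> int" where
  "same_b x y z = of_bool (x = z \<and> x \<in> {\<b>, \<B>} \<and> y \<in> {\<a>, \<A>})"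

definition same_a :: "letter \<Rightarrow> letter \<Rightarrow> letter \<Rightarrow> int" where
  "same_a x y z = of_bool (x = z \<and> x \<in> {\<a>, \<A>} \<and> y \<in> {\<b>, \<B>})"

lemma block_sum_same_b: "block_sum same_b (e, k) (e', k') z = of_bool (e = e' \<and> \<bar>k\<bar> = 1)"
  by (auto simp: block_sum_eq Let_def same_b_def bpow_def asgn_def)

lemma block_sum_same_a:
  "\<lbrakk>\<bar>k\<bar> = 1; \<bar>k'\<bar> = 1\<rbrakk> \<Longrightarrow> block_sum same_a (e, k) (e', k') z = of_bool (k = k')"
  by (auto simp: block_sum_eq Let_def same_a_def bpow_def asgn_def)

text \<open>All powers of the twist give the same number of letters \<open>a\<close>, so every gain
  vanishes, which says that adjacent signs differ.\<close>

lemma fixed_blocks_alternate: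
  assumes "xs \<noteq> []" "cyclically_reduced (blocks xs)" "curve_L (conj_class (blocks xs)) = conj_class (blocks xs)"
  shows "sg xs (Suc i) = (\<not> sg xs i)"
proof -
  have cls: "conj_class (blocks (twist (int n) xs)) = conj_class (blocks xs)" for n
  proof (induction n)
    case (Suc n)
    have "conj_class (blocks (twist (int (Suc n)) xs)) = conj_class (blocks (twist 1 (twist (int n) xs)))"
      by (simp add: twist_twist)
    also have "\<dots> = curve_L (conj_class (blocks (twist (int n) xs)))"
      unfolding curve_L_conj_class by (rule conj_class_L_subst_blocks[symmetric]) (simp add: assms)
    finally show ?case using Suc assms by simp
  qed (simp add: twist_0)
  have "bsum num_a (twist (int n) xs) = bsum num_a xs" for n
    using class_functions(2)[OF cyclically_reduced_twist[OF assms(1,2)], of "int n"]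
      class_functions(2)[OF assms(2)] cls by simp
  then have "gain (sg xs i) (sg xs (Suc i)) = 0" using twist_bounded(1)[OF assms(1,2)] by blast
  then show ?thesis by (auto simp: gain_def split: if_splits)
qed

lemma fixed_same_b:
  assumes "cyclically_reduced w" "curve_L (conj_class w) = conj_class w"
  shows "cyc_sum same_b w = 0"
proof (cases "\<b> \<in> set w \<or> \<B> \<in> set w")
  case True
  obtain xs u v where xs: "xs \<noteq> []" "w = u @ v" "blocks xs = v @ u" using ex_blocks[OF assms(1) True] by blast
  have "conj_class (blocks xs) = conj_class w" using xs conj_class_rotate by metis
  moreover have "cyclically_reduced (blocks xs)" using xs assms cyclically_reduced_rotate by metis
  ultimately have alt: "sg xs (Suc i) = (\<not> sg xs i)" for i using fixed_blocks_alternate[OF xs(1)] assms by simp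
  have "cyc_sum same_b (blocks xs) = 0"
    unfolding cyc_sum_blocks'[OF xs(1)] block_sum_same_b using alt by simp
  then show ?thesis using xs cyc_sum_rotate by metis
next
  case False
  have "cyc w i \<in> set w" if "w \<noteq> []" for i using that by (simp add: cyc_def)
  then have "same_b (cyc w i) y z = 0" if "w \<noteq> []" for i y z
    using False that by (auto simp: same_b_def) metis+
  then show ?thesis by (cases "w = []") (simp_all add: cyc_sum_def)
qed

lemma fixed_same_a:
  assumes "cyclically_reduced w" "curve_R (conj_class w) = conj_class w"
  shows "cyc_sum same_a w = 0"
proof -
  have "conj_class (swap_word (L_subst (swap_word w))) = conj_class w"
    using assms(2) by (simp add: curve_R_conj_class conj_class_R_subst)
  then have "conj_class (swap_word (swap_word (L_subst (swap_word w)))) = conj_class (swap_word w)"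
    by (rule swap_conj_class)
  then have "curve_L (conj_class (swap_word w)) = conj_class (swap_word w)"
    unfolding curve_L_conj_class swap_word_swap .
  then have "cyc_sum same_b (swap_word w) = 0"
    using fixed_same_b cyclically_reduced_swap assms(1) by blast
  moreover have "same_b (swap_letter x) (swap_letter y) (swap_letter z) = same_a x y z" for x y z
    by (cases x; cases y; cases z; simp add: same_a_def same_b_def)
  ultimately show ?thesis unfolding cyc_sum_map by simp
qed

lemma blocks_alternating:
  assumes "successively (\<lambda>x y. y = (\<not> fst x, - snd x)) (x # xs)" "even (length (x # xs))"
  shows "blocks (x # xs) = concat (replicate (length (x # xs) div 2) (blocks [x, (\<not> fst x, - snd x)]))"
  using assms
proof (induction "length xs" arbitrary: x xs rule: less_induct)
  case less
  then obtain y ys where xs: "xs = y # ys" by (cases xs) auto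
  then have y: "y = (\<not> fst x, - snd x)" using less.prems by simp
  show ?case
  proof (cases ys)
    case Nil
    then show ?thesis using xs y by simp
  next
    case (Cons z zs)
    then have z: "z = x" using less.prems xs y by (cases x) auto
    have "blocks (z # zs) = concat (replicate (length (z # zs) div 2) (blocks [z, (\<not> fst z, - snd z)]))"
      by (rule less.hyps) (use less.prems xs Cons in auto)
    moreover have "length (x # xs) div 2 = Suc (length (z # zs) div 2)" using xs Cons by simp
    moreover have "blocks (x # xs) = blocks [x, y] @ blocks (z # zs)"
      using xs Cons by (simp add: blocks_def)
    ultimately show ?thesis using y z by simp
  qed
qed

lemma conj_class_power_cong:
  assumes "reduce u = reduce (g @ v @ inv_word g) \<or> reduce u = reduce (g @ inv_word v @ inv_word g)"
  shows "conj_class (concat (replicate n u)) = conj_class (concat (replicate n v))"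
proof -
  have snoc: "concat (replicate (Suc n) v) = concat (replicate n v) @ v" for n and v :: word
    by (induction n) auto
  have inv: "concat (replicate n (inv_word v)) = inv_word (concat (replicate n v))" for n
  proof (induction n)
    case (Suc n)
    have "concat (replicate (Suc n) (inv_word v)) = inv_word (concat (replicate n v)) @ inv_word v"
      unfolding snoc Suc ..
    then show ?case by simp
  qed simp
  have *: "conj_class (concat (replicate n u)) = conj_class (concat (replicate n v'))"
    if "reduce u = reduce (g @ v' @ inv_word g)" for v'
    using reduce_power_cong[OF that, of n] unfolding reduce_power_conj
    by (metis conj_class_cong conj_class_conj)
  show ?thesis using assms *[of v] *[of "inv_word v"] inv conj_class_inv by metis
qed

lemma commutator_power:
  "curve_of ([\<a>, \<b>, \<A>, \<B>] [^]\<^bsub>F2\<^esub> (n::nat)) = conj_class (concat (replicate n [\<a>, \<b>, \<A>, \<B>]))"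
proof -
  have "[\<a>, \<b>, \<A>, \<B>] [^]\<^bsub>F2\<^esub> n = reduce (concat (replicate n [\<a>, \<b>, \<A>, \<B>]))"
  proof (induction n)
    case (Suc n)
    have "concat (replicate (Suc n) [\<a>, \<b>, \<A>, \<B>]) = concat (replicate n [\<a>, \<b>, \<A>, \<B>]) @ [\<a>, \<b>, \<A>, \<B>]"
      by (metis append_Nil2 concat.simps concat_append replicate_Suc replicate_append_same)
    then show ?case using Suc by simp
  qed auto
  then show ?thesis by (simp add: curve_of_eq conj_class_reduce)
qed

text \<open>Invariance under \<open>L\<close> makes the signs of \<open>b\<close> alternate, so no
  exponent is 0; equal numbers of both kinds of letters leave only exponents 1 and -1; invariance
  under \<open>R\<close> makes these alternate as well. The word is then a cyclic power of a
  commutator.\<close>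

lemma not_essential_if_fixed:
  assumes "c \<in> curves" "curve_L c = c" "curve_R c = c"
  shows "\<not> essential c"
proof -
  obtain w where w: "cyclically_reduced w" "c = conj_class w" using curveE[OF assms(1)] .
  \<comment> \<open>The length increments \<open>q - 2 t\<close> and \<open>p - 2 t\<close> of the
    two twists both vanish.\<close>
  have aut_mat: "cyc_sum num_a w = 2 * cyc_sum turns w" "cyc_sum num_b w = 2 * cyc_sum turns w"
    using torus.p_l[OF assms(1)] torus.q_r[OF assms(1)] class_functions[OF w(1)] w(2) assms by auto
  show ?thesis
  proof (cases "\<b> \<in> set w \<or> \<B> \<in> set w")
    case False
    have "cyc w i \<in> set w" if "w \<noteq> []" for i using that by (simp add: cyc_def)
    then have "cyc w i \<notin> {\<b>, \<B>}" if "w \<noteq> []" for i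
      using that False by (metis insertE singletonD)
    then have "cyc_sum num_b w = 0" by (cases "w = []") (simp_all add: cyc_sum_def num_b_def)
    then have "w = []" using aut_mat length_eq_cyc_sum[of w] by simp
    then show ?thesis using w(2) unfolding essential_def by (simp add: curve_of_eq)
  next
    case True
    obtain xs u v where xs: "xs \<noteq> []" "w = u @ v" "blocks xs = v @ u" using ex_blocks[OF w(1) True] by blast
    have cs: "cyc_sum f (blocks xs) = cyc_sum f w" for f using xs cyc_sum_rotate[of f u v] by simp
    have cl: "conj_class (blocks xs) = c" using xs conj_class_rotate w by metis
    have red: "cyclically_reduced (blocks xs)" using xs w cyclically_reduced_rotate by metis
    have alt: "sg xs (Suc i) = (\<not> sg xs i)" for i
      using fixed_blocks_alternate[OF xs(1) red] cl assms by simp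
    then have nz: "ex xs i \<noteq> 0" for i
      using red unfolding cyclically_reduced_blocks[OF xs(1)] by auto
    have one: "\<bar>ex xs i\<bar> = 1" for i
    proof -
      have "(\<Sum>i<length xs. \<bar>ex xs i\<bar> - 1) = 0"
        using cs[of num_a] cs[of num_b] aut_mat unfolding cyc_sum_blocks'[OF xs(1)] block_sums sum_subtractf by simp
      moreover have "\<bar>ex xs i\<bar> - 1 \<ge> 0" for i using nz[of i] by linarith
      ultimately have "\<forall>i<length xs. \<bar>ex xs i\<bar> - 1 = 0"
        by (subst (asm) sum_nonneg_eq_0_iff) auto
      moreover have "i mod length xs < length xs" using xs by simp
      ultimately show ?thesis using ex_mod[of xs i] by force
    qed
    have "cyc_sum same_a (blocks xs) = 0" using fixed_same_a[OF w(1)] w assms cs by simp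
    then have same: "block_sum same_a (sg xs i, ex xs i) (sg xs (i + 1), ex xs (i + 1)) (sg xs (i + 2), ex xs (i + 2)) = 0" for i
      by (subst (asm) cyc_sum_blocks_eq_0) (auto simp: same_a_def xs)
    have alt': "ex xs (Suc i) = - ex xs i" for i
    proof -
      have "of_bool (ex xs i = ex xs (i + 1)) = (0::int)"
        using same[of i] block_sum_same_a[OF one[of i] one[of "i + 1"]] by metis
      then have "ex xs i \<noteq> ex xs (Suc i)" by simp
      then show ?thesis using one[of i] one[of "Suc i"] by arith
    qed
    have "xs ! Suc i = (\<not> fst (xs ! i), - snd (xs ! i))" if "Suc i < length xs" for i
      using alt[of i] alt'[of i] that by (auto simp: sg_def ex_def cyc_def prod_eq_iff)
    then have suc: "successively (\<lambda>x y. y = (\<not> fst x, - snd x)) xs"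
      unfolding successively_conv_nth by blast
    \<comment> \<open>Going once around the cycle returns to the first sign, so the number of blocks
      is even.\<close>
    have "sg xs i = (sg xs 0 = even i)" for i by (induction i) (auto simp: alt)
    from this[of "length xs"] have ev: "even (length xs)" by (cases "fst (xs ! 0)") (simp_all add: sg_def cyc_def)
    obtain e k ys where ys: "xs = (e, k) # ys" using xs by (cases xs) auto
    define m where "m = length xs div 2"
    have eq: "blocks xs = concat (replicate m (blocks [(e, k), (\<not> e, - k)]))"
      using blocks_alternating[of "(e, k)" ys] suc ev unfolding ys m_def by simp
    have "k = 1 \<or> k = - 1" using one[of 0] unfolding ys by (auto simp: ex_def cyc_def)
    \<comment> \<open>The four choices of signs give the four rotations, up to inversion, of the
      commutator.\<close>
    then obtain g where "reduce (blocks [(e, k), (\<not> e, - k)]) = reduce (g @ [\<a>, \<b>, \<A>, \<B>] @ inv_word g) \<or>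
       reduce (blocks [(e, k), (\<not> e, - k)]) = reduce (g @ inv_word [\<a>, \<b>, \<A>, \<B>] @ inv_word g)"
    proof -
      assume th: thesis if "reduce (blocks [(e, k), (\<not> e, - k)]) = reduce (g @ [\<a>, \<b>, \<A>, \<B>] @ inv_word g) \<or>
       reduce (blocks [(e, k), (\<not> e, - k)]) = reduce (g @ inv_word [\<a>, \<b>, \<A>, \<B>] @ inv_word g)" for g
      assume "k = 1 \<or> k = - 1"
      then consider "e" "k = 1" | "e" "k = -1" | "\<not> e" "k = 1" | "\<not> e" "k = -1" by blast
      then show thesis
      proof cases
        case 1 then show ?thesis by (intro th[of "[]"]) (simp add: bpow_def apow_def asgn_def)
      next
        case 2 then show ?thesis by (intro th[of "[\<A>]"]) (simp add: bpow_def apow_def asgn_def reduce_def)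
      next
        case 3 then show ?thesis by (intro th[of "[\<B>]"]) (simp add: bpow_def apow_def asgn_def reduce_def)
      next
        case 4 then show ?thesis by (intro th[of "[\<B>, \<A>]"]) (simp add: bpow_def apow_def asgn_def reduce_def)
      qed
    qed
    then have "c = conj_class (concat (replicate m [\<a>, \<b>, \<A>, \<B>]))"
      using conj_class_power_cong[of _ g "[\<a>, \<b>, \<A>, \<B>]" m] eq cl by metis
    then show ?thesis unfolding essential_def commutator_power[symmetric] by blast
  qed
qed

section \<open>The modular group\<close>

subsection \<open>A normal form\<close>

context group
begin

fun word_val :: "'a \<Rightarrow> 'a \<Rightarrow> bool list \<Rightarrow> 'a" where
  "word_val l r [] = \<one>"
| "word_val l r (x # b) = (if x then l else r) \<otimes> word_val l r b"

lemma word_val_closed [simp]: "\<lbrakk>l \<in> carrier G; r \<in> carrier G\<rbrakk> \<Longrightarrow> word_val l r b \<in> carrier G"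
  by (induction b) auto

text \<open>The optional trailing \<open>s\<close> accommodates inverses of generators:
  \<open>inv l\<close> is \<open>s^3 r s\<close> and \<open>inv r\<close> is
  \<open>s^3 l s\<close>.\<close>

definition normal_forms :: "'a \<Rightarrow> 'a \<Rightarrow> 'a \<Rightarrow> 'a set" where
  "normal_forms l r s = {s [^] (k::nat) \<otimes> (word_val l r b \<otimes> s [^] e) | k b e. e \<in> {0, 1::nat}}"

context
  fixes l r s
  assumes closed [simp]: "l \<in> carrier G" "r \<in> carrier G" "s \<in> carrier G"
    and lsl: "l \<otimes> (s \<otimes> l) = r" and lsr: "l \<otimes> (s \<otimes> r) = s" and rsl: "r \<otimes> (s \<otimes> l) = s"
    and s4: "s [^] (4::nat) = \<one>"
begin

lemma normal_formsI: "e \<in> {0, 1::nat} \<Longrightarrow> x = s [^] (k::nat) \<otimes> (word_val l r b \<otimes> s [^] e) \<Longrightarrow> x \<in> normal_forms l r s"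
  unfolding normal_forms_def by blast

lemma normal_forms_closed: "x \<in> normal_forms l r s \<Longrightarrow> x \<in> carrier G"
proof -
  assume "x \<in> normal_forms l r s"
  then obtain k b e where "x = s [^] (k::nat) \<otimes> (word_val l r b \<otimes> s [^] (e::nat))"
    unfolding normal_forms_def by blast
  then show ?thesis by simp
qed

lemma s_normal_forms: "x \<in> normal_forms l r s \<Longrightarrow> s \<otimes> x \<in> normal_forms l r s"
proof -
  assume "x \<in> normal_forms l r s"
  then obtain k b e where x: "x = s [^] (k::nat) \<otimes> (word_val l r b \<otimes> s [^] e)" "e \<in> {0, 1::nat}"
    unfolding normal_forms_def by blast
  then have "s \<otimes> x = s [^] (Suc k) \<otimes> (word_val l r b \<otimes> s [^] e)"
    by (simp add: m_assoc[symmetric] nat_pow_Suc2[symmetric] del: nat_pow_Suc)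
  then show ?thesis using normal_formsI x(2) by blast
qed

lemma spow_normal_forms: "x \<in> normal_forms l r s \<Longrightarrow> s [^] (k::nat) \<otimes> x \<in> normal_forms l r s"
proof (induction k)
  case 0
  then show ?case using normal_forms_closed by simp
next
  case (Suc k)
  have "x \<in> carrier G" using Suc.prems normal_forms_closed by blast
  then have "s [^] Suc k \<otimes> x = s \<otimes> (s [^] k \<otimes> x)"
    by (simp add: m_assoc[symmetric] nat_pow_Suc2[symmetric] del: nat_pow_Suc)
  then show ?case using Suc s_normal_forms by simp
qed

text \<open>Rewriting rules: the first four move a generator or its inverse past \<open>s\<close>,
  the next two absorb an inverse into an adjacent generator, the last two eliminate
  inverses.\<close>

lemma inv_moves:
  "inv l \<otimes> s = s \<otimes> r" "inv r \<otimes> s = s \<otimes> l" "l \<otimes> s = s \<otimes> inv r" "r \<otimes> s = s \<otimes> inv l"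
  "inv l \<otimes> r = s \<otimes> l" "inv r \<otimes> l = s [^] (3::nat) \<otimes> r"
  "inv l = s \<otimes> (r \<otimes> s [^] (3::nat))" "inv r = s \<otimes> (l \<otimes> s [^] (3::nat))"
proof -
  show il: "inv l \<otimes> s = s \<otimes> r" using lsr by (metis closed inv_solve_left m_closed)
  show ir: "inv r \<otimes> s = s \<otimes> l" using rsl by (metis closed inv_solve_left m_closed)
  show "l \<otimes> s = s \<otimes> inv r" using lsr by (metis closed inv_closed inv_solve_right m_assoc m_closed)
  show "r \<otimes> s = s \<otimes> inv l" using rsl by (metis closed inv_closed inv_solve_right m_assoc m_closed)
  show lr: "inv l \<otimes> r = s \<otimes> l" using lsl by (metis closed inv_solve_left m_closed)
  have s13: "s \<otimes> s [^] (3::nat) = \<one>" "s [^] (3::nat) \<otimes> s = \<one>"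
    using s4 nat_pow_Suc2[of s 3] nat_pow_Suc[of s 3] by (simp_all del: nat_pow_Suc)
  have il3: "inv l = inv l \<otimes> s \<otimes> s [^] (3::nat)" by (simp add: m_assoc s13)
  then show "inv l = s \<otimes> (r \<otimes> s [^] (3::nat))" unfolding il by (simp add: m_assoc)
  have "inv r = inv r \<otimes> s \<otimes> s [^] (3::nat)" by (simp add: m_assoc s13)
  then show "inv r = s \<otimes> (l \<otimes> s [^] (3::nat))" unfolding ir by (simp add: m_assoc)
  have "s \<otimes> (inv r \<otimes> l) = l \<otimes> s \<otimes> l" using \<open>l \<otimes> s = s \<otimes> inv r\<close> by (simp add: m_assoc[symmetric])
  also have "\<dots> = r" using lsl by (simp add: m_assoc)
  finally have "s [^] (3::nat) \<otimes> (s \<otimes> (inv r \<otimes> l)) = s [^] (3::nat) \<otimes> r" by simp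
  moreover have "s [^] (3::nat) \<otimes> (s \<otimes> (inv r \<otimes> l)) = inv r \<otimes> l"
    using s13(2) by (simp add: m_assoc[symmetric])
  ultimately show "inv r \<otimes> l = s [^] (3::nat) \<otimes> r" by simp
qed

lemma s2_central: "s \<otimes> s \<otimes> l = l \<otimes> (s \<otimes> s)" "s \<otimes> s \<otimes> r = r \<otimes> (s \<otimes> s)"
proof -
  have "l \<otimes> (s \<otimes> s) = (l \<otimes> s) \<otimes> s" by (simp add: m_assoc)
  also have "\<dots> = s \<otimes> (inv r \<otimes> s)" unfolding inv_moves(3) by (simp add: m_assoc)
  finally show "s \<otimes> s \<otimes> l = l \<otimes> (s \<otimes> s)" unfolding inv_moves(2) by (simp add: m_assoc)
  have "r \<otimes> (s \<otimes> s) = (r \<otimes> s) \<otimes> s" by (simp add: m_assoc)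
  also have "\<dots> = s \<otimes> (inv l \<otimes> s)" unfolding inv_moves(4) by (simp add: m_assoc)
  finally show "s \<otimes> s \<otimes> r = r \<otimes> (s \<otimes> s)" unfolding inv_moves(1) by (simp add: m_assoc)
qed

lemma s3: "s [^] (3::nat) = s \<otimes> s \<otimes> s"
  by (simp add: eval_nat_numeral m_assoc)

text \<open>An inverse cancels against an equal first letter and is absorbed by a different one. On
  the empty word it produces or consumes the trailing \<open>s\<close>.\<close>

lemma gen_normal_forms_0:
  assumes "x \<in> {l, r, inv l, inv r}" "e \<in> {0, 1::nat}"
  shows "x \<otimes> (word_val l r b \<otimes> s [^] e) \<in> normal_forms l r s"
proof -
  have pos: "(if y then l else r) \<otimes> (word_val l r b \<otimes> s [^] e) \<in> normal_forms l r s" for y b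
    by (rule normal_formsI[OF assms(2), of _ 0 "y # b"]) (simp add: m_assoc)
  have plain: "word_val l r b \<otimes> s [^] e \<in> normal_forms l r s" for b
    by (rule normal_formsI[OF assms(2), of _ 0 b]) simp
  have cancel: "inv z \<otimes> (z \<otimes> w) = w" if "z \<in> carrier G" "w \<in> carrier G" for z w
    using that by (simp add: m_assoc[symmetric])
  consider "x = l" | "x = r" | "x = inv l" | "x = inv r" using assms by auto
  then show ?thesis
  proof cases
    case 1 then show ?thesis using pos[of True] by simp
  next
    case 2 then show ?thesis using pos[of False] by simp
  next
    case 3
    show ?thesis
    proof (cases b)
      case Nil
      show ?thesis
      proof (cases "e = 0")
        case True
        have "inv l = s [^] (3::nat) \<otimes> (word_val l r [False] \<otimes> s [^] (1::nat))"
        proof -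
          have "inv l = s \<otimes> ((r \<otimes> (s \<otimes> s)) \<otimes> s)" unfolding inv_moves(7) s3 by (simp add: m_assoc)
          then show ?thesis unfolding s2_central(2)[symmetric] s3 by (simp add: m_assoc)
        qed
        then show ?thesis using 3 Nil True by (intro normal_formsI[of 1 _ 3 "[False]"]) simp_all
      next
        case False
        then have "x \<otimes> (word_val l r b \<otimes> s [^] e) = s [^] (1::nat) \<otimes> (word_val l r [False] \<otimes> s [^] (0::nat))"
         using 3 Nil assms(2) inv_moves(1) by simp
        then show ?thesis by (intro normal_formsI[of 0 _ 1 "[False]"]) simp_all
      qed
    next
      case (Cons y b')
      show ?thesis
      proof (cases y)
        case True
        then show ?thesis using 3 Cons plain by (simp add: m_assoc cancel)
      next
        case False
        then have "x \<otimes> (word_val l r b \<otimes> s [^] e) = (inv l \<otimes> r) \<otimes> (word_val l r b' \<otimes> s [^] e)"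
          using 3 Cons by (simp add: m_assoc)
        also have "\<dots> = s \<otimes> (l \<otimes> (word_val l r b' \<otimes> s [^] e))" unfolding inv_moves(5) by (simp add: m_assoc)
        finally show ?thesis using s_normal_forms pos[of True b'] by simp
      qed
    qed
  next
    case 4
    show ?thesis
    proof (cases b)
      case Nil
      show ?thesis
      proof (cases "e = 0")
        case True
        have "inv r = s [^] (3::nat) \<otimes> (word_val l r [True] \<otimes> s [^] (1::nat))"
        proof -
          have "inv r = s \<otimes> ((l \<otimes> (s \<otimes> s)) \<otimes> s)" unfolding inv_moves(8) s3 by (simp add: m_assoc)
          then show ?thesis unfolding s2_central(1)[symmetric] s3 by (simp add: m_assoc)
        qed
        then show ?thesis using 4 Nil True by (intro normal_formsI[of 1 _ 3 "[True]"]) simp_all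
      next
        case False
        then have "x \<otimes> (word_val l r b \<otimes> s [^] e) = s [^] (1::nat) \<otimes> (word_val l r [True] \<otimes> s [^] (0::nat))"
         using 4 Nil assms(2) inv_moves(2) by simp
        then show ?thesis by (intro normal_formsI[of 0 _ 1 "[True]"]) simp_all
      qed
    next
      case (Cons y b')
      show ?thesis
      proof (cases y)
        case False
        then show ?thesis using 4 Cons plain by (simp add: m_assoc cancel)
      next
        case True
        then have "x \<otimes> (word_val l r b \<otimes> s [^] e) = (inv r \<otimes> l) \<otimes> (word_val l r b' \<otimes> s [^] e)"
          using 4 Cons by (simp add: m_assoc)
        also have "\<dots> = s [^] (3::nat) \<otimes> (r \<otimes> (word_val l r b' \<otimes> s [^] e))" unfolding inv_moves(6) by (simp add: m_assoc)
        finally show ?thesis using spow_normal_forms pos[of False b'] by simp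
      qed
    qed
  qed
qed

text \<open>Moving past \<open>s\<close> permutes the four elements \<open>l\<close>,
  \<open>r\<close> and their inverses, so the leading power of \<open>s\<close> is crossed one
  factor at a time.\<close>

lemma gen_normal_forms:
  assumes "x \<in> {l, r, inv l, inv r}" "y \<in> normal_forms l r s"
  shows "x \<otimes> y \<in> normal_forms l r s"
proof -
  obtain k b e where y: "y = s [^] (k::nat) \<otimes> (word_val l r b \<otimes> s [^] e)" "e \<in> {0, 1::nat}"
    using assms unfolding normal_forms_def by blast
  have "x \<otimes> (s [^] (k::nat) \<otimes> (word_val l r b \<otimes> s [^] e)) \<in> normal_forms l r s"
    using assms(1)
  proof (induction k arbitrary: x)
    case 0
    then show ?case using gen_normal_forms_0[OF _ y(2)] by auto
  next
    case (Suc k)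
    have x: "x \<in> carrier G" using Suc.prems by auto
    obtain x' where x': "x' \<in> {l, r, inv l, inv r}" "x \<otimes> s = s \<otimes> x'"
      using Suc.prems inv_moves(1-4) by blast
    then have x'c: "x' \<in> carrier G" by auto
    let ?z = "s [^] k \<otimes> (word_val l r b \<otimes> s [^] e)"
    have "x \<otimes> (s [^] Suc k \<otimes> (word_val l r b \<otimes> s [^] e)) = (x \<otimes> s) \<otimes> ?z"
      unfolding nat_pow_Suc2[OF closed(3)] using x by (simp add: m_assoc)
    also have "\<dots> = s \<otimes> (x' \<otimes> ?z)" unfolding x'(2) using x'c by (simp add: m_assoc)
    finally show ?case using s_normal_forms Suc.IH[OF x'(1)] by simp
  qed
  then show ?thesis using y by simp
qed

text \<open>The induction shows that left multiplication preserves normal forms, a property that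
  passes to products; the claim is the case of the identity.\<close>

lemma generate_normal_forms:
  assumes "x \<in> generate G {l, r}"
  shows "x \<in> normal_forms l r s"
proof -
  have "\<forall>y \<in> normal_forms l r s. x \<otimes> y \<in> normal_forms l r s"
    using assms
  proof (induction rule: generate.induct)
    case one
    then show ?case using normal_forms_closed by simp
  next
    case (incl h)
    then show ?case using gen_normal_forms by auto
  next
    case (inv h)
    then show ?case using gen_normal_forms by auto
  next
    case (eng h1 h2)
    have "h1 \<in> carrier G" "h2 \<in> carrier G"
      using eng generate_in_carrier[of "{l, r}"] by auto
    then show ?case using eng normal_forms_closed by (simp add: m_assoc)
  qed
  moreover have "\<one> \<in> normal_forms l r s" by (rule normal_formsI[of 0 _ 0 "[]"]) auto
  moreover have "x \<in> carrier G" using assms generate_in_carrier[of "{l, r}"] by auto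
  ultimately show ?thesis by fastforce
qed

end

end

subsection \<open>Integer matrices of determinant one\<close>

type_synonym mat = "int \<times> int \<times> int \<times> int"

fun mat_mult :: "mat \<Rightarrow> mat \<Rightarrow> mat" where
  "mat_mult (p, q, r, s) (p', q', r', s') = (p * p' + q * r', p * q' + q * s', r * p' + s * r', r * q' + s * s')"

definition SL2 :: "mat monoid" where
  "SL2 = \<lparr>carrier = {(p, q, r, s). p * s - q * r = 1}, monoid.mult = mat_mult, one = (1, 0, 0, 1)\<rparr>"

abbreviation "mL \<equiv> (1, 1, 0, 1) :: mat"
abbreviation "mR \<equiv> (1, 0, 1, 1) :: mat"
abbreviation "mS \<equiv> (0, - 1, 1, 0) :: mat"

lemma carrier_SL2 [simp]: "(p, q, r, s) \<in> carrier SL2 \<longleftrightarrow> p * s - q * r = 1"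
  by (simp add: SL2_def)

lemma mult_SL2 [simp]: "M \<otimes>\<^bsub>SL2\<^esub> N = mat_mult M N" and one_SL2 [simp]: "\<one>\<^bsub>SL2\<^esub> = (1, 0, 0, 1)"
  by (simp_all add: SL2_def)

interpretation SL2: group SL2
proof (rule groupI)
  fix M N assume "M \<in> carrier SL2" "N \<in> carrier SL2"
  then show "M \<otimes>\<^bsub>SL2\<^esub> N \<in> carrier SL2"
  proof (cases M; cases N; clarsimp)
    fix p q r s p' q' r' s' :: int
    assume "p * s - q * r = 1" "p' * s' - q' * r' = 1"
    then have "(p * s - q * r) * (p' * s' - q' * r') = 1" by simp
    then show "(p * p' + q * r') * (r * q' + s * s') - (p * q' + q * s') * (r * p' + s * r') = 1"
      by (simp add: algebra_simps)
  qed
next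
  fix M assume "M \<in> carrier SL2"
  then show "\<exists>N\<in>carrier SL2. N \<otimes>\<^bsub>SL2\<^esub> M = \<one>\<^bsub>SL2\<^esub>"
  proof (cases M)
    case (fields p q r s)
    then show ?thesis using \<open>M \<in> carrier SL2\<close>
      by (intro bexI[of _ "(s, - q, - r, p)"]) (auto simp: algebra_simps)
  qed
next
  show "M \<otimes>\<^bsub>SL2\<^esub> N \<otimes>\<^bsub>SL2\<^esub> K = M \<otimes>\<^bsub>SL2\<^esub> (N \<otimes>\<^bsub>SL2\<^esub> K)" for M N K
    by (cases M; cases N; cases K) (simp add: algebra_simps)
qed (auto simp: SL2_def)

lemma inv_SL2: "(p, q, r, s) \<in> carrier SL2 \<Longrightarrow> inv\<^bsub>SL2\<^esub> (p, q, r, s) = (s, - q, - r, p)"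
  by (rule SL2.inv_equality) (auto simp: algebra_simps)

abbreviation "wmat \<equiv> SL2.word_val mL mR"

text \<open>Each generator adds one row to the other, and no row is zero because the determinant is
  1. So the sum of the entries grows with every letter.\<close>

lemma wmat_nonneg:
  obtains p q r s where "wmat b = (p, q, r, s)" "p \<ge> 0" "q \<ge> 0" "r \<ge> 0" "s \<ge> 0"
    "p * s - q * r = 1" "p + q + r + s \<ge> 2 + int (length b)"
proof -
  have "\<exists>p q r s. wmat b = (p, q, r, s) \<and> p \<ge> 0 \<and> q \<ge> 0 \<and> r \<ge> 0 \<and> s \<ge> 0 \<and>
    p * s - q * r = 1 \<and> p + q + r + s \<ge> 2 + int (length b)"
  proof (induction b)
    case (Cons x b)
    then obtain p q r s where IH: "wmat b = (p, q, r, s)" "p \<ge> 0" "q \<ge> 0" "r \<ge> 0" "s \<ge> 0"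
      "p * s - q * r = 1" "p + q + r + s \<ge> 2 + int (length b)" by blast
    have "p + q > 0" "r + s > 0"
    proof -
      have "\<not> (p = 0 \<and> q = 0)" "\<not> (r = 0 \<and> s = 0)" using IH(6) by auto
      then show "p + q > 0" "r + s > 0" using IH by linarith+
    qed
    then show ?case using IH by (cases x) (auto simp: algebra_simps)
  qed auto
  then show thesis using that by blast
qed

lemma mS_pow: "mS [^]\<^bsub>SL2\<^esub> (0::nat) = (1, 0, 0, 1)" "mS [^]\<^bsub>SL2\<^esub> (1::nat) = mS"
  "mS [^]\<^bsub>SL2\<^esub> (2::nat) = (- 1, 0, 0, - 1)" "mS [^]\<^bsub>SL2\<^esub> (3::nat) = (0, 1, - 1, 0)"
  "mS [^]\<^bsub>SL2\<^esub> (4::nat) = (1, 0, 0, 1)"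
  by (simp_all add: eval_nat_numeral)

lemma mS_pow_mod: "mS [^]\<^bsub>SL2\<^esub> (k::nat) = mS [^]\<^bsub>SL2\<^esub> (k mod 4)"
proof -
  have "mS [^]\<^bsub>SL2\<^esub> k = mS [^]\<^bsub>SL2\<^esub> (4 * (k div 4) + k mod 4)" by simp
  also have "\<dots> = (mS [^]\<^bsub>SL2\<^esub> (4::nat)) [^]\<^bsub>SL2\<^esub> (k div 4) \<otimes>\<^bsub>SL2\<^esub> mS [^]\<^bsub>SL2\<^esub> (k mod 4)"
    by (simp only: SL2.nat_pow_mult[symmetric] SL2.nat_pow_pow carrier_SL2)
  also have "\<dots> = mS [^]\<^bsub>SL2\<^esub> (k mod 4)"
    unfolding mS_pow using SL2.nat_pow_one[of "k div 4"] SL2.l_one[OF SL2.nat_pow_closed[of mS "k mod 4"]] by simp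
  finally show ?thesis .
qed

lemma mS_pow_cases: "mS [^]\<^bsub>SL2\<^esub> (k::nat) \<in> {(1, 0, 0, 1), mS, (- 1, 0, 0, - 1), (0, 1, - 1, 0)}"
proof -
  have "k mod 4 \<in> {0, 1, 2, 3}" by auto
  then show ?thesis using mS_pow_mod[of k] mS_pow by (auto simp del: SL2.nat_pow_0 SL2.nat_pow_Suc)
qed

text \<open>Powers of \<open>mS\<close> only permute entries up to sign. The absolute entries of
  \<open>wmat b\<close> therefore sum to 2, which leaves no room for a letter.\<close>

lemma normal_form_trivial:
  assumes "mS [^]\<^bsub>SL2\<^esub> (k::nat) \<otimes>\<^bsub>SL2\<^esub> (wmat b \<otimes>\<^bsub>SL2\<^esub> mS [^]\<^bsub>SL2\<^esub> (e::nat)) = (1, 0, 0, 1)"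
  shows "b = []" "4 dvd k + e"
proof -
  obtain p q r s where M: "wmat b = (p, q, r, s)" "p \<ge> 0" "q \<ge> 0" "r \<ge> 0" "s \<ge> 0"
    "p * s - q * r = 1" "p + q + r + s \<ge> 2 + int (length b)" using wmat_nonneg by blast
  have "p + q + r + s = 2"
    using mS_pow_cases[of k] mS_pow_cases[of e] assms M by auto
  then show b: "b = []" using M by auto
  have "mS [^]\<^bsub>SL2\<^esub> k \<otimes>\<^bsub>SL2\<^esub> mS [^]\<^bsub>SL2\<^esub> e = (1, 0, 0, 1)"
    using assms SL2.l_one[OF SL2.nat_pow_closed[of mS e]] unfolding b by simp
  then have "mS [^]\<^bsub>SL2\<^esub> (k + e) = (1, 0, 0, 1)" by (simp only: SL2.nat_pow_mult carrier_SL2)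
  then have eq: "mS [^]\<^bsub>SL2\<^esub> ((k + e) mod 4) = (1, 0, 0, 1)" using mS_pow_mod[of "k + e"] by simp
  have "(k + e) mod 4 \<in> {0, 1, 2, 3}" by auto
  then have "(k + e) mod 4 = 0" using eq mS_pow by (elim insertE) auto
  then show "4 dvd k + e" by auto
qed

text \<open>Euclidean division in the first column: a translation followed by \<open>mS\<close>
  replaces the lower left entry \<open>r\<close> by a remainder of absolute value below that of
  \<open>r\<close>.\<close>

lemma SL2_induct:
  assumes "\<And>n. P (1, n, 0, 1)" "\<And>n. P (- 1, n, 0, - 1)"
    and L: "\<And>M n. M \<in> carrier SL2 \<Longrightarrow> P M \<Longrightarrow> P ((1, n, 0, 1) \<otimes>\<^bsub>SL2\<^esub> M)"
    and S: "\<And>M. M \<in> carrier SL2 \<Longrightarrow> P M \<Longrightarrow> P (mS \<otimes>\<^bsub>SL2\<^esub> M)"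
    and "M \<in> carrier SL2"
  shows "P M"
proof -
  have "P (p, q, r, s)" if "p * s - q * r = 1" for p q r s
    using that
  proof (induction "nat \<bar>r\<bar>" arbitrary: p q r s rule: less_induct)
    case less
    show ?case
    proof (cases "r = 0")
      case True
      then have "p * s = 1" using less.prems by simp
      then have "p = 1 \<and> s = 1 \<or> p = - 1 \<and> s = - 1" using zmult_eq_1_iff by auto
      then show ?thesis using assms(1,2) True by auto
    next
      case False
      define n where "n = p div r"
      have "\<bar>p - n * r\<bar> < \<bar>r\<bar>"
        using False abs_mod_less[of r p] by (simp add: n_def minus_div_mult_eq_mod)
      have det: "r * (n * s - q) - s * (n * r - p) = 1" using less.prems by (simp add: algebra_simps)
      have "P (r, s, n * r - p, n * s - q)"
        by (rule less.hyps) (use det \<open>\<bar>p - n * r\<bar> < \<bar>r\<bar>\<close> in auto)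
      then have "P (mS \<otimes>\<^bsub>SL2\<^esub> (r, s, n * r - p, n * s - q))" by (rule S[rotated]) (use det in simp)
      then have "P ((1, n, 0, 1) \<otimes>\<^bsub>SL2\<^esub> (mS \<otimes>\<^bsub>SL2\<^esub> (r, s, n * r - p, n * s - q)))"
        by (rule L[rotated]) (use det in \<open>simp add: algebra_simps\<close>)
      then show ?thesis by simp
    qed
  qed
  then show ?thesis using assms(5) by (cases M) auto
qed

lemma SL2_upper_pow: "mL [^]\<^bsub>SL2\<^esub> (n::nat) = (1, int n, 0, 1)"
  by (induction n) (auto simp: algebra_simps)

lemma SL2_generated:
  assumes "subgroup H SL2" "mL \<in> H" "mS \<in> H"
  shows "H = carrier SL2"
proof
  show "H \<subseteq> carrier SL2" using assms(1) by (rule subgroup.subset)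
  have pow: "mL [^]\<^bsub>SL2\<^esub> (n::nat) \<in> H" for n
    using subgroup.one_closed[OF assms(1)] subgroup.m_closed[OF assms(1) _ assms(2)] by (induction n) auto
  have Ln: "(1, n, 0, 1) \<in> H" for n
  proof (cases "n \<ge> 0")
    case True
    show ?thesis using pow[of "nat n"] True SL2_upper_pow[of "nat n"] by simp
  next
    case False
    have "inv\<^bsub>SL2\<^esub> (1, - n, 0, 1) \<in> H"
      using pow[of "nat (- n)"] False SL2_upper_pow[of "nat (- n)"] subgroup.m_inv_closed[OF assms(1)] by simp
    then show ?thesis by (simp add: inv_SL2)
  qed
  have mult: "M \<otimes>\<^bsub>SL2\<^esub> N \<in> H" if "M \<in> H" "N \<in> H" for M N
    using subgroup.m_closed[OF assms(1)] that by blast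
  have "M \<in> H" if "M \<in> carrier SL2" for M
  proof (rule SL2_induct[where P = "\<lambda>M. M \<in> H", OF _ _ _ _ that])
    show "(1, n, 0, 1) \<in> H" for n by (rule Ln)
    show "(- 1, n, 0, - 1) \<in> H" for n
      using mult[OF mult[OF assms(3) assms(3)] Ln[of "- n"]] by simp
    show "(1, n, 0, 1) \<otimes>\<^bsub>SL2\<^esub> M \<in> H" if "M \<in> H" for M n using mult[OF Ln that] .
    show "mS \<otimes>\<^bsub>SL2\<^esub> M \<in> H" if "M \<in> H" for M using mult[OF assms(3) that] .
  qed
  then show "carrier SL2 \<subseteq> H" by blast
qed

subsection \<open>Abelianization\<close>

fun expo :: "letter \<Rightarrow> word \<Rightarrow> int" where
  "expo x [] = 0"
| "expo x (y # w) = (if y = x then 1 else if y = inv_letter x then - 1 else 0) + expo x w"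

lemma expo_append [simp]: "expo x (u @ v) = expo x u + expo x v"
  by (induction u) auto

lemma expo_inv_word [simp]: "expo x (inv_word w) = - expo x w"
  by (induction w) (auto simp: inv_letter_eq_iff)

lemma expo_reduce [simp]: "expo x (reduce w) = expo x w"
proof (induction w)
  case (Cons y w)
  have "expo x (cons_reduce y v) = expo x (y # v)" for v
    by (cases v) (auto simp: inv_letter_eq_iff)
  then have "expo x (cons_reduce y (reduce w)) = expo x (y # reduce w)" .
  moreover have "reduce (y # w) = cons_reduce y (reduce w)" by (simp add: reduce_def)
  ultimately show ?case using Cons by simp
qed auto

lemma expo_subst: "expo x (subst u v w) = expo x u * expo \<a> w + expo x v * expo \<b> w"
proof (induction w)
  case (Cons y w)
  then show ?case by (cases y) (auto simp: algebra_simps)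
qed auto

text \<open>The columns are the abelianized images of the generators, so that composition becomes
  the matrix product.\<close>

definition aut_mat :: "(word \<Rightarrow> word) \<Rightarrow> mat" where
  "aut_mat f = (expo \<a> (f [\<a>]), expo \<a> (f [\<b>]), expo \<b> (f [\<a>]), expo \<b> (f [\<b>]))"

subsection \<open>Automorphisms\<close>

abbreviation "Aut \<equiv> AutoGroup F2"

interpretation Aut: group Aut
  by (rule F2.AutoGroup)

lemma carrier_Aut: "carrier Aut = auto F2"
  by (simp add: AutoGroup_def)

lemma auto_reduced: "f \<in> auto F2 \<Longrightarrow> reduced w \<Longrightarrow> reduced (f w)"
  by (auto simp: auto_def hom_def Pi_def)

lemma auto_reduce: "f \<in> auto F2 \<Longrightarrow> f (reduce w) = reduce (subst (f [\<a>]) (f [\<b>]) w)"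
  using hom_eq_subst[of f "reduce w"] by (simp add: auto_def)

lemma auto_eqI: "\<lbrakk>f \<in> auto F2; g \<in> auto F2; f [\<a>] = g [\<a>]; f [\<b>] = g [\<b>]\<rbrakk> \<Longrightarrow> f = g"
  by (rule hom_ext) (auto simp: auto_def Bij_def)

lemma mult_Aut: "\<lbrakk>f \<in> auto F2; g \<in> auto F2\<rbrakk> \<Longrightarrow> f \<otimes>\<^bsub>Aut\<^esub> g = compose (carrier F2) f g"
  by (simp add: AutoGroup_def BijGroup_def auto_def)

lemma mult_Aut_apply:
  "\<lbrakk>f \<in> auto F2; g \<in> auto F2; reduced w\<rbrakk> \<Longrightarrow> (f \<otimes>\<^bsub>Aut\<^esub> g) w = f (g w)"
  by (simp add: mult_Aut compose_def)

lemma mult_Aut_closed: "\<lbrakk>f \<in> auto F2; g \<in> auto F2\<rbrakk> \<Longrightarrow> f \<otimes>\<^bsub>Aut\<^esub> g \<in> auto F2"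
  using Aut.m_closed unfolding carrier_Aut by blast

lemma mult_Aut_gen:
  assumes "f \<in> auto F2" "g \<in> auto F2" "reduced w"
  shows "(f \<otimes>\<^bsub>Aut\<^esub> g) w = reduce (subst (f [\<a>]) (f [\<b>]) (g w))"
  using assms auto_reduce[of f "g w"] auto_reduced[of g w] by (simp add: mult_Aut_apply reduce_reduced)

lemma one_Aut: "\<one>\<^bsub>Aut\<^esub> = (\<lambda>w\<in>carrier F2. w)"
  by (simp add: AutoGroup_def BijGroup_def)

lemma reduced_gens [simp]: "reduced [x]"
  by (simp add: reduced_Cons)

lemma aut_mat_mult:
  assumes "f \<in> auto F2" "g \<in> auto F2"
  shows "aut_mat (f \<otimes>\<^bsub>Aut\<^esub> g) = mat_mult (aut_mat f) (aut_mat g)"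
  using assms by (simp add: aut_mat_def mult_Aut_gen expo_subst)

definition conj_aut :: "word \<Rightarrow> word \<Rightarrow> word" where
  "conj_aut g = (\<lambda>w\<in>carrier F2. reduce (g @ w @ inv_word g))"

lemma conj_aut_apply: "reduced w \<Longrightarrow> conj_aut g w = reduce (g @ w @ inv_word g)"
  by (simp add: conj_aut_def)

lemma reduce_conj_reduce: "reduce (g @ reduce w @ inv_word g) = reduce (g @ w @ inv_word g)"
  by (intro reduce_cong) auto

lemma reduce_conj_conj: "reduce (g @ reduce (h @ w @ inv_word h) @ inv_word g) = reduce ((g @ h) @ w @ inv_word (g @ h))"
  unfolding reduce_conj_reduce by simp

lemma conj_aut_auto: "conj_aut g \<in> auto F2"
proof -
  have inv: "conj_aut (inv_word g) (conj_aut g w) = w" if "reduced w" for g w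
  proof -
    have "reduce ((inv_word g @ g) @ w @ inv_word (inv_word g @ g)) = reduce w"
      using reduce_cong[of w w "inv_word g @ g" "[]"] by (simp only: append_assoc reduce_cancel) simp
    moreover have "reduce ((inv_word g @ g) @ w @ inv_word (inv_word g @ g)) = conj_aut (inv_word g) (conj_aut g w)"
      using that by (simp only: conj_aut_apply reduced_reduce reduce_conj_conj)
    ultimately show ?thesis using that by (simp add: reduce_reduced)
  qed
  have "conj_aut g \<in> hom F2 F2"
  proof (rule homI)
    fix u v assume "u \<in> carrier F2" "v \<in> carrier F2"
    then have "conj_aut g (u \<otimes>\<^bsub>F2\<^esub> v) = reduce (g @ u @ v @ inv_word g)"
      using reduce_conj_reduce[of g "u @ v"] by (simp add: conj_aut_def)
    also have "\<dots> = reduce ((g @ u) @ (inv_word g @ g @ v @ inv_word g))"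
      using reduce_cong[of "g @ u" "g @ u" "v @ inv_word g" "inv_word g @ g @ v @ inv_word g"] by simp
    also have "\<dots> = conj_aut g u \<otimes>\<^bsub>F2\<^esub> conj_aut g v"
      using \<open>u \<in> carrier F2\<close> \<open>v \<in> carrier F2\<close> by (simp add: conj_aut_def)
    finally show "conj_aut g (u \<otimes>\<^bsub>F2\<^esub> v) = conj_aut g u \<otimes>\<^bsub>F2\<^esub> conj_aut g v" .
  qed (auto simp: conj_aut_def)
  moreover have "bij_betw (conj_aut g) (carrier F2) (carrier F2)"
    by (rule bij_betw_byWitness[where f' = "conj_aut (inv_word g)"])
      (use inv[of _ g] inv[of _ "inv_word g"] in \<open>auto simp: conj_aut_def[of g] conj_aut_def[of "inv_word g"]\<close>)
  ultimately show ?thesis by (auto simp: auto_def Bij_def conj_aut_def)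
qed

lemma conj_aut_reduce: "conj_aut (reduce g) = conj_aut g"
proof -
  have "reduce (reduce g @ w @ inv_word (reduce g)) = reduce (g @ w @ inv_word g)" for w
    by (intro reduce_cong) (auto simp flip: reduce_inv_word)
  then show ?thesis by (simp add: conj_aut_def)
qed

lemma inner_auts_eq: "inner_auts = range conj_aut"
proof -
  have "(\<lambda>w\<in>carrier F2. g \<otimes>\<^bsub>F2\<^esub> w \<otimes>\<^bsub>F2\<^esub> inv\<^bsub>F2\<^esub> g) = conj_aut g" if "reduced g" for g
    using that by (simp add: conj_aut_def inv_F2)
  then have "inner_auts = conj_aut ` {g. reduced g}" unfolding inner_auts_def by (auto simp: image_iff) metis+
  also have "\<dots> = range conj_aut" by (auto simp: image_iff) (metis conj_aut_reduce reduced_reduce)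
  finally show ?thesis .
qed

lemma conj_aut_mult: "conj_aut g \<otimes>\<^bsub>Aut\<^esub> conj_aut h = conj_aut (g @ h)"
  by (rule auto_eqI)
    (simp_all add: mult_Aut_closed conj_aut_auto mult_Aut_apply conj_aut_apply reduce_conj_reduce)

lemma conj_aut_Nil: "conj_aut [] = \<one>\<^bsub>Aut\<^esub>"
  unfolding one_Aut conj_aut_def by (rule restrict_ext) (simp add: reduce_reduced)

lemma auto_conj_aut:
  assumes "f \<in> auto F2"
  shows "f \<otimes>\<^bsub>Aut\<^esub> conj_aut g = conj_aut (f (reduce g)) \<otimes>\<^bsub>Aut\<^esub> f"
proof -
  have "f (reduce (g @ [x] @ inv_word g)) = reduce (f (reduce g) @ f [x] @ inv_word (f (reduce g)))" for x
  proof -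
    let ?s = "subst (f [\<a>]) (f [\<b>])"
    have "f (reduce (g @ [x] @ inv_word g)) = reduce (?s g @ ?s [x] @ inv_word (?s g))"
      using auto_reduce[OF assms, of "g @ [x] @ inv_word g"] by (simp add: subst_inv_word)
    also have "\<dots> = reduce (reduce (?s g) @ reduce (?s [x]) @ inv_word (reduce (?s g)))"
      by (intro reduce_cong) (auto simp flip: reduce_inv_word)
    finally show ?thesis using auto_reduce[OF assms, of g] auto_reduce[OF assms, of "[x]"] by simp
  qed
  from this[of \<a>] this[of \<b>] show ?thesis
    by (intro auto_eqI) (simp_all add: assms mult_Aut_closed conj_aut_auto mult_Aut_apply auto_reduced conj_aut_apply)
qed

lemma normal_inner: "inner_auts \<lhd> Aut"
proof -
  have inv: "inv\<^bsub>Aut\<^esub> (conj_aut g) = conj_aut (inv_word g)" for g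
  proof (rule Aut.inv_equality)
    have "conj_aut (inv_word g @ g) = conj_aut []"
      using conj_aut_reduce[of "inv_word g @ g"] by simp
    then show "conj_aut (inv_word g) \<otimes>\<^bsub>Aut\<^esub> conj_aut g = \<one>\<^bsub>Aut\<^esub>"
      by (simp add: conj_aut_mult conj_aut_Nil)
  qed (simp_all add: carrier_Aut conj_aut_auto)
  have sub: "subgroup inner_auts Aut"
  proof (rule Aut.subgroupI)
    show "inner_auts \<subseteq> carrier Aut" unfolding inner_auts_eq carrier_Aut using conj_aut_auto by blast
    show "inner_auts \<noteq> {}" unfolding inner_auts_eq by blast
  qed (auto simp: inner_auts_eq inv conj_aut_mult)
  show ?thesis
  proof (rule Aut.normal_invI[OF sub])
    fix f h assume f: "f \<in> carrier Aut" and "h \<in> inner_auts"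
    then obtain g where h: "h = conj_aut g" unfolding inner_auts_eq by blast
    have "f \<otimes>\<^bsub>Aut\<^esub> h \<otimes>\<^bsub>Aut\<^esub> inv\<^bsub>Aut\<^esub> f = conj_aut (f (reduce g)) \<otimes>\<^bsub>Aut\<^esub> (f \<otimes>\<^bsub>Aut\<^esub> inv\<^bsub>Aut\<^esub> f)"
      using f auto_conj_aut[of f g] conj_aut_auto[of "f (reduce g)"]
      by (simp add: h carrier_Aut Aut.m_assoc[unfolded carrier_Aut] Aut.inv_closed[unfolded carrier_Aut])
    also have "\<dots> = conj_aut (f (reduce g))"
      using f conj_aut_auto[of "f (reduce g)"] Aut.r_inv[OF f] Aut.r_one[unfolded carrier_Aut] by simp
    finally show "f \<otimes>\<^bsub>Aut\<^esub> h \<otimes>\<^bsub>Aut\<^esub> inv\<^bsub>Aut\<^esub> f \<in> inner_auts" unfolding inner_auts_eq by simp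
  qed
qed

interpretation inner: normal inner_auts Aut
  by (rule normal_inner)

interpretation Out: group Out_F2
  unfolding Out_F2_def by (rule inner.factorgroup_is_group)

lemma outer_class_mult:
  "\<lbrakk>f \<in> auto F2; g \<in> auto F2\<rbrakk> \<Longrightarrow> outer_class f \<otimes>\<^bsub>Out_F2\<^esub> outer_class g = outer_class (f \<otimes>\<^bsub>Aut\<^esub> g)"
  unfolding outer_class_def Out_F2_def FactGroup_def by (simp add: inner.rcos_sum carrier_Aut)

lemma carrier_Out: "carrier Out_F2 = outer_class ` auto F2"
  unfolding outer_class_def Out_F2_def FactGroup_def RCOSETS_def by (auto simp: carrier_Aut)

lemma outer_class_closed: "f \<in> auto F2 \<Longrightarrow> outer_class f \<in> carrier Out_F2"
  unfolding carrier_Out by blast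

lemma outer_class_members: "f \<in> auto F2 \<Longrightarrow> outer_class f = (\<lambda>g. conj_aut g \<otimes>\<^bsub>Aut\<^esub> f) ` UNIV"
  unfolding outer_class_def inner_auts_eq r_coset_def by auto

lemma outer_class_conj_aut: "f \<in> auto F2 \<Longrightarrow> outer_class (conj_aut g \<otimes>\<^bsub>Aut\<^esub> f) = outer_class f"
proof -
  assume f: "f \<in> auto F2"
  have "inner_auts #>\<^bsub>Aut\<^esub> conj_aut g = inner_auts"
    by (rule inner.rcos_const[OF Aut.is_group]) (simp add: inner_auts_eq)
  then show ?thesis using f Aut.coset_mult_assoc[of inner_auts "conj_aut g" f] inner.subset
    unfolding outer_class_def by (simp add: carrier_Aut conj_aut_auto)
qed

lemma one_Out: "\<one>\<^bsub>Out_F2\<^esub> = outer_class \<one>\<^bsub>Aut\<^esub>"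
  unfolding Out_F2_def FactGroup_def outer_class_def using Aut.coset_mult_one[OF inner.subset] by simp

subsection \<open>The mapping class group and its matrices\<close>

text \<open>Any representative would do, since conjugation does not change exponent sums.\<close>

definition outer_mat :: "(word \<Rightarrow> word) set \<Rightarrow> mat" where
  "outer_mat F = aut_mat (SOME f. f \<in> F)"

lemma outer_mat_outer_class:
  assumes "f \<in> auto F2"
  shows "outer_mat (outer_class f) = aut_mat f"
proof -
  have "aut_mat (conj_aut g \<otimes>\<^bsub>Aut\<^esub> f) = aut_mat f" for g
    using assms by (simp add: aut_mat_def mult_Aut_apply conj_aut_auto auto_reduced conj_aut_apply)
  then have "\<forall>h \<in> outer_class f. aut_mat h = aut_mat f" using outer_class_members[OF assms] by auto
  moreover have "outer_class f \<noteq> {}" using outer_class_members[OF assms] by auto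
  ultimately show ?thesis unfolding outer_mat_def by (simp add: some_in_eq)
qed

lemma mcg_act_outer_class:
  assumes "f \<in> auto F2" "c \<in> curves"
  shows "mcg_act (outer_class f) c = f ` c"
proof -
  obtain w where c: "c = conj_class w" using assms(2) unfolding curves_eq by blast
  have "(conj_aut g \<otimes>\<^bsub>Aut\<^esub> f) ` c = f ` c" for g
  proof -
    have "reduced x" if "x \<in> c" for x using that unfolding c conj_class_def by auto
    then have "(conj_aut g \<otimes>\<^bsub>Aut\<^esub> f) ` c = conj_aut g ` (f ` c)"
      using assms(1) by (auto simp: mult_Aut_apply conj_aut_auto image_iff)
    also have "f ` c = conj_class (subst (f [\<a>]) (f [\<b>]) w)" unfolding c by (rule auto_conj_class[OF assms(1)])
    also have "conj_aut g ` conj_class v = conj_class v" for v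
    proof -
      have "conj_class (subst (conj_aut g [\<a>]) (conj_aut g [\<b>]) v)
          = conj_class (subst (g @ [\<a>] @ inv_word g) (g @ [\<b>] @ inv_word g) v)"
        by (rule conj_class_cong) (subst (1 2) subst_reduce_gens, simp add: conj_aut_def)
      also have "\<dots> = conj_class (g @ v @ inv_word g)"
        using subst_conj[of g "[\<a>]" "[\<b>]" v] by (intro conj_class_cong) (simp add: subst_id)
      finally show ?thesis using auto_conj_class[OF conj_aut_auto] conj_class_conj by simp
    qed
    finally show ?thesis unfolding c auto_conj_class[OF assms(1)] .
  qed
  then show ?thesis unfolding mcg_act_def outer_class_members[OF assms(1)] by auto
qed

lemma auto_curves: "\<lbrakk>f \<in> auto F2; c \<in> curves\<rbrakk> \<Longrightarrow> f ` c \<in> curves"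
  unfolding curves_eq using auto_conj_class by auto

text \<open>A rotation by a quarter turn; it merely permutes the letters, so it preserves
  lengths.\<close>

definition aut_S :: "word \<Rightarrow> word" where "aut_S = endo [\<b>] [\<A>]"

lemma aut_S_auto: "aut_S \<in> auto F2"
  unfolding aut_S_def by (rule endo_auto[where u' = "[\<B>]" and v' = "[\<a>]"]) simp_all

lemma aut_gens [simp]:
  "aut_L [\<a>] = [\<a>]" "aut_L [\<b>] = [\<a>, \<b>]" "aut_R [\<a>] = [\<a>, \<b>]" "aut_R [\<b>] = [\<b>]"
  "aut_S [\<a>] = [\<b>]" "aut_S [\<b>] = [\<A>]"
  by (simp_all add: aut_L_def aut_R_def aut_S_def endo_gens reduce_def)

abbreviation "oL \<equiv> outer_class aut_L"
abbreviation "oR \<equiv> outer_class aut_R"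
abbreviation "oS \<equiv> outer_class aut_S"

lemmas gens_auto = aut_L_auto aut_R_auto aut_S_auto

text \<open>The hypotheses of the normal form. On automorphisms, the first holds up to conjugation
  by \<open>ab\<close> and the second up to conjugation by \<open>a\<close>; the others hold
  exactly.\<close>

lemma out_relations:
  "oL \<otimes>\<^bsub>Out_F2\<^esub> (oS \<otimes>\<^bsub>Out_F2\<^esub> oL) = oR" "oL \<otimes>\<^bsub>Out_F2\<^esub> (oS \<otimes>\<^bsub>Out_F2\<^esub> oR) = oS"
  "oR \<otimes>\<^bsub>Out_F2\<^esub> (oS \<otimes>\<^bsub>Out_F2\<^esub> oL) = oS" "oS [^]\<^bsub>Out_F2\<^esub> (4::nat) = \<one>\<^bsub>Out_F2\<^esub>"
proof -
  note simps = gens_auto mult_Aut_closed conj_aut_auto mult_Aut_gen conj_aut_apply reduce_def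
  have "aut_L \<otimes>\<^bsub>Aut\<^esub> (aut_S \<otimes>\<^bsub>Aut\<^esub> aut_L) = conj_aut [\<a>, \<b>] \<otimes>\<^bsub>Aut\<^esub> aut_R"
    by (rule auto_eqI) (simp_all add: simps)
  then show "oL \<otimes>\<^bsub>Out_F2\<^esub> (oS \<otimes>\<^bsub>Out_F2\<^esub> oL) = oR"
    by (simp add: outer_class_mult gens_auto mult_Aut_closed outer_class_conj_aut)
  have "aut_L \<otimes>\<^bsub>Aut\<^esub> (aut_S \<otimes>\<^bsub>Aut\<^esub> aut_R) = conj_aut [\<a>] \<otimes>\<^bsub>Aut\<^esub> aut_S"
    by (rule auto_eqI) (simp_all add: simps)
  then show "oL \<otimes>\<^bsub>Out_F2\<^esub> (oS \<otimes>\<^bsub>Out_F2\<^esub> oR) = oS"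
    by (simp add: outer_class_mult gens_auto mult_Aut_closed outer_class_conj_aut)
  have "aut_R \<otimes>\<^bsub>Aut\<^esub> (aut_S \<otimes>\<^bsub>Aut\<^esub> aut_L) = aut_S"
    by (rule auto_eqI) (simp_all add: simps)
  then show "oR \<otimes>\<^bsub>Out_F2\<^esub> (oS \<otimes>\<^bsub>Out_F2\<^esub> oL) = oS"
    by (simp add: outer_class_mult gens_auto mult_Aut_closed)
  have "aut_S \<otimes>\<^bsub>Aut\<^esub> (aut_S \<otimes>\<^bsub>Aut\<^esub> (aut_S \<otimes>\<^bsub>Aut\<^esub> aut_S)) = conj_aut []"
    by (rule auto_eqI) (simp_all add: simps)
  then have "oS \<otimes>\<^bsub>Out_F2\<^esub> (oS \<otimes>\<^bsub>Out_F2\<^esub> (oS \<otimes>\<^bsub>Out_F2\<^esub> oS)) = \<one>\<^bsub>Out_F2\<^esub>"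
    by (simp add: outer_class_mult gens_auto mult_Aut_closed conj_aut_Nil one_Out)
  then show "oS [^]\<^bsub>Out_F2\<^esub> (4::nat) = \<one>\<^bsub>Out_F2\<^esub>"
    by (simp add: eval_nat_numeral Out.m_assoc outer_class_closed gens_auto)
qed

lemma carrier_MCG: "carrier MCG = generate Out_F2 {oL, oR}"
proof -
  have "carrier Out_F2 \<inter> {oL, oR} = {oL, oR}" using outer_class_closed gens_auto by auto
  then show ?thesis unfolding MCG_def by (simp add: carrier_subgroup_generated)
qed

lemma MCG_simps: "F \<otimes>\<^bsub>MCG\<^esub> G = F \<otimes>\<^bsub>Out_F2\<^esub> G" "\<one>\<^bsub>MCG\<^esub> = \<one>\<^bsub>Out_F2\<^esub>"
  by (simp_all add: MCG_def)

interpretation MCG: group MCG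
  unfolding MCG_def by (rule Out.group_subgroup_generated)

lemma MCG_subset: "F \<in> carrier MCG \<Longrightarrow> F \<in> carrier Out_F2"
  unfolding carrier_MCG using Out.generate_in_carrier[of "{oL, oR}"] outer_class_closed gens_auto by auto

lemma MCG_E:
  assumes "F \<in> carrier MCG"
  obtains f where "f \<in> auto F2" "F = outer_class f"
  using MCG_subset[OF assms] unfolding carrier_Out by blast

lemma outer_mat_mult:
  assumes "F \<in> carrier Out_F2" "G \<in> carrier Out_F2"
  shows "outer_mat (F \<otimes>\<^bsub>Out_F2\<^esub> G) = mat_mult (outer_mat F) (outer_mat G)"
  using assms unfolding carrier_Out
  by (auto simp: outer_class_mult outer_mat_outer_class mult_Aut_closed aut_mat_mult)

lemma outer_mat_gens: "outer_mat oL = mL" "outer_mat oR = mR" "outer_mat oS = mS"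
  by (simp_all add: outer_mat_outer_class gens_auto aut_mat_def)

lemma outer_mat_one: "outer_mat \<one>\<^bsub>Out_F2\<^esub> = (1, 0, 0, 1)"
proof -
  have "\<one>\<^bsub>Aut\<^esub> \<in> auto F2" using Aut.one_closed by (simp add: carrier_Aut)
  then show ?thesis unfolding one_Out by (simp add: outer_mat_outer_class aut_mat_def one_Aut)
qed

lemma outer_mat_closed: "F \<in> carrier MCG \<Longrightarrow> outer_mat F \<in> carrier SL2"
  unfolding carrier_MCG
proof (induction rule: generate.induct)
  case one
  then show ?case by (simp add: outer_mat_one)
next
  case (incl h)
  then show ?case by (auto simp: outer_mat_gens)
next
  case (inv h)
  then have h: "h \<in> carrier Out_F2" "outer_mat h \<in> carrier SL2" using outer_class_closed gens_auto by (auto simp: outer_mat_gens)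
  obtain p q r s where i: "outer_mat (inv\<^bsub>Out_F2\<^esub> h) = (p, q, r, s)" by (cases "outer_mat (inv\<^bsub>Out_F2\<^esub> h)")
  have "mat_mult (p, q, r, s) (outer_mat h) = (1, 0, 0, 1)"
    using outer_mat_mult[of "inv\<^bsub>Out_F2\<^esub> h" h] h Out.l_inv[OF h(1)] outer_mat_one i by simp
  moreover have "outer_mat h = mL \<or> outer_mat h = mR" using inv by (auto simp: outer_mat_gens)
  ultimately show ?case unfolding i by auto
next
  case (eng h1 h2)
  then have "h1 \<in> carrier Out_F2" "h2 \<in> carrier Out_F2" using MCG_subset carrier_MCG by auto
  then show ?case using eng SL2.m_closed by (simp add: outer_mat_mult)
qed

lemma outer_mat_hom: "outer_mat \<in> hom MCG SL2"
  by (rule homI) (use outer_mat_closed outer_mat_mult MCG_subset in \<open>auto simp: MCG_simps\<close>)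

interpretation outer_mat: group_hom MCG SL2 outer_mat
  by unfold_locales (rule outer_mat_hom)

text \<open>Solve \<open>L S L = R\<close> for \<open>S\<close>.\<close>

lemma oS_MCG: "oS \<in> carrier MCG"
proof -
  have g: "oL \<in> carrier MCG" "oR \<in> carrier MCG" unfolding carrier_MCG by (auto intro: generate.incl)
  have "oS = inv\<^bsub>MCG\<^esub> oL \<otimes>\<^bsub>MCG\<^esub> (oR \<otimes>\<^bsub>MCG\<^esub> inv\<^bsub>MCG\<^esub> oL)"
  proof -
    have c: "oS \<in> carrier Out_F2" "oL \<in> carrier Out_F2" using outer_class_closed gens_auto by auto
    have "inv\<^bsub>MCG\<^esub> oL = inv\<^bsub>Out_F2\<^esub> oL"
      using g(1) unfolding MCG_def by (simp add: Out.inv_subgroup_generated)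
    then show ?thesis unfolding MCG_simps out_relations(1)[symmetric] using c
      by (simp add: Out.m_assoc) (simp add: Out.m_assoc[symmetric])
  qed
  then show ?thesis using g by simp
qed

lemma word_val_outer_mat: "outer_mat (Out.word_val oL oR b) = wmat b"
  by (induction b) (auto simp: outer_mat_one outer_mat_mult Out.word_val_closed outer_class_closed gens_auto outer_mat_gens)

lemma pow_outer_mat: "outer_mat (oS [^]\<^bsub>Out_F2\<^esub> (k::nat)) = mS [^]\<^bsub>SL2\<^esub> k"
  by (induction k) (auto simp: outer_mat_one outer_mat_mult outer_class_closed gens_auto outer_mat_gens)

lemma MCG_normal_form:
  assumes "F \<in> carrier MCG"
  obtains k b e where "e \<in> {0, 1::nat}"
    "F = oS [^]\<^bsub>Out_F2\<^esub> (k::nat) \<otimes>\<^bsub>Out_F2\<^esub> (Out.word_val oL oR b \<otimes>\<^bsub>Out_F2\<^esub> oS [^]\<^bsub>Out_F2\<^esub> e)"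
proof -
  have "F \<in> Out.normal_forms oL oR oS"
    by (rule Out.generate_normal_forms)
      (use assms outer_class_closed gens_auto out_relations in \<open>auto simp: carrier_MCG\<close>)
  then show thesis unfolding Out.normal_forms_def using that by blast
qed

text \<open>An element of the kernel has a normal form whose matrix is the identity; then its word
  is empty and its power of \<open>S\<close> is divisible by 4.\<close>

lemma inj_outer_mat: "inj_on outer_mat (carrier MCG)"
proof -
  have "F = \<one>\<^bsub>MCG\<^esub>" if F: "F \<in> carrier MCG" "outer_mat F = \<one>\<^bsub>SL2\<^esub>" for F
  proof -
    have c: "oL \<in> carrier Out_F2" "oR \<in> carrier Out_F2" "oS \<in> carrier Out_F2"
      using outer_class_closed gens_auto by auto
    obtain k b e where nf: "e \<in> {0, 1::nat}"
      "F = oS [^]\<^bsub>Out_F2\<^esub> (k::nat) \<otimes>\<^bsub>Out_F2\<^esub> (Out.word_val oL oR b \<otimes>\<^bsub>Out_F2\<^esub> oS [^]\<^bsub>Out_F2\<^esub> e)"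
      using MCG_normal_form[OF F(1)] .
    have "mS [^]\<^bsub>SL2\<^esub> k \<otimes>\<^bsub>SL2\<^esub> (wmat b \<otimes>\<^bsub>SL2\<^esub> mS [^]\<^bsub>SL2\<^esub> e) = (1, 0, 0, 1)"
      using F(2) c unfolding nf by (simp add: outer_mat_mult word_val_outer_mat pow_outer_mat del: SL2.nat_pow_Suc)
    then have b: "b = []" "4 dvd k + e" using normal_form_trivial by blast+
    then obtain j where "k + e = 4 * j" by blast
    then have "F = oS [^]\<^bsub>Out_F2\<^esub> (4 * j)" using nf c b by (simp add: Out.nat_pow_mult)
    also have "\<dots> = \<one>\<^bsub>Out_F2\<^esub>"
      using out_relations(4) c Out.nat_pow_pow[OF c(3), of 4 j] by simp
    finally show ?thesis by (simp add: MCG_simps)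
  qed
  then have "kernel MCG SL2 outer_mat = {\<one>\<^bsub>MCG\<^esub>}" unfolding kernel_def by auto
  then show ?thesis using outer_mat.inj_iff_trivial_ker by simp
qed

lemma outer_mat_image: "outer_mat ` carrier MCG = carrier SL2"
proof (rule SL2_generated)
  show "subgroup (outer_mat ` carrier MCG) SL2" by (rule outer_mat.img_is_subgroup)
  have "oL \<in> carrier MCG" unfolding carrier_MCG by (auto intro: generate.incl)
  then show "mL \<in> outer_mat ` carrier MCG" using outer_mat_gens(1) by force
  show "mS \<in> outer_mat ` carrier MCG" using outer_mat_gens(3) oS_MCG by force
qed

text \<open>The mapping class action carried over to matrices through the isomorphism
  \<open>outer_mat\<close>; all orbit counting takes place there.\<close>

definition act :: "mat \<Rightarrow> word set \<Rightarrow> word set" where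
  "act M c = mcg_act (inv_into (carrier MCG) outer_mat M) c"

lemma act_outer_mat: "F \<in> carrier MCG \<Longrightarrow> act (outer_mat F) c = mcg_act F c"
  unfolding act_def using inj_outer_mat by (simp add: inv_into_f_f)

lemma mcg_act_closed: "\<lbrakk>F \<in> carrier MCG; c \<in> curves\<rbrakk> \<Longrightarrow> mcg_act F c \<in> curves"
  by (metis MCG_E auto_curves mcg_act_outer_class)

lemma mcg_act_mult:
  assumes "F \<in> carrier MCG" "G \<in> carrier MCG" "c \<in> curves"
  shows "mcg_act (F \<otimes>\<^bsub>MCG\<^esub> G) c = mcg_act F (mcg_act G c)"
proof -
  obtain f where f: "f \<in> auto F2" "F = outer_class f" using MCG_E[OF assms(1)] .
  obtain g where g: "g \<in> auto F2" "G = outer_class g" using MCG_E[OF assms(2)] .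
  have "reduced x" if "x \<in> c" for x using that assms(3) unfolding curves_eq conj_class_def by auto
  then have "(f \<otimes>\<^bsub>Aut\<^esub> g) ` c = f ` g ` c" using f g by (auto simp: mult_Aut_apply image_iff)
  then show ?thesis using f g assms(3)
    by (simp add: MCG_simps outer_class_mult mcg_act_outer_class mult_Aut_closed auto_curves)
qed

lemma SL2_E:
  assumes "M \<in> carrier SL2"
  obtains F where "F \<in> carrier MCG" "M = outer_mat F"
  using assms outer_mat_image by blast

lemma act_closed: "\<lbrakk>M \<in> carrier SL2; c \<in> curves\<rbrakk> \<Longrightarrow> act M c \<in> curves"
  by (metis SL2_E act_outer_mat mcg_act_closed)

lemma act_mult:
  "\<lbrakk>M \<in> carrier SL2; N \<in> carrier SL2; c \<in> curves\<rbrakk> \<Longrightarrow> act (M \<otimes>\<^bsub>SL2\<^esub> N) c = act M (act N c)"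
  by (metis SL2_E MCG.m_closed outer_mat.hom_mult act_outer_mat mcg_act_mult)

lemma act_gens: "c \<in> curves \<Longrightarrow> act mL c = curve_L c" "c \<in> curves \<Longrightarrow> act mR c = curve_R c"
  "c \<in> curves \<Longrightarrow> act mS c = aut_S ` c"
proof -
  have g: "oL \<in> carrier MCG" "oR \<in> carrier MCG" unfolding carrier_MCG by (auto intro: generate.incl)
  show "c \<in> curves \<Longrightarrow> act mL c = curve_L c" "c \<in> curves \<Longrightarrow> act mR c = curve_R c"
    "c \<in> curves \<Longrightarrow> act mS c = aut_S ` c"
    using act_outer_mat[OF g(1)] act_outer_mat[OF g(2)] act_outer_mat[OF oS_MCG]
    by (simp_all add: outer_mat_gens mcg_act_outer_class gens_auto curve_L_def curve_R_def)
qed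

lemma act_one: "c \<in> curves \<Longrightarrow> act (1, 0, 0, 1) c = c"
proof -
  assume c: "c \<in> curves"
  have "\<one>\<^bsub>Aut\<^esub> \<in> auto F2" using Aut.one_closed by (simp add: carrier_Aut)
  moreover have "reduced x" if "x \<in> c" for x using that c unfolding curves_eq conj_class_def by auto
  ultimately have "mcg_act \<one>\<^bsub>MCG\<^esub> c = c"
    using c by (auto simp: MCG_simps one_Out mcg_act_outer_class one_Aut image_iff)
  then show ?thesis using act_outer_mat[OF MCG.one_closed] by (simp add: MCG_simps outer_mat_one)
qed

lemma len_c_act_mS:
  assumes "c \<in> curves"
  shows "len_c (act mS c) = len_c c"
proof -
  obtain w where w: "cyclically_reduced w" "c = conj_class w" using curveE[OF assms] .
  define g where "g x = hd (subst_letter [\<b>] [\<A>] x)" for x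
  have "subst [\<b>] [\<A>] v = map g v" for v
  proof (induction v)
    case (Cons x v)
    then show ?case by (cases x) (auto simp: g_def)
  qed auto
  then have "act mS c = conj_class (map g w)"
    using act_gens(3)[OF assms] endo_conj_class[OF aut_S_auto[unfolded aut_S_def], of w]
    by (simp add: aut_S_def w)
  moreover have "cyclically_reduced (map g w)"
  proof -
    have "backtracks (g x) (g y) (g z) = backtracks x y z" for x y z
      by (cases x; cases y; simp add: backtracks_def g_def)
    then show ?thesis using w(1) unfolding cyclically_reduced_iff cyc_sum_map by simp
  qed
  ultimately show ?thesis using w by (simp add: len_c_def curve_length_eq)
qed

lemma orbit_eq: "orbit MCG mcg_act \<gamma> = {act M \<gamma> | M. M \<in> carrier SL2}"
proof -
  have "orbit MCG mcg_act \<gamma> = (\<lambda>F. act (outer_mat F) \<gamma>) ` carrier MCG"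
    unfolding orbit_def using act_outer_mat by auto
  also have "\<dots> = (\<lambda>M. act M \<gamma>) ` (outer_mat ` carrier MCG)" by auto
  finally show ?thesis unfolding outer_mat_image by (simp only: Setcompr_eq_image)
qed

definition mat_torsion :: "word set \<Rightarrow> bool" where
  "mat_torsion \<gamma> \<longleftrightarrow> (\<exists>M\<in>carrier SL2. act M \<gamma> = \<gamma> \<and> M \<noteq> (1, 0, 0, 1) \<and> (\<exists>n::nat. n \<ge> 1 \<and> M [^]\<^bsub>SL2\<^esub> n = (1, 0, 0, 1)))"

lemma torsion_iff: "has_nontrivial_torsion MCG (stabilizer MCG mcg_act \<gamma>) \<longleftrightarrow> mat_torsion \<gamma>"
proof -
  have one: "F = \<one>\<^bsub>MCG\<^esub> \<longleftrightarrow> outer_mat F = (1, 0, 0, 1)" if "F \<in> carrier MCG" for F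
    using inj_on_eq_iff[OF inj_outer_mat that MCG.one_closed] by simp
  have pow: "outer_mat (F [^]\<^bsub>MCG\<^esub> (n::nat)) = outer_mat F [^]\<^bsub>SL2\<^esub> n" if "F \<in> carrier MCG" for F n
    using that by (rule outer_mat.hom_nat_pow)
  have "has_nontrivial_torsion MCG (stabilizer MCG mcg_act \<gamma>) \<longleftrightarrow>
    (\<exists>F\<in>carrier MCG. mcg_act F \<gamma> = \<gamma> \<and> F \<noteq> \<one>\<^bsub>MCG\<^esub> \<and> (\<exists>n::nat. n \<ge> 1 \<and> F [^]\<^bsub>MCG\<^esub> n = \<one>\<^bsub>MCG\<^esub>))"
    unfolding has_nontrivial_torsion_def stabilizer_def by auto
  also have "\<dots> \<longleftrightarrow> (\<exists>F\<in>carrier MCG. act (outer_mat F) \<gamma> = \<gamma> \<and> outer_mat F \<noteq> (1, 0, 0, 1) \<and>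
      (\<exists>n::nat. n \<ge> 1 \<and> outer_mat F [^]\<^bsub>SL2\<^esub> n = (1, 0, 0, 1)))"
    by (intro bex_cong refl) (simp add: act_outer_mat one pow)
  also have "\<dots> \<longleftrightarrow> mat_torsion \<gamma>"
    unfolding mat_torsion_def outer_mat_image[symmetric] by blast
  finally show ?thesis .
qed

subsection \<open>Matrices with nonnegative entries\<close>

lemma gens_SL2 [simp]: "mL \<in> carrier SL2" "mR \<in> carrier SL2" "mS \<in> carrier SL2"
  by simp_all

lemma wmat_closed: "wmat b \<in> carrier SL2"
  by (rule SL2.word_val_closed) simp_all

lemma wmat_append: "wmat (b @ b') = wmat b \<otimes>\<^bsub>SL2\<^esub> wmat b'"
proof (induction b)
  case Nil
  then show ?case using SL2.l_one[OF wmat_closed, of b'] by simp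
next
  case (Cons x b)
  then show ?case using SL2.m_assoc[OF _ wmat_closed wmat_closed] by (simp del: mult_SL2)
qed

text \<open>The weights are the column sums. The reversal occurs because a walk applies its first
  step first, a matrix product its last factor.\<close>

lemma wt_wmat: "wmat (rev b) = (p, q, r, s) \<Longrightarrow> wt b = (p + r, q + s)"
proof (induction b arbitrary: p q r s)
  case (Cons x b)
  obtain p' q' r' s' where M: "wmat (rev b) = (p', q', r', s')" by (cases "wmat (rev b)")
  have "wmat (rev b @ [x]) = wmat (rev b) \<otimes>\<^bsub>SL2\<^esub> wmat [x]" by (rule wmat_append)
  then show ?case using Cons.IH[OF M] Cons.prems M by (cases x) auto
qed auto

lemma wmat_pos:
  assumes "wmat b = (p, q, r, s)"
  shows "p \<ge> 0" "q \<ge> 0" "r \<ge> 0" "s \<ge> 0" "p * s - q * r = 1" "p + q > 0" "r + s > 0"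
    "b \<noteq> [] \<Longrightarrow> p * q + r * s > 0"
proof -
  show *: "p \<ge> 0" "q \<ge> 0" "r \<ge> 0" "s \<ge> 0" "p * s - q * r = 1"
    using wmat_nonneg[of b] assms by auto
  have "p + q + r + s \<ge> 2 + int (length b)" using wmat_nonneg[of b] assms by auto
  have "\<not> (p = 0 \<and> q = 0)" "\<not> (r = 0 \<and> s = 0)" using *(5) by auto
  then show "p + q > 0" "r + s > 0" using * by linarith+
  assume "b \<noteq> []"
  then have gt: "p + q + r + s \<ge> 3" using \<open>p + q + r + s \<ge> 2 + int (length b)\<close> by (cases b) auto
  have "p * q \<ge> 0" "r * s \<ge> 0" "q * r \<ge> 0" using * by auto
  moreover have "\<not> (p * q = 0 \<and> r * s = 0)"
  proof
    assume z: "p * q = 0 \<and> r * s = 0"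
    have "p * s \<ge> 1" using *(5) \<open>q * r \<ge> 0\<close> by linarith
    then have "p \<noteq> 0" "s \<noteq> 0" by auto
    then have qr: "q = 0" "r = 0" using z by auto
    then have "p * s = 1" using *(5) by simp
    then have "p = 1" "s = 1" using *(1,4) zmult_eq_1_iff by auto
    then show False using gt qr by simp
  qed
  ultimately show "p * q + r * s > 0" by linarith
qed

text \<open>The first letter is recognized by which row dominates the other, and can then be
  removed.\<close>

lemma inj_wmat: "wmat b = wmat b' \<Longrightarrow> b = b'"
proof (induction b arbitrary: b')
  case Nil
  show ?case
  proof (rule ccontr)
    assume "[] \<noteq> b'"
    then have "int (length b') \<ge> 1" by (cases b') auto
    moreover obtain p q r s where "wmat b' = (p, q, r, s)" "p + q + r + s \<ge> 2 + int (length b')"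
      using wmat_nonneg[of b'] by metis
    ultimately show False using Nil by simp
  qed
next
  case (Cons x b)
  obtain p q r s where M: "wmat b = (p, q, r, s)" by (cases "wmat b")
  note Mp = wmat_pos[OF M]
  show ?case
  proof (cases b')
    case Nil
    obtain p q r s where "wmat (x # b) = (p, q, r, s)" "p + q + r + s \<ge> 2 + int (length (x # b))"
      using wmat_nonneg[of "x # b"] by metis
    then show ?thesis using Cons.prems Nil by simp
  next
    case (Cons y b'')
    obtain p' q' r' s' where M': "wmat b'' = (p', q', r', s')" by (cases "wmat b''")
    note Mp' = wmat_pos[OF M']
    have "x = y \<and> wmat b = wmat b''"
      using Cons.prems M M' Mp Mp' unfolding Cons by (cases x; cases y) auto
    then show ?thesis using Cons.IH Cons by auto
  qed
qed

text \<open>The inner product of the two columns is unchanged by \<open>mS\<close> on the left and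
  changes sign under \<open>mS\<close> on the right, which determines \<open>e\<close>; it is
  positive on nonempty words. The signs of the row sums then determine \<open>k\<close>.\<close>

lemma nf_unique:
  assumes eq: "mS [^]\<^bsub>SL2\<^esub> (k::nat) \<otimes>\<^bsub>SL2\<^esub> (wmat b \<otimes>\<^bsub>SL2\<^esub> mS [^]\<^bsub>SL2\<^esub> (e::nat)) =
      mS [^]\<^bsub>SL2\<^esub> (k'::nat) \<otimes>\<^bsub>SL2\<^esub> (wmat b' \<otimes>\<^bsub>SL2\<^esub> mS [^]\<^bsub>SL2\<^esub> (e'::nat))"
    and k: "k < 4" "k' < 4" and e: "e < 2" "e' < 2" and b: "b \<noteq> []" "b' \<noteq> []"
  shows "k = k' \<and> b = b' \<and> e = e'"
proof -
  define dot :: "mat \<Rightarrow> int" where "dot Z = (case Z of (p, q, r, s) \<Rightarrow> p * q + r * s)" for Z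
  have Spow: "mS [^]\<^bsub>SL2\<^esub> j \<in> carrier SL2" for j :: nat by simp
  have k4: "k = 0 \<or> k = 1 \<or> k = 2 \<or> k = 3" if "k < 4" for k :: nat using that by auto
  have dotS: "dot (mS [^]\<^bsub>SL2\<^esub> k \<otimes>\<^bsub>SL2\<^esub> Z) = dot Z" if "k < 4" for Z and k :: nat
    using k4[OF that] mS_pow by (cases Z) (auto simp: dot_def algebra_simps simp del: SL2.nat_pow_Suc)
  have dote: "(dot (wmat b \<otimes>\<^bsub>SL2\<^esub> mS [^]\<^bsub>SL2\<^esub> e) > 0 \<longleftrightarrow> e = 0)" if "b \<noteq> []" "e < 2" for b and e :: nat
  proof -
    obtain p q r s where M: "wmat b = (p, q, r, s)" by (cases "wmat b")
    have "e = 0 \<or> e = 1" using that by auto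
    then show ?thesis using wmat_pos(8)[OF M that(1)] mS_pow
      by (auto simp: dot_def M algebra_simps simp del: SL2.nat_pow_Suc)
  qed
  have ee: "e = e'"
    using arg_cong[OF eq, of dot] dotS k dote[OF b(1) e(1)] dote[OF b(2) e(2)] e by auto
  then have eq1: "mS [^]\<^bsub>SL2\<^esub> k \<otimes>\<^bsub>SL2\<^esub> wmat b = mS [^]\<^bsub>SL2\<^esub> k' \<otimes>\<^bsub>SL2\<^esub> wmat b'"
  proof -
    have "(mS [^]\<^bsub>SL2\<^esub> k \<otimes>\<^bsub>SL2\<^esub> wmat b) \<otimes>\<^bsub>SL2\<^esub> mS [^]\<^bsub>SL2\<^esub> e =
        (mS [^]\<^bsub>SL2\<^esub> k' \<otimes>\<^bsub>SL2\<^esub> wmat b') \<otimes>\<^bsub>SL2\<^esub> mS [^]\<^bsub>SL2\<^esub> e"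
      unfolding SL2.m_assoc[OF Spow wmat_closed Spow] using eq ee by simp
    then show ?thesis
      by (rule SL2.right_cancel[OF Spow SL2.m_closed[OF Spow wmat_closed] SL2.m_closed[OF Spow wmat_closed], THEN iffD1])
  qed
  obtain p q r s where M: "wmat b = (p, q, r, s)" by (cases "wmat b")
  obtain p' q' r' s' where M': "wmat b' = (p', q', r', s')" by (cases "wmat b'")
  have kk: "k = k'"
    using k4[OF k(1)] k4[OF k(2)] eq1 wmat_pos(6,7)[OF M] wmat_pos(6,7)[OF M'] mS_pow
    unfolding M M' by (elim disjE) (auto simp del: SL2.nat_pow_Suc)
  then have "wmat b = wmat b'" using SL2.l_cancel[OF eq1[unfolded kk[symmetric]] wmat_closed wmat_closed Spow] by blast
  then show ?thesis using inj_wmat ee kk by blast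
qed

lemma SL2_normal_form:
  assumes "M \<in> carrier SL2"
  obtains k b e where "k < 4" "e < (2::nat)"
    "M = mS [^]\<^bsub>SL2\<^esub> (k::nat) \<otimes>\<^bsub>SL2\<^esub> (wmat b \<otimes>\<^bsub>SL2\<^esub> mS [^]\<^bsub>SL2\<^esub> e)"
proof -
  obtain F where F: "F \<in> carrier MCG" "M = outer_mat F" using SL2_E[OF assms] .
  obtain k b e where nf: "e \<in> {0, 1::nat}"
    "F = oS [^]\<^bsub>Out_F2\<^esub> (k::nat) \<otimes>\<^bsub>Out_F2\<^esub> (Out.word_val oL oR b \<otimes>\<^bsub>Out_F2\<^esub> oS [^]\<^bsub>Out_F2\<^esub> e)"
    using MCG_normal_form[OF F(1)] .
  have c: "oL \<in> carrier Out_F2" "oR \<in> carrier Out_F2" "oS \<in> carrier Out_F2"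
    using outer_class_closed gens_auto by auto
  have "M = mS [^]\<^bsub>SL2\<^esub> k \<otimes>\<^bsub>SL2\<^esub> (wmat b \<otimes>\<^bsub>SL2\<^esub> mS [^]\<^bsub>SL2\<^esub> e)"
    using c unfolding F(2) nf by (simp add: outer_mat_mult word_val_outer_mat pow_outer_mat del: SL2.nat_pow_Suc)
  then have "M = mS [^]\<^bsub>SL2\<^esub> (k mod 4) \<otimes>\<^bsub>SL2\<^esub> (wmat b \<otimes>\<^bsub>SL2\<^esub> mS [^]\<^bsub>SL2\<^esub> e)"
    using mS_pow_mod[of k] by simp
  moreover have "k mod 4 < 4" "e < 2" using nf by auto
  ultimately show thesis using that by blast
qed

subsection \<open>Elements of finite order\<close>

text \<open>Chebyshev values of the second kind: by Cayley-Hamilton, \<open>M^n\<close> is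
  \<open>cheb t n\<close> times \<open>M\<close> minus \<open>cheb t (n - 1)\<close> times the
  identity, with \<open>t\<close> the trace.\<close>

fun cheb :: "int \<Rightarrow> nat \<Rightarrow> int" where
  "cheb t 0 = 0"
| "cheb t (Suc 0) = 1"
| "cheb t (Suc (Suc n)) = t * cheb t (Suc n) - cheb t n"

lemma cheb_growth:
  assumes "\<bar>t\<bar> \<ge> 2"
  shows "\<bar>cheb t (Suc n)\<bar> > \<bar>cheb t n\<bar>"
proof (induction n)
  case (Suc n)
  have "2 * \<bar>cheb t (Suc n)\<bar> \<le> \<bar>t\<bar> * \<bar>cheb t (Suc n)\<bar>" by (rule mult_right_mono) (use assms in auto)
  then have "2 * \<bar>cheb t (Suc n)\<bar> \<le> \<bar>t * cheb t (Suc n)\<bar>" by (simp add: abs_mult)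
  then show ?case using Suc by simp
qed auto

lemma SL2_pow:
  assumes "(p, q, r, s) \<in> carrier SL2"
  shows "(p, q, r, s) [^]\<^bsub>SL2\<^esub> Suc n = (cheb (p + s) (Suc n) * p - cheb (p + s) n, cheb (p + s) (Suc n) * q,
    cheb (p + s) (Suc n) * r, cheb (p + s) (Suc n) * s - cheb (p + s) n)"
proof (induction n)
  case 0
  then show ?case by simp
next
  case (Suc n)
  let ?u = "cheb (p + s)"
  have d: "q * r = p * s - 1" using assms by simp
  have "(p, q, r, s) [^]\<^bsub>SL2\<^esub> Suc (Suc n) = mat_mult ((p, q, r, s) [^]\<^bsub>SL2\<^esub> Suc n) (p, q, r, s)" by simp
  also have "\<dots> = mat_mult (?u (Suc n) * p - ?u n, ?u (Suc n) * q, ?u (Suc n) * r, ?u (Suc n) * s - ?u n) (p, q, r, s)"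
    unfolding Suc ..
  also have "\<dots> = (?u (Suc (Suc n)) * p - ?u (Suc n), ?u (Suc (Suc n)) * q,
      ?u (Suc (Suc n)) * r, ?u (Suc (Suc n)) * s - ?u (Suc n))"
  proof -
    have "?u (Suc n) * q * r = ?u (Suc n) * (p * s - 1)" unfolding d[symmetric] by simp
    moreover have "?u (Suc n) * r * q = ?u (Suc n) * (p * s - 1)" unfolding d[symmetric] by simp
    ultimately show ?thesis by (simp add: algebra_simps)
  qed
  finally show ?case .
qed

text \<open>For trace of absolute value at least 2 the Chebyshev factor is nonzero, so the
  off-diagonal entries vanish along with those of the power.\<close>

lemma finite_order_trace:
  assumes "(p, q, r, s) \<in> carrier SL2" "n \<ge> 1" "(p, q, r, s) [^]\<^bsub>SL2\<^esub> (n::nat) = (1, 0, 0, 1)"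
  shows "\<bar>p + s\<bar> \<le> 1 \<or> (p, q, r, s) \<in> {(1, 0, 0, 1), (- 1, 0, 0, - 1)}"
proof (cases "\<bar>p + s\<bar> \<le> 1")
  case False
  obtain m where n: "n = Suc m" using assms(2) by (cases n) auto
  have "cheb (p + s) (Suc m) \<noteq> 0" using cheb_growth[of "p + s" m] False by auto
  then have "q = 0" "r = 0" using assms(3) unfolding n SL2_pow[OF assms(1)] by auto
  moreover then have "p * s = 1" using assms(1) by simp
  ultimately show ?thesis using zmult_eq_1_iff by auto
qed auto

text \<open>An element of order 3; its inverse is \<open>(- 1, - 1, 1, 0)\<close>.\<close>

abbreviation "mU \<equiv> (0, 1, - 1, - 1) :: mat"

definition conjugate :: "mat \<Rightarrow> mat \<Rightarrow> bool" where
  "conjugate M N \<longleftrightarrow> (\<exists>Z\<in>carrier SL2. mat_mult Z M = mat_mult N Z)"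

lemma mm_assoc: "mat_mult (mat_mult A B) C = mat_mult A (mat_mult B C)"
  by (cases A; cases B; cases C) (simp add: algebra_simps)

lemma conjugate_trans: "conjugate M N \<Longrightarrow> conjugate N K \<Longrightarrow> conjugate M K"
proof -
  assume "conjugate M N" "conjugate N K"
  then obtain Z Y where XY: "Z \<in> carrier SL2" "Y \<in> carrier SL2" "mat_mult Z M = mat_mult N Z" "mat_mult Y N = mat_mult K Y"
    unfolding conjugate_def by blast
  have "mat_mult (mat_mult Y Z) M = mat_mult K (mat_mult Y Z)" using XY mm_assoc by metis
  moreover have "mat_mult Y Z \<in> carrier SL2" using XY SL2.m_closed by simp
  ultimately show ?thesis unfolding conjugate_def by blast
qed

lemma conjugate_T: "conjugate (p, q, r, s) (p + n * r, q + n * s - n * (p + n * r), r, s - n * r)"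
  unfolding conjugate_def by (intro bexI[of _ "(1, n, 0, 1)"]) (auto simp: algebra_simps)

lemma conjugate_S: "conjugate (p, q, r, s) (s, - r, - q, p)"
  unfolding conjugate_def by (intro bexI[of _ mS]) auto

text \<open>Reduction of the quadratic form of an elliptic matrix: as long as the lower left entry is not a
  unit, it can be made smaller by a translation followed by the inversion.\<close>
lemma elliptic_unit:
  assumes "p * s - q * r = 1" "p + s \<in> {0, - 1}"
  shows "\<exists>p' q' r' s'. conjugate (p, q, r, s) (p', q', r', s') \<and> \<bar>r'\<bar> = 1 \<and>
    p' * s' - q' * r' = 1 \<and> p' + s' = p + s"
  using assms
proof (induction "nat \<bar>r\<bar>" arbitrary: p q r s rule: less_induct)
  case less
  have r: "r \<noteq> 0"
  proof
    assume "r = 0"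
    then have "p * s = 1" using less.prems by simp
    then show False using less.prems(2) zmult_eq_1_iff[of p s] by auto
  qed
  define x where "x = 2 * p - (p + s)"
  \<comment> \<open>A nearest-integer quotient: translating by \<open>n\<close> brings the
    difference of the diagonal entries into the interval from \<open>- \<bar>r\<bar>\<close> to
    \<open>\<bar>r\<bar>\<close>.\<close>
  define n where "n = - ((x + \<bar>r\<bar>) div (2 * \<bar>r\<bar>)) * sgn r"
  define p1 q1 s1 where "p1 = p + n * r" and "q1 = q + n * s - n * (p + n * r)" and "s1 = s - n * r"
  have conj1: "conjugate (p, q, r, s) (p1, q1, r, s1)"
    unfolding p1_def q1_def s1_def by (rule conjugate_T)
  have det1: "p1 * s1 - q1 * r = 1" using less.prems(1) by (simp add: p1_def q1_def s1_def algebra_simps)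
  have tr1: "p1 + s1 = p + s" by (simp add: p1_def s1_def)
  have "2 * p1 - (p1 + s1) = x + 2 * (n * r)" by (simp add: p1_def s1_def x_def)
  also have "n * r = - ((x + \<bar>r\<bar>) div (2 * \<bar>r\<bar>)) * \<bar>r\<bar>" unfolding n_def by (simp add: abs_sgn mult.assoc mult.commute)
  finally have "2 * p1 - (p1 + s1) + \<bar>r\<bar> = (x + \<bar>r\<bar>) - (x + \<bar>r\<bar>) div (2 * \<bar>r\<bar>) * (2 * \<bar>r\<bar>)" by simp
  also have "\<dots> = (x + \<bar>r\<bar>) mod (2 * \<bar>r\<bar>)" by (rule minus_div_mult_eq_mod)
  finally have "2 * p1 - (p1 + s1) + \<bar>r\<bar> = (x + \<bar>r\<bar>) mod (2 * \<bar>r\<bar>)" .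
  moreover have "0 \<le> (x + \<bar>r\<bar>) mod (2 * \<bar>r\<bar>)" "(x + \<bar>r\<bar>) mod (2 * \<bar>r\<bar>) < 2 * \<bar>r\<bar>"
    using r by auto
  ultimately have bound: "\<bar>2 * p1 - (p1 + s1)\<bar> \<le> \<bar>r\<bar>" by linarith
  show ?case
  proof (cases "\<bar>q1\<bar> < \<bar>r\<bar>")
    case True
    have conj2: "conjugate (p, q, r, s) (s1, - r, - q1, p1)"
      using conjugate_trans[OF conj1 conjugate_S] .
    have "\<exists>p' q' r' s'. conjugate (s1, - r, - q1, p1) (p', q', r', s') \<and> \<bar>r'\<bar> = 1 \<and>
       p' * s' - q' * r' = 1 \<and> p' + s' = s1 + p1"
      by (rule less.hyps) (use True det1 tr1 less.prems in \<open>auto simp: algebra_simps\<close>)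
    then show ?thesis using conjugate_trans[OF conj2] tr1 by (metis add.commute)
  next
    case False
    let ?t = "p1 + s1"
    have "(2 * p1 - ?t)\<^sup>2 \<le> r\<^sup>2" using bound by (rule abs_le_square_iff[THEN iffD1])
    \<comment> \<open>The discriminant identity. If the upper right entry is not smaller than
      \<open>r\<close>, it yields \<open>4 r^2\<close> at most \<open>r^2 + 4\<close>, hence
      \<open>r\<close> is a unit.\<close>
    moreover have "4 * (- (q1 * r)) = (2 * p1 - ?t)\<^sup>2 + 4 - ?t\<^sup>2"
    proof -
      have "- (q1 * r) = 1 - p1 * s1" using det1 by simp
      then show ?thesis by (simp add: power2_eq_square algebra_simps)
    qed
    moreover have "- (q1 * r) \<ge> r\<^sup>2 \<or> q1 * r \<ge> r\<^sup>2"
    proof -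
      have "\<bar>r\<bar> * \<bar>r\<bar> \<le> \<bar>q1\<bar> * \<bar>r\<bar>" using False by (intro mult_right_mono) auto
      then show ?thesis by (simp add: power2_eq_square abs_mult[symmetric]) linarith
    qed
    moreover have "?t\<^sup>2 \<ge> 0" "?t\<^sup>2 \<le> 1" "(2 * p1 - ?t)\<^sup>2 \<ge> 0" "r\<^sup>2 \<ge> 1" using tr1 less.prems(2) r
      by (auto simp: power2_eq_square int_one_le_iff_zero_less) (metis not_less_iff_gr_or_eq zero_less_mult_iff)+
    ultimately have "3 * r\<^sup>2 \<le> 4" by linarith
    then have "r\<^sup>2 < 2\<^sup>2" by simp
    then have "\<bar>r\<bar> < 2" using power2_less_imp_less[of "\<bar>r\<bar>" 2] by simp
    then have "\<bar>r\<bar> = 1" using r by linarith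
    then show ?thesis using conj1 det1 tr1 by blast
  qed
qed

text \<open>Once the lower left entry is a unit, a translation can prescribe the upper left entry
  \<open>x\<close>; trace and determinant then fix the rest.\<close>

lemma elliptic_conjugate:
  assumes "(p, q, r, s) \<in> carrier SL2"
  shows "p + s = 0 \<Longrightarrow> conjugate (p, q, r, s) mS \<or> conjugate (p, q, r, s) (0, 1, - 1, 0)"
    "p + s = - 1 \<Longrightarrow> conjugate (p, q, r, s) mU \<or> conjugate (p, q, r, s) (- 1, - 1, 1, 0)"
proof -
  have det: "p * s - q * r = 1" using assms by simp
  have T: "conjugate (p, q, r, s) (x, y, r', t - x)"
    if "conjugate (p, q, r, s) (p', q', r', s')" "\<bar>r'\<bar> = 1" "p' * s' - q' * r' = 1" "t = p' + s'"
      "y = (x * (t - x) - 1) * r'" for p' q' r' s' t x y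
  proof -
    define n where "n = (x - p') * r'"
    have rr: "r' * r' = 1" using that(2) by (auto simp: abs_if split: if_splits)
    have nr: "n * r' = x - p'" unfolding n_def using rr by (simp add: mult.assoc)
    have c: "conjugate (p, q, r, s) (p' + n * r', q' + n * s' - n * (p' + n * r'), r', s' - n * r')"
      using conjugate_trans[OF that(1) conjugate_T] .
    have "(p' + n * r') * (s' - n * r') - (q' + n * s' - n * (p' + n * r')) * r' = 1"
      using that(3) by (simp add: algebra_simps)
    then have "(q' + n * s' - n * (p' + n * r')) * r' = x * (t - x) - 1"
      using nr that(4) by (simp add: algebra_simps)
    then have "(q' + n * s' - n * (p' + n * r')) * (r' * r') = (x * (t - x) - 1) * r'"
      by (metis mult.assoc)
    then have y: "q' + n * s' - n * (p' + n * r') = y" using rr that(5) by simp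
    have "p' + n * r' = x" "s' - n * r' = t - x" using nr that(4) by linarith+
    then show ?thesis using c unfolding y by simp
  qed
  {
    assume t: "p + s = 0"
    obtain p' q' r' s' where *: "conjugate (p, q, r, s) (p', q', r', s')" "\<bar>r'\<bar> = 1"
      "p' * s' - q' * r' = 1" "p' + s' = p + s" using elliptic_unit[OF det] t by blast
    have "r' = 1 \<or> r' = - 1" using *(2) by linarith
    then show "conjugate (p, q, r, s) mS \<or> conjugate (p, q, r, s) (0, 1, - 1, 0)"
      using T[OF *(1,2,3) refl, of _ 0] * t by auto
  }
  {
    assume t: "p + s = - 1"
    obtain p' q' r' s' where *: "conjugate (p, q, r, s) (p', q', r', s')" "\<bar>r'\<bar> = 1"
      "p' * s' - q' * r' = 1" "p' + s' = p + s" using elliptic_unit[OF det] t by blast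
    have "r' = 1 \<or> r' = - 1" using *(2) by linarith
    then show "conjugate (p, q, r, s) mU \<or> conjugate (p, q, r, s) (- 1, - 1, 1, 0)"
      using T[OF *(1,2,3) refl, of _ 0] T[OF *(1,2,3) refl, of _ "- 1"] * t by auto
  }
qed

text \<open>\<open>q - r\<close> is the trace of \<open>M mS\<close>. The squares of both traces add
  up to 2 plus the sum of squared entries, so the two products cannot both be elliptic. A stabilizer
  containing \<open>mS\<close> is thus no larger than its powers.\<close>

lemma elliptic_commensurable_S:
  assumes "(p, q, r, s) \<in> carrier SL2" "\<bar>p + s\<bar> \<le> 1" "\<bar>q - r\<bar> \<le> 1"
  shows False
proof -
  have sq: "x\<^sup>2 \<le> 1" if "\<bar>x\<bar> \<le> 1" for x :: int using that abs_square_le_1 by blast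
  have "(p + s)\<^sup>2 + (q - r)\<^sup>2 = p\<^sup>2 + q\<^sup>2 + r\<^sup>2 + s\<^sup>2 + 2 * (p * s - q * r)"
    by (simp add: power2_eq_square algebra_simps)
  then have "p\<^sup>2 + q\<^sup>2 + r\<^sup>2 + s\<^sup>2 \<le> 0" using assms sq[of "p + s"] sq[of "q - r"] by simp
  then have "p = 0" "q = 0" using zero_le_power2[of p] zero_le_power2[of q] zero_le_power2[of r] zero_le_power2[of s]
    by (smt (verit) power2_less_0 zero_less_power2)+
  then show False using assms(1) by simp
qed

text \<open>The three numbers are the traces of \<open>M\<close>, \<open>M mU\<close> and
  \<open>M mU^2\<close>; their squares add up to at least 6.\<close>

lemma elliptic_commensurable_U:
  assumes "(p, q, r, s) \<in> carrier SL2" "\<bar>p + s\<bar> \<le> 1" "\<bar>r - q - s\<bar> \<le> 1" "\<bar>q - p - r\<bar> \<le> 1"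
  shows False
proof -
  have sq: "x\<^sup>2 \<le> 1" if "\<bar>x\<bar> \<le> 1" for x :: int using that abs_square_le_1 by blast
  have "(p + s)\<^sup>2 + (r - q - s)\<^sup>2 + (q - p - r)\<^sup>2 =
      6 * (p * s - q * r) + ((p - s + r)\<^sup>2 + (p - s - q)\<^sup>2 + (q + r)\<^sup>2)"
    by (simp add: power2_eq_square algebra_simps)
  then show False using assms sq[of "p + s"] sq[of "r - q - s"] sq[of "q - p - r"]
      zero_le_power2[of "p - s + r"] zero_le_power2[of "p - s - q"] zero_le_power2[of "q + r"] by simp
qed

section \<open>Counting curves in an orbit\<close>

lemma act_wmat: "c \<in> curves \<Longrightarrow> act (wmat b) c = torus.W (rev b) c"
proof (induction b)
  case Nil
  then show ?case by (simp add: act_one)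
next
  case (Cons x b)
  have "act (wmat (x # b)) c = act (if x then mL else mR) (act (wmat b) c)"
    using act_mult[OF _ wmat_closed Cons.prems, of "if x then mL else mR" b] by simp
  also have "\<dots> = torus.W [x] (act (wmat b) c)"
    using act_gens[OF act_closed[OF wmat_closed Cons.prems]] by simp
  finally show ?case using Cons by (simp add: walk_append)
qed

lemma len_c_act_mS_pow: "c \<in> curves \<Longrightarrow> len_c (act (mS [^]\<^bsub>SL2\<^esub> (k::nat)) c) = len_c c"
proof (induction k arbitrary: c)
  case 0
  then show ?case by (simp add: act_one)
next
  case (Suc k)
  have "act (mS [^]\<^bsub>SL2\<^esub> Suc k) c = act (mS [^]\<^bsub>SL2\<^esub> k) (act mS c)"
    using act_mult[of "mS [^]\<^bsub>SL2\<^esub> k" mS c] Suc.prems by simp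
  then show ?case using Suc.IH[of "act mS c"] Suc.prems act_closed[of mS c] len_c_act_mS by simp
qed

abbreviation "mN \<equiv> (- 1, 0, 0, - 1) :: mat"

lemma act_mN: "c \<in> curves \<Longrightarrow> act mN c = act mS (act mS c)"
  using act_mult[of mS mS c] by simp

lemma len_c_act_mN: "c \<in> curves \<Longrightarrow> len_c (act mN c) = len_c c"
  by (simp add: act_mN len_c_act_mS act_closed)

definition mats_of_length :: "word set \<Rightarrow> int \<Rightarrow> mat set" where
  "mats_of_length \<gamma> L = {M \<in> carrier SL2. len_c (act M \<gamma>) = L}"

definition stab :: "word set \<Rightarrow> mat set" where
  "stab \<gamma> = {M \<in> carrier SL2. act M \<gamma> = \<gamma>}"

definition curves_of_length :: "word set \<Rightarrow> int \<Rightarrow> word set set" where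
  "curves_of_length \<gamma> L = {\<alpha> \<in> orbit MCG mcg_act \<gamma>. int (curve_length \<alpha>) = L}"

lemma curves_of_length_eq: "curves_of_length \<gamma> L = (\<lambda>M. act M \<gamma>) ` mats_of_length \<gamma> L"
  unfolding curves_of_length_def orbit_eq mats_of_length_def len_c_def by blast

lemma act_act_inv: "\<lbrakk>M \<in> carrier SL2; c \<in> curves\<rbrakk> \<Longrightarrow> act (inv\<^bsub>SL2\<^esub> M) (act M c) = c"
  using act_mult[of "inv\<^bsub>SL2\<^esub> M" M c] by (simp add: SL2.l_inv[unfolded one_SL2 mult_SL2] act_one)

lemma curves_of_length_act:
  assumes "Z \<in> carrier SL2" "\<gamma> \<in> curves"
  shows "curves_of_length (act Z \<gamma>) L = curves_of_length \<gamma> L"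
proof -
  have "\<exists>N \<in> carrier SL2. act M (act Z \<gamma>) = act N \<gamma>" if "M \<in> carrier SL2" for M
    using act_mult[OF that assms] SL2.m_closed[OF that assms(1)] by metis
  moreover have "\<exists>N \<in> carrier SL2. act M \<gamma> = act N (act Z \<gamma>)" if "M \<in> carrier SL2" for M
  proof
    have i: "inv\<^bsub>SL2\<^esub> Z \<in> carrier SL2" using assms by simp
    show "M \<otimes>\<^bsub>SL2\<^esub> inv\<^bsub>SL2\<^esub> Z \<in> carrier SL2" using SL2.m_closed[OF that i] .
    show "act M \<gamma> = act (M \<otimes>\<^bsub>SL2\<^esub> inv\<^bsub>SL2\<^esub> Z) (act Z \<gamma>)"
      unfolding act_mult[OF that i act_closed[OF assms]] act_act_inv[OF assms] ..
  qed
  ultimately have "orbit MCG mcg_act (act Z \<gamma>) = orbit MCG mcg_act \<gamma>" unfolding orbit_eq by fast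
  then show ?thesis unfolding curves_of_length_def by simp
qed

lemma stab_mult: "\<lbrakk>\<gamma> \<in> curves; M \<in> stab \<gamma>; N \<in> stab \<gamma>\<rbrakk> \<Longrightarrow> M \<otimes>\<^bsub>SL2\<^esub> N \<in> stab \<gamma>"
  unfolding stab_def using act_mult SL2.m_closed by auto

lemma stab_one: "\<gamma> \<in> curves \<Longrightarrow> (1, 0, 0, 1) \<in> stab \<gamma>"
  unfolding stab_def by (simp add: act_one)

lemma stab_conjugate:
  assumes "\<gamma> \<in> curves" "M \<in> stab \<gamma>" "conjugate M N" "N \<in> carrier SL2"
  shows "\<exists>Z\<in>carrier SL2. N \<in> stab (act Z \<gamma>)"
proof -
  obtain Z where Z: "Z \<in> carrier SL2" "mat_mult Z M = mat_mult N Z" using assms(3) unfolding conjugate_def by blast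
  have "act N (act Z \<gamma>) = act Z (act M \<gamma>)"
    using act_mult[OF assms(4) Z(1) assms(1)] act_mult[of Z M \<gamma>] Z assms unfolding stab_def by simp
  then have "N \<in> stab (act Z \<gamma>)" using assms unfolding stab_def by simp
  then show ?thesis using Z by blast
qed

text \<open>Orbit-stabilizer: the matrices taking \<gamma> to a given curve form a coset of the
  stabilizer.\<close>

lemma card_mats_of_length:
  assumes "\<gamma> \<in> curves" "finite (mats_of_length \<gamma> L)"
  shows "card (mats_of_length \<gamma> L) = card (stab \<gamma>) * card (curves_of_length \<gamma> L)"
proof -
  have fib: "card {M \<in> mats_of_length \<gamma> L. act M \<gamma> = \<alpha>} = card (stab \<gamma>)" if \<alpha>: "\<alpha> \<in> curves_of_length \<gamma> L" for \<alpha>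
  proof -
    obtain M0 where "M0 \<in> mats_of_length \<gamma> L" "\<alpha> = act M0 \<gamma>"
      using \<alpha> unfolding curves_of_length_eq by blast
    then have M0: "M0 \<in> carrier SL2" "len_c (act M0 \<gamma>) = L" "\<alpha> = act M0 \<gamma>"
      by (simp_all add: mats_of_length_def)
    have "{M \<in> mats_of_length \<gamma> L. act M \<gamma> = \<alpha>} = (\<lambda>h. M0 \<otimes>\<^bsub>SL2\<^esub> h) ` stab \<gamma>"
    proof (intro equalityI subsetI)
      fix M assume "M \<in> {M \<in> mats_of_length \<gamma> L. act M \<gamma> = \<alpha>}"
      then have M: "M \<in> carrier SL2" "act M \<gamma> = act M0 \<gamma>" using M0 by (simp_all add: mats_of_length_def)
      have i: "inv\<^bsub>SL2\<^esub> M0 \<in> carrier SL2" using M0 by simp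
      have "act (inv\<^bsub>SL2\<^esub> M0 \<otimes>\<^bsub>SL2\<^esub> M) \<gamma> = \<gamma>"
        unfolding act_mult[OF i M(1) assms(1)] M(2) by (rule act_act_inv[OF M0(1) assms(1)])
      then have "inv\<^bsub>SL2\<^esub> M0 \<otimes>\<^bsub>SL2\<^esub> M \<in> stab \<gamma>"
        unfolding stab_def using SL2.m_closed[OF i M(1)] by simp
      moreover have "M = M0 \<otimes>\<^bsub>SL2\<^esub> (inv\<^bsub>SL2\<^esub> M0 \<otimes>\<^bsub>SL2\<^esub> M)"
        unfolding SL2.m_assoc[OF M0(1) i M(1), symmetric] SL2.r_inv[OF M0(1)]
        by (rule SL2.l_one[OF M(1), symmetric])
      ultimately show "M \<in> (\<lambda>h. M0 \<otimes>\<^bsub>SL2\<^esub> h) ` stab \<gamma>" by blast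
    next
      fix M assume "M \<in> (\<lambda>h. M0 \<otimes>\<^bsub>SL2\<^esub> h) ` stab \<gamma>"
      then obtain h where "h \<in> stab \<gamma>" "M = M0 \<otimes>\<^bsub>SL2\<^esub> h" by blast
      then have h: "h \<in> carrier SL2" "act h \<gamma> = \<gamma>" "M = M0 \<otimes>\<^bsub>SL2\<^esub> h" by (simp_all add: stab_def)
      then have "act M \<gamma> = act M0 \<gamma>" using act_mult[OF M0(1) h(1) assms(1)] by simp
      then show "M \<in> {M \<in> mats_of_length \<gamma> L. act M \<gamma> = \<alpha>}"
        using M0 SL2.m_closed[OF M0(1) h(1)] h(3) by (simp add: mats_of_length_def)
    qed
    moreover have "inj_on (\<lambda>h. M0 \<otimes>\<^bsub>SL2\<^esub> h) (stab \<gamma>)"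
    proof (rule inj_onI)
      fix h h' assume h: "h \<in> stab \<gamma>" "h' \<in> stab \<gamma>" and eq: "M0 \<otimes>\<^bsub>SL2\<^esub> h = M0 \<otimes>\<^bsub>SL2\<^esub> h'"
      have "h \<in> carrier SL2" "h' \<in> carrier SL2" using h by (simp_all add: stab_def)
      then show "h = h'" using SL2.l_cancel[OF eq] M0(1) by blast
    qed
    ultimately show ?thesis by (simp add: card_image)
  qed
  have "card (mats_of_length \<gamma> L) = (\<Sum>\<alpha>\<in>curves_of_length \<gamma> L. card {M \<in> mats_of_length \<gamma> L. act M \<gamma> = \<alpha>})"
    using sum.image_gen[OF assms(2), of "\<lambda>_. 1::nat" "\<lambda>M. act M \<gamma>"] by (simp add: curves_of_length_eq)
  then show ?thesis using fib by simp
qed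

definition phi_like_orbit :: "word set \<Rightarrow> bool" where
  "phi_like_orbit \<gamma> \<longleftrightarrow> (\<exists>F m M. phi_like F \<and> (\<forall>L\<ge>M. int (card (curves_of_length \<gamma> L)) = m * F L) \<and>
     m = (if mat_torsion \<gamma> then 2 else 4))"

lemma phi_like_orbitI:
  assumes "phi_like F" "\<And>L. L \<ge> M \<Longrightarrow> int (card (curves_of_length \<gamma> L)) = m * F L"
    "m = (if mat_torsion \<gamma> then 2 else 4)"
  shows "phi_like_orbit \<gamma>"
  using assms unfolding phi_like_orbit_def by blast

subsection \<open>Filling curves\<close>

text \<open>Quantifying over all translates of \<gamma> covers every conjugate of \<open>L\<close>,
  including those related to \<open>R\<close>.\<close>

definition fills :: "word set \<Rightarrow> bool" where
  "fills \<gamma> \<longleftrightarrow> \<gamma> \<in> curves \<and> (\<forall>M\<in>carrier SL2. curve_L (act M \<gamma>) \<noteq> act M \<gamma>)"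

lemma fills_act: "\<lbrakk>fills \<gamma>; Z \<in> carrier SL2\<rbrakk> \<Longrightarrow> fills (act Z \<gamma>)"
  unfolding fills_def using act_closed act_mult SL2.m_closed by metis

lemma curve_L_S_R: "c \<in> curves \<Longrightarrow> curve_L (act mS (curve_R c)) = act mS c"
proof -
  assume c: "c \<in> curves"
  have "curve_L (act mS (curve_R c)) = act mL (act mS (act mR c))"
    using c act_closed act_gens gens_SL2 by metis
  also have "\<dots> = act (mat_mult mL (mat_mult mS mR)) c"
    using c act_closed act_mult[of mS mR c] act_mult[of mL "mat_mult mS mR" c] by simp
  finally show ?thesis by simp
qed

lemma curve_L_S_L: "c \<in> curves \<Longrightarrow> curve_L (act mS (curve_L c)) = curve_R c"
proof -
  assume c: "c \<in> curves"
  have "curve_L (act mS (curve_L c)) = act mL (act mS (act mL c))"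
    using c act_closed act_gens gens_SL2 by metis
  also have "\<dots> = act (mat_mult mL (mat_mult mS mL)) c"
    using c act_closed act_mult[of mS mL c] act_mult[of mL "mat_mult mS mL" c] by simp
  finally show ?thesis using act_gens(2)[OF c] by simp
qed

lemma fills_filling:
  assumes "fills \<gamma>"
  shows "torus.filling \<gamma>"
  unfolding torus.filling_def
proof
  fix b
  define c where "c = torus.W b \<gamma>"
  have g: "\<gamma> \<in> curves" using assms fills_def by blast
  have "c = act (wmat (rev b)) \<gamma>" unfolding c_def using act_wmat[OF g, of "rev b"] by simp
  then have c: "fills c" using fills_act[OF assms wmat_closed] by simp
  then have "c \<in> curves" unfolding fills_def by blast
  moreover have "curve_L (act (1, 0, 0, 1) c) \<noteq> act (1, 0, 0, 1) c"
    using c[unfolded fills_def, THEN conjunct2, THEN bspec, of "(1, 0, 0, 1)"] by simp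
  ultimately have cc: "c \<in> curves" "curve_L c \<noteq> c" using act_one by simp_all
  have "curve_R c \<noteq> c"
  proof
    assume "curve_R c = c"
    then have "curve_L (act mS c) = act mS c" using curve_L_S_R[OF cc(1)] by simp
    then show False using c gens_SL2(3) unfolding fills_def by blast
  qed
  then show "curve_L (torus.W b \<gamma>) \<noteq> torus.W b \<gamma> \<and> curve_R (torus.W b \<gamma>) \<noteq> torus.W b \<gamma>"
    using cc unfolding c_def by blast
qed

lemma torus_len_W: "c \<in> curves \<Longrightarrow> torus.len (torus.W b c) = len_c (torus.W b c)"
  using torus_len torus.W_closed by blast

lemma fills_countable:
  assumes "fills \<gamma>"
  shows "finite {b. len_c (torus.W b \<gamma>) = L}" "phi_like (torus.count \<gamma>)"
    "torus.count \<gamma> L = int (card {b. len_c (torus.W b \<gamma>) = L})"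
proof -
  have g: "\<gamma> \<in> curves" using assms fills_def by blast
  have "torus.countable_tree \<gamma>" using torus.filling_countable_tree[OF g fills_filling[OF assms]] .
  then show "finite {b. len_c (torus.W b \<gamma>) = L}" "phi_like (torus.count \<gamma>)"
    unfolding torus.countable_tree_def torus_len_W[OF g] by auto
  show "torus.count \<gamma> L = int (card {b. len_c (torus.W b \<gamma>) = L})"
    unfolding torus.count_def torus_len_W[OF g] ..
qed

text \<open>In the normal form the four powers on the left leave the length alone, and the trailing
  exponent selects the tree rooted at \<gamma> or at \<open>act mS \<gamma>\<close>.\<close>

lemma mats_of_length_fills:
  assumes "fills \<gamma>"
  shows "finite (mats_of_length \<gamma> L)"
    "L \<noteq> len_c \<gamma> \<Longrightarrow> int (card (mats_of_length \<gamma> L)) = 4 * (torus.count \<gamma> L + torus.count (act mS \<gamma>) L)"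
proof -
  have g: "\<gamma> \<in> curves" "act mS \<gamma> \<in> curves" using assms act_closed[of mS] fills_def by auto
  have fS: "fills (act mS \<gamma>)" using fills_act[OF assms gens_SL2(3)] .
  let ?s = "\<lambda>k::nat. mS [^]\<^bsub>SL2\<^esub> k"
  define \<Phi> where "\<Phi> = (\<lambda>(k, b, e). ?s k \<otimes>\<^bsub>SL2\<^esub> (wmat b \<otimes>\<^bsub>SL2\<^esub> ?s e))"
  define E where "E = {(b, e). e < 2 \<and> len_c (torus.W (rev b) (act (?s e) \<gamma>)) = L}"
  have s: "?s k \<in> carrier SL2" for k by simp
  have len: "len_c (act (\<Phi> (k, b, e)) \<gamma>) = len_c (torus.W (rev b) (act (?s e) \<gamma>))" for k b e
  proof -
    have c: "act (?s e) \<gamma> \<in> curves" using act_closed[OF s g(1)] .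
    have "act (\<Phi> (k, b, e)) \<gamma> = act (?s k) (act (wmat b) (act (?s e) \<gamma>))"
      unfolding \<Phi>_def prod.case
      using act_mult[OF s SL2.m_closed[OF wmat_closed s] g(1)] act_mult[OF wmat_closed s g(1)] by metis
    then show ?thesis using len_c_act_mS_pow act_closed[OF wmat_closed c] act_wmat[OF c] by simp
  qed
  have im: "mats_of_length \<gamma> L = \<Phi> ` ({..<4} \<times> E)"
  proof (intro equalityI subsetI)
    fix M assume M: "M \<in> mats_of_length \<gamma> L"
    then obtain k b e where nf: "k < 4" "e < (2::nat)" "M = ?s k \<otimes>\<^bsub>SL2\<^esub> (wmat b \<otimes>\<^bsub>SL2\<^esub> ?s e)"
      using SL2_normal_form unfolding mats_of_length_def by blast
    then have M': "M = \<Phi> (k, b, e)" by (simp add: \<Phi>_def)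
    have "(b, e) \<in> E" using M nf(2) len[of k b e] unfolding E_def mats_of_length_def M' by simp
    then show "M \<in> \<Phi> ` ({..<4} \<times> E)" using nf(1) M' by blast
  next
    fix M assume "M \<in> \<Phi> ` ({..<4} \<times> E)"
    then obtain k b e where M: "M = \<Phi> (k, b, e)" "(b, e) \<in> E" by auto
    have "M \<in> carrier SL2" unfolding M(1) \<Phi>_def prod.case by (intro SL2.m_closed s wmat_closed)
    then show "M \<in> mats_of_length \<gamma> L" using len[of k b e] M unfolding mats_of_length_def E_def by simp
  qed
  let ?B0 = "{b. len_c (torus.W b \<gamma>) = L}" and ?B1 = "{b. len_c (torus.W b (act mS \<gamma>)) = L}"
  have E: "E = (\<lambda>b. (rev b, 0)) ` ?B0 \<union> (\<lambda>b. (rev b, 1)) ` ?B1"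
  proof -
    have s01: "act (?s 0) \<gamma> = \<gamma>" "act (?s 1) \<gamma> = act mS \<gamma>" using mS_pow act_one[OF g(1)] by auto
    have "(b, e) \<in> E \<longleftrightarrow> (b, e) \<in> (\<lambda>b. (rev b, 0)) ` ?B0 \<union> (\<lambda>b. (rev b, 1)) ` ?B1" for b and e :: nat
    proof -
      have "e < 2 \<longleftrightarrow> e = 0 \<or> e = 1" by auto
      moreover have "\<exists>b'. b = rev b'" by (metis rev_rev_ident)
      ultimately show ?thesis unfolding E_def using s01 by (auto simp del: SL2.nat_pow_Suc SL2.nat_pow_0)
    qed
    then show ?thesis by auto
  qed
  have fin: "finite ?B0" "finite ?B1" using fills_countable(1) assms fS by auto
  then have finE: "finite E" unfolding E by simp
  then show "finite (mats_of_length \<gamma> L)" unfolding im by simp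
  assume L: "L \<noteq> len_c \<gamma>"
  have "inj_on \<Phi> ({..<4} \<times> E)"
  proof (rule inj_onI)
    fix x y assume x: "x \<in> {..<4} \<times> E" and y: "y \<in> {..<4} \<times> E" and eq: "\<Phi> x = \<Phi> y"
    obtain k b e where xx: "x = (k, b, e)" by (cases x)
    obtain k' b' e' where yy: "y = (k', b', e')" by (cases y)
    \<comment> \<open>An empty word gives the length of \<gamma> itself; excluding this length
      leaves only words for which the normal form is unique.\<close>
    have ne: "b \<noteq> []" if "(b, e) \<in> E" for b e
      using that L len_c_act_mS_pow[OF g(1), of e] unfolding E_def by auto
    have "k = k' \<and> b = b' \<and> e = e'"
      by (rule nf_unique) (use eq x y ne in \<open>auto simp: xx yy \<Phi>_def E_def simp del: mult_SL2\<close>)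
    then show "x = y" unfolding xx yy by simp
  qed
  then have "card (mats_of_length \<gamma> L) = 4 * card E" unfolding im by (simp add: card_image card_cartesian_product)
  also have "card E = card ?B0 + card ?B1"
  proof -
    have "card E = card ((\<lambda>b. (rev b, 0::nat)) ` ?B0) + card ((\<lambda>b. (rev b, 1::nat)) ` ?B1)"
      unfolding E by (rule card_Un_disjoint) (use fin in auto)
    then show ?thesis by (simp add: card_image inj_on_def)
  qed
  finally show "int (card (mats_of_length \<gamma> L)) = 4 * (torus.count \<gamma> L + torus.count (act mS \<gamma>) L)"
    using fills_countable(3) assms fS by simp
qed

text \<open>The stabilizer consists of matrices that keep the length of \<gamma>, and there are
  finitely many of those.\<close>

lemma finite_stab:
  assumes "fills \<gamma>"
  shows "finite (stab \<gamma>)"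
  by (rule finite_subset[OF _ mats_of_length_fills(1)[OF assms, of "len_c \<gamma>"]])
    (auto simp: stab_def mats_of_length_def)

lemma stab_pow: "\<lbrakk>\<gamma> \<in> curves; M \<in> stab \<gamma>\<rbrakk> \<Longrightarrow> M [^]\<^bsub>SL2\<^esub> (n::nat) \<in> stab \<gamma>"
  using stab_one stab_mult by (induction n) (simp_all del: mult_SL2)

lemma stab_finite_order:
  assumes "fills \<gamma>" "M \<in> stab \<gamma>"
  shows "\<exists>n::nat. n \<ge> 1 \<and> M [^]\<^bsub>SL2\<^esub> n = (1, 0, 0, 1)"
proof -
  have g: "\<gamma> \<in> curves" and M: "M \<in> carrier SL2" using assms by (auto simp: fills_def stab_def)
  have "finite (range (\<lambda>n::nat. M [^]\<^bsub>SL2\<^esub> n))"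
    by (rule finite_subset[OF _ finite_stab[OF assms(1)]]) (use stab_pow[OF g assms(2)] in auto)
  then have "\<not> inj (\<lambda>n::nat. M [^]\<^bsub>SL2\<^esub> n)" using finite_imageD infinite_UNIV_nat by blast
  then obtain i j where "i \<noteq> j" "M [^]\<^bsub>SL2\<^esub> (i::nat) = M [^]\<^bsub>SL2\<^esub> (j::nat)" unfolding inj_def by blast
  then obtain i j where ij: "i < j" "M [^]\<^bsub>SL2\<^esub> (i::nat) = M [^]\<^bsub>SL2\<^esub> (j::nat)"
    by (metis linorder_neqE_nat)
  have "M [^]\<^bsub>SL2\<^esub> i \<otimes>\<^bsub>SL2\<^esub> M [^]\<^bsub>SL2\<^esub> (j - i) = M [^]\<^bsub>SL2\<^esub> j"
    using SL2.nat_pow_mult[OF M, of i "j - i"] ij(1) by simp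
  then have "M [^]\<^bsub>SL2\<^esub> (j - i) = \<one>\<^bsub>SL2\<^esub>"
    using ij(2) M SL2.r_cancel_one[of "M [^]\<^bsub>SL2\<^esub> i" "M [^]\<^bsub>SL2\<^esub> (j - i)"] by (simp del: mult_SL2)
  then show ?thesis using ij(1) by (intro exI[of _ "j - i"]) auto
qed

lemma stab_trace:
  assumes "fills \<gamma>" "(p, q, r, s) \<in> stab \<gamma>"
  shows "\<bar>p + s\<bar> \<le> 1 \<or> (p, q, r, s) \<in> {(1, 0, 0, 1), mN}"
proof -
  have "(p, q, r, s) \<in> carrier SL2" using assms(2) by (auto simp: stab_def)
  then show ?thesis using finite_order_trace stab_finite_order[OF assms] by blast
qed

lemma mat_torsion_fills:
  assumes "fills \<gamma>"
  shows "mat_torsion \<gamma> \<longleftrightarrow> stab \<gamma> \<noteq> {(1, 0, 0, 1)}"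
proof -
  have one: "(1, 0, 0, 1) \<in> stab \<gamma>" using stab_one assms fills_def by blast
  have "mat_torsion \<gamma> \<longleftrightarrow> (\<exists>M \<in> stab \<gamma>. M \<noteq> (1, 0, 0, 1) \<and> (\<exists>n::nat. n \<ge> 1 \<and> M [^]\<^bsub>SL2\<^esub> n = (1, 0, 0, 1)))"
    unfolding mat_torsion_def stab_def by blast
  also have "\<dots> \<longleftrightarrow> (\<exists>M \<in> stab \<gamma>. M \<noteq> (1, 0, 0, 1))" using stab_finite_order[OF assms] by blast
  also have "\<dots> \<longleftrightarrow> stab \<gamma> \<noteq> {(1, 0, 0, 1)}" using one by blast
  finally show ?thesis .
qed

text \<open>The stabilizer is exactly the group of order 4 generated by \<open>mS\<close>, and the
  two trees coincide: 8 times the count divided by 4.\<close>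

lemma counts_stab_S:
  assumes "fills \<gamma>" "mS \<in> stab \<gamma>"
  shows "\<exists>F M. phi_like F \<and> (\<forall>L\<ge>M. int (card (curves_of_length \<gamma> L)) = 2 * F L)"
proof -
  have g: "\<gamma> \<in> curves" using assms fills_def by blast
  have "stab \<gamma> = {(1, 0, 0, 1), mN, mS, (0, 1, - 1, 0)}"
  proof (intro equalityI subsetI)
    fix M assume M: "M \<in> stab \<gamma>"
    obtain p q r s where pq: "M = (p, q, r, s)" by (cases M)
    have MS: "(q, - p, s, - r) \<in> stab \<gamma>" using stab_mult[OF g M assms(2)] pq by simp
    have "\<not> (\<bar>p + s\<bar> \<le> 1 \<and> \<bar>q - r\<bar> \<le> 1)"
      using elliptic_commensurable_S M unfolding pq stab_def by blast
    then have "(p, q, r, s) \<in> {(1, 0, 0, 1), mN} \<or> (q, - p, s, - r) \<in> {(1, 0, 0, 1), mN}"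
      using stab_trace[OF assms(1) M[unfolded pq]] stab_trace[OF assms(1) MS] by auto
    then show "M \<in> {(1, 0, 0, 1), mN, mS, (0, 1, - 1, 0)}" unfolding pq by auto
  next
    fix M assume "M \<in> {(1, 0, 0, 1), mN, mS, (0, 1, - 1, 0)}"
    then show "M \<in> stab \<gamma>"
      using stab_one[OF g] assms(2) stab_mult[OF g assms(2) assms(2)]
        stab_mult[OF g stab_mult[OF g assms(2) assms(2)] assms(2)] by auto
  qed
  then have card: "card (stab \<gamma>) = 4" by simp
  have S: "act mS \<gamma> = \<gamma>" using assms(2) by (simp add: stab_def)
  have "int (card (curves_of_length \<gamma> L)) = 2 * torus.count \<gamma> L" if "L \<ge> len_c \<gamma> + 1" for L
    using mats_of_length_fills(2)[OF assms(1), of L]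
      card_mats_of_length[OF g mats_of_length_fills(1)[OF assms(1)], of L] that card S by simp
  then show ?thesis using fills_countable(2)[OF assms(1)] by blast
qed

lemma count_mN:
  assumes "c \<in> curves"
  shows "torus.count (act mN c) L = torus.count c L"
proof -
  have "len_c (torus.W b (act mN c)) = len_c (torus.W b c)" for b
  proof -
    obtain p q r s where M: "wmat (rev b) = (p, q, r, s)" by (cases "wmat (rev b)")
    have "torus.W b (act mN c) = act (wmat (rev b)) (act mN c)"
      using act_wmat[OF act_closed[OF _ assms], of mN "rev b"] by simp
    also have "\<dots> = act (wmat (rev b) \<otimes>\<^bsub>SL2\<^esub> mN) c"
      by (rule act_mult[symmetric]) (simp_all add: wmat_closed assms)
    also have "wmat (rev b) \<otimes>\<^bsub>SL2\<^esub> mN = mN \<otimes>\<^bsub>SL2\<^esub> wmat (rev b)" unfolding M by simp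
    also have "act (mN \<otimes>\<^bsub>SL2\<^esub> wmat (rev b)) c = act mN (act (wmat (rev b)) c)"
      by (rule act_mult) (simp_all add: wmat_closed assms)
    finally show ?thesis
      using len_c_act_mN[OF act_closed[OF wmat_closed[of "rev b"] assms]] act_wmat[OF assms, of "rev b"] by simp
  qed
  then show ?thesis
    unfolding torus.count_def torus_len_W[OF assms] torus_len_W[OF act_closed[OF _ assms], of mN, simplified] by simp
qed

text \<open>From \<open>mS mU = mL\<close> the two subtrees below \<gamma> are rooted at
  \<open>act mS \<gamma>\<close> and its image under \<open>mN\<close>, so the count of \<gamma> is
  eventually twice that of \<open>act mS \<gamma>\<close>. The total of 12 single counts is divided
  by 3 or 6.\<close>

lemma counts_stab_U:
  assumes "fills \<gamma>" "mU \<in> stab \<gamma>"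
  shows "\<exists>F M. phi_like F \<and> (\<forall>L\<ge>M. int (card (curves_of_length \<gamma> L)) = 2 * F L)"
proof -
  have g: "\<gamma> \<in> curves" using assms fills_def by blast
  let ?V = "(- 1, - 1, 1, 0) :: mat"
  have V: "?V \<in> stab \<gamma>" using stab_mult[OF g assms(2) assms(2)] by simp
  have sub: "M \<in> {(1, 0, 0, 1), mU, ?V} \<union> {mN, (0, - 1, 1, 1), (1, 1, - 1, 0)}" if M: "M \<in> stab \<gamma>" for M
  proof -
    obtain p q r s where pq: "M = (p, q, r, s)" by (cases M)
    have MU: "(- q, p - q, - s, r - s) \<in> stab \<gamma>" using stab_mult[OF g M assms(2)] pq by simp
    have MV: "(q - p, - p, s - r, - r) \<in> stab \<gamma>" using stab_mult[OF g M V] pq by simp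
    have "\<not> (\<bar>p + s\<bar> \<le> 1 \<and> \<bar>r - q - s\<bar> \<le> 1 \<and> \<bar>q - p - r\<bar> \<le> 1)"
      using elliptic_commensurable_U M unfolding pq stab_def by blast
    then have "\<not> (\<bar>p + s\<bar> \<le> 1 \<and> \<bar>- q + (r - s)\<bar> \<le> 1 \<and> \<bar>q - p + - r\<bar> \<le> 1)" by (simp add: algebra_simps)
    moreover define D :: "mat set" where "D = {(1, 0, 0, 1), mN}"
    ultimately have "(p, q, r, s) \<in> D \<or> (- q, p - q, - s, r - s) \<in> D \<or> (q - p, - p, s - r, - r) \<in> D"
      using stab_trace[OF assms(1) M[unfolded pq], folded D_def] stab_trace[OF assms(1) MU, folded D_def]
        stab_trace[OF assms(1) MV, folded D_def] by blast
    then consider "p = 1 \<and> q = 0 \<and> r = 0 \<and> s = 1" | "p = - 1 \<and> q = 0 \<and> r = 0 \<and> s = - 1"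
      | "p = - 1 \<and> q = - 1 \<and> r = 1 \<and> s = 0" | "p = 1 \<and> q = 1 \<and> r = - 1 \<and> s = 0"
      | "p = 0 \<and> q = 1 \<and> r = - 1 \<and> s = - 1" | "p = 0 \<and> q = - 1 \<and> r = 1 \<and> s = 1"
      unfolding D_def insert_iff empty_iff prod.inject by (elim disjE conjE FalseE) simp_all
    then show ?thesis unfolding pq by cases simp_all
  qed
  have stab3: "{(1, 0, 0, 1), mU, ?V} \<subseteq> stab \<gamma>" using stab_one[OF g] assms(2) V by simp
  have negs: "(0, - 1, 1, 1) \<in> stab \<gamma> \<longleftrightarrow> mN \<in> stab \<gamma>" "(1, 1, - 1, 0) \<in> stab \<gamma> \<longleftrightarrow> mN \<in> stab \<gamma>"
  proof -
    have "(0, - 1, 1, 1) \<in> stab \<gamma>" "(1, 1, - 1, 0) \<in> stab \<gamma>" if "mN \<in> stab \<gamma>"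
      using stab_mult[OF g that assms(2)] stab_mult[OF g that V] by simp_all
    moreover have "mN \<in> stab \<gamma>" if "(0, - 1, 1, 1) \<in> stab \<gamma>"
      using stab_mult[OF g that V] by simp
    moreover have "mN \<in> stab \<gamma>" if "(1, 1, - 1, 0) \<in> stab \<gamma>"
      using stab_mult[OF g that assms(2)] by simp
    ultimately show "(0, - 1, 1, 1) \<in> stab \<gamma> \<longleftrightarrow> mN \<in> stab \<gamma>" "(1, 1, - 1, 0) \<in> stab \<gamma> \<longleftrightarrow> mN \<in> stab \<gamma>"
      by blast+
  qed
  have fS: "fills (act mS \<gamma>)" using fills_act[OF assms(1) gens_SL2(3)] .
  have fL: "fills (curve_L \<gamma>)" "fills (curve_R \<gamma>)"
    using fills_act[OF assms(1) gens_SL2(1)] fills_act[OF assms(1) gens_SL2(2)]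
    unfolding act_gens[OF g] by blast+
  have actU: "act mU \<gamma> = \<gamma>" "act ?V \<gamma> = \<gamma>" using assms(2) V by (auto simp: stab_def)
  have L: "curve_L \<gamma> = act mS \<gamma>"
    using act_mult[of mS mU \<gamma>] g actU act_gens(1)[OF g] by simp
  have R: "curve_R \<gamma> = act mN (act mS \<gamma>)"
  proof -
    have "act mN (act mS \<gamma>) = act mN (act mS (act ?V \<gamma>))" using actU by simp
    also have "\<dots> = act mN (act (mS \<otimes>\<^bsub>SL2\<^esub> ?V) \<gamma>)" using act_mult[of mS ?V \<gamma>] g by simp
    also have "\<dots> = act (mN \<otimes>\<^bsub>SL2\<^esub> (mS \<otimes>\<^bsub>SL2\<^esub> ?V)) \<gamma>" using act_mult[of mN "mS \<otimes>\<^bsub>SL2\<^esub> ?V" \<gamma>] g by simp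
    finally show ?thesis using act_gens(2)[OF g] by simp
  qed
  have cS: "act mS \<gamma> \<in> curves" using fS fills_def by blast
  have cnt: "torus.count \<gamma> L = 2 * torus.count (act mS \<gamma>) L" if "L \<noteq> len_c \<gamma>" for L
  proof -
    have "torus.count \<gamma> L = torus.count (curve_L \<gamma>) L + torus.count (curve_R \<gamma>) L"
    proof (rule torus.count_step)
      show "finite {b. torus.len (torus.W b (curve_L \<gamma>)) = L}"
        using fills_countable(1)[OF fL(1)] fL(1) torus_len_W unfolding fills_def by simp
      show "finite {b. torus.len (torus.W b (curve_R \<gamma>)) = L}"
        using fills_countable(1)[OF fL(2)] fL(2) torus_len_W unfolding fills_def by simp
      show "L \<noteq> torus.len \<gamma>" using that torus_len[OF g] by simp
    qed
    then show ?thesis using count_mN[OF cS] L R by simp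
  qed
  let ?F = "torus.count (act mS \<gamma>)"
  have tot: "int (card (stab \<gamma>)) * int (card (curves_of_length \<gamma> L)) = 12 * ?F L" if "L \<ge> len_c \<gamma> + 1" for L
    using mats_of_length_fills(2)[OF assms(1), of L]
      card_mats_of_length[OF g mats_of_length_fills(1)[OF assms(1)], of L] that cnt[of L] by simp
  have pl: "phi_like ?F" using fills_countable(2)[OF fS] .
  show ?thesis
  proof (cases "mN \<in> stab \<gamma>")
    case True
    have "stab \<gamma> = {(1, 0, 0, 1), mU, ?V, mN, (0, - 1, 1, 1), (1, 1, - 1, 0)}" (is "_ = ?T")
    proof (rule equalityI)
      show "stab \<gamma> \<subseteq> ?T"
      proof
        fix M assume "M \<in> stab \<gamma>"
        from sub[OF this] show "M \<in> ?T" by (elim UnE insertE emptyE) simp_all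
      qed
      have "{mN, (0, - 1, 1, 1), (1, 1, - 1, 0)} \<subseteq> stab \<gamma>" using True negs by simp
      then show "?T \<subseteq> stab \<gamma>" using stab3 by simp
    qed
    then have "card (stab \<gamma>) = 6" by simp
    then have "int (card (curves_of_length \<gamma> L)) = 2 * ?F L" if "L \<ge> len_c \<gamma> + 1" for L
      using tot[OF that] by simp
    then show ?thesis using pl by blast
  next
    case False
    have "stab \<gamma> = {(1, 0, 0, 1), mU, ?V}"
    proof (rule equalityI[OF _ stab3], rule subsetI)
      fix M assume M: "M \<in> stab \<gamma>"
      have "M \<noteq> mN" "M \<noteq> (0, - 1, 1, 1)" "M \<noteq> (1, 1, - 1, 0)" using M False negs by metis+
      with sub[OF M] show "M \<in> {(1, 0, 0, 1), mU, ?V}" by (elim UnE insertE emptyE) simp_all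
    qed
    then have "card (stab \<gamma>) = 3" by simp
    then have "int (card (curves_of_length \<gamma> L)) = 2 * (?F L + ?F L)" if "L \<ge> len_c \<gamma> + 1" for L
      using tot[OF that] by simp
    then show ?thesis using phi_like_add[OF pl pl] by blast
  qed
qed

text \<open>Conjugating moves \<gamma> within its orbit, which keeps the counts. Trace 1 is turned
  into trace -1 by squaring, and a suitable power of the conjugate is \<open>mS\<close> or
  \<open>mU\<close>.\<close>

lemma counts_elliptic:
  assumes "fills \<gamma>" "M \<in> stab \<gamma>" "M \<notin> {(1, 0, 0, 1), mN}"
  shows "\<exists>F M. phi_like F \<and> (\<forall>L\<ge>M. int (card (curves_of_length \<gamma> L)) = 2 * F L)"
proof -
  have g: "\<gamma> \<in> curves" using assms fills_def by blast
  let ?R = "\<exists>N Z. Z \<in> carrier SL2 \<and> N \<in> stab (act Z \<gamma>) \<and> N \<in> {mS, mU}"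
  have ?R
  proof -
    have *: ?R if st: "(p, q, r, s) \<in> stab \<gamma>" and tr: "p + s \<in> {0, - 1}" for p q r s
    proof -
      have c: "(p, q, r, s) \<in> carrier SL2" using st by (simp add: stab_def)
      have "\<exists>N \<in> {mS, mU, (0, 1, - 1, 0), (- 1, - 1, 1, 0)}. conjugate (p, q, r, s) N"
        using elliptic_conjugate[OF c] tr by auto
      then obtain N where N: "N \<in> {mS, mU, (0, 1, - 1, 0), (- 1, - 1, 1, 0)}" "conjugate (p, q, r, s) N" by blast
      then have "N \<in> carrier SL2" by auto
      then obtain Z where Z: "Z \<in> carrier SL2" "N \<in> stab (act Z \<gamma>)"
        using stab_conjugate[OF g st N(2)] by blast
      note gZ = act_closed[OF Z(1) g]
      have sq: "N \<otimes>\<^bsub>SL2\<^esub> N \<in> stab (act Z \<gamma>)" using stab_mult[OF gZ Z(2) Z(2)] .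
      have cube: "N \<otimes>\<^bsub>SL2\<^esub> N \<otimes>\<^bsub>SL2\<^esub> N \<in> stab (act Z \<gamma>)" using stab_mult[OF gZ sq Z(2)] .
      from N(1) consider "N = mS" | "N = mU" | "mS = N \<otimes>\<^bsub>SL2\<^esub> N \<otimes>\<^bsub>SL2\<^esub> N" | "mU = N \<otimes>\<^bsub>SL2\<^esub> N"
        by auto
      then have "mS \<in> stab (act Z \<gamma>) \<or> mU \<in> stab (act Z \<gamma>)"
        by cases (use Z(2) sq cube in metis)+
      then show ?R using Z(1) by (metis insertCI)
    qed
    obtain p q r s where pq: "M = (p, q, r, s)" by (cases M)
    have "\<bar>p + s\<bar> \<le> 1"
      using stab_trace[OF assms(1) assms(2)[unfolded pq]]
    proof (elim disjE)
      assume "(p, q, r, s) \<in> {(1, 0, 0, 1), mN}"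
      then show ?thesis using assms(3) pq by simp
    qed
    then consider "p + s \<in> {0, - 1}" | "p + s = 1" by force
    then show ?R
    proof cases
      case 1
      then show ?thesis using * assms(2) pq by blast
    next
      case 2
      have det: "p * s - q * r = 1" using assms(2) pq by (simp add: stab_def)
      have "M \<otimes>\<^bsub>SL2\<^esub> M \<in> stab \<gamma>" using stab_mult[OF g assms(2) assms(2)] .
      then have "(p * p + q * r, p * q + q * s, r * p + s * r, r * q + s * s) \<in> stab \<gamma>" unfolding pq by simp
      moreover have "p * p + q * r + (r * q + s * s) = - 1"
      proof -
        have "(p + s) * (p + s) = 1" using 2 by simp
        then show ?thesis using det by (simp add: algebra_simps)
      qed
      ultimately show ?thesis using * by blast
    qed
  qed
  then obtain N Z where NZ: "Z \<in> carrier SL2" "N \<in> stab (act Z \<gamma>)" "N \<in> {mS, mU}" by blast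
  have "fills (act Z \<gamma>)" using fills_act[OF assms(1) NZ(1)] .
  then have "\<exists>F M. phi_like F \<and> (\<forall>L\<ge>M. int (card (curves_of_length (act Z \<gamma>) L)) = 2 * F L)"
    using counts_stab_S counts_stab_U NZ by blast
  then show ?thesis unfolding curves_of_length_act[OF NZ(1) g] .
qed

theorem fills_phi_like_orbit:
  assumes "fills \<gamma>"
  shows "phi_like_orbit \<gamma>"
proof (cases "stab \<gamma> \<subseteq> {(1, 0, 0, 1), mN}")
  case False
  then obtain M where M: "M \<in> stab \<gamma>" "M \<notin> {(1, 0, 0, 1), mN}" by blast
  then have "mat_torsion \<gamma>" unfolding mat_torsion_fills[OF assms] by blast
  then show ?thesis using counts_elliptic[OF assms M] unfolding phi_like_orbit_def by auto
next
  case True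
  have g: "\<gamma> \<in> curves" using assms fills_def by blast
  have fS: "fills (act mS \<gamma>)" using fills_act[OF assms gens_SL2(3)] .
  let ?F = "\<lambda>L. torus.count \<gamma> L + torus.count (act mS \<gamma>) L"
  have pl: "phi_like ?F" using phi_like_add fills_countable(2) assms fS by blast
  have tot: "int (card (stab \<gamma>)) * int (card (curves_of_length \<gamma> L)) = 4 * ?F L" if "L \<ge> len_c \<gamma> + 1" for L
    using mats_of_length_fills(2)[OF assms, of L]
      card_mats_of_length[OF g mats_of_length_fills(1)[OF assms], of L] that by simp
  show ?thesis
  proof (cases "mN \<in> stab \<gamma>")
    case mN: True
    then have "stab \<gamma> = {(1, 0, 0, 1), mN}" using True stab_one[OF g] by blast
    then have "card (stab \<gamma>) = 2" "mat_torsion \<gamma>" unfolding mat_torsion_fills[OF assms] by auto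
    moreover have "int (card (curves_of_length \<gamma> L)) = 2 * ?F L" if "L \<ge> len_c \<gamma> + 1" for L
      using tot[OF that] \<open>card (stab \<gamma>) = 2\<close> by simp
    ultimately show ?thesis by (intro phi_like_orbitI[OF pl, of "len_c \<gamma> + 1" _ 2]) simp_all
  next
    case mN: False
    then have "stab \<gamma> = {(1, 0, 0, 1)}" using True stab_one[OF g] by blast
    then have "card (stab \<gamma>) = 1" "\<not> mat_torsion \<gamma>" unfolding mat_torsion_fills[OF assms] by auto
    then show ?thesis using tot by (intro phi_like_orbitI[OF pl, of "len_c \<gamma> + 1" _ 4]) simp_all
  qed
qed

subsection \<open>Curves fixed by a twist\<close>

text \<open>Subtractive Euclid again, now undoing row additions.\<close>

lemma ex_first_column:
  fixes x y :: int
  assumes "x \<ge> 1" "y \<ge> 1" "gcd x y = 1"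
  shows "\<exists>b q s. wmat b = (x, q, y, s)"
  using assms
proof (induction "nat (x + y)" arbitrary: x y rule: less_induct)
  case less
  consider "x = y" | "x < y" | "y < x" by linarith
  then show ?case
  proof cases
    case 1
    then have "wmat [False] = (x, 0, y, 1)" using less.prems by auto
    then show ?thesis by blast
  next
    case 2
    have "gcd x (y - x) = 1" using less.prems(3) by (metis gcd.commute gcd_diff1)
    then obtain b q s where "wmat b = (x, q, y - x, s)" using less.hyps[of x "y - x"] less.prems 2 by auto
    then have "wmat (False # b) = (x, q, y, q + s)" by simp
    then show ?thesis by blast
  next
    case 3
    have "gcd (x - y) y = 1" using less.prems(3) by (metis gcd_diff1)
    then obtain b q s where "wmat b = (x - y, q, y, s)" using less.hyps[of "x - y" y] less.prems 3 by auto
    then have "wmat (True # b) = (x, q + s, y, s)" by simp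
    then show ?thesis by blast
  qed
qed

lemma same_first_column:
  assumes "(x, q, y, s) \<in> carrier SL2" "(x, q', y, s') \<in> carrier SL2"
  shows "\<exists>j. (x, q', y, s') = (x, q, y, s) \<otimes>\<^bsub>SL2\<^esub> (1, j, 0, 1)"
proof -
  \<comment> \<open>The upper right entry of the inverse of the first matrix times the
    second.\<close>
  define j where "j = s * (q' - q) - q * (s' - s)"
  have d: "x * s - q * y = 1" and d': "x * s' - q' * y = 1" using assms by simp_all
  have dd: "x * (s' - s) = y * (q' - q)" using d d' by (simp add: algebra_simps)
  have "x * j = s * x * (q' - q) - q * (x * (s' - s))" by (simp add: j_def algebra_simps)
  also have "\<dots> = (x * s - q * y) * (q' - q)" unfolding dd by (simp add: algebra_simps)
  finally have 1: "x * j = q' - q" using d by simp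
  have "y * j = s * (y * (q' - q)) - q * y * (s' - s)" by (simp add: j_def algebra_simps)
  also have "\<dots> = (x * s - q * y) * (s' - s)" unfolding dd[symmetric] by (simp add: algebra_simps)
  finally have 2: "y * j = s' - s" using d by simp
  show ?thesis using 1 2 by (intro exI[of _ j]) simp
qed

lemma coprime_first_column: "(x, q, y, s) \<in> carrier SL2 \<Longrightarrow> gcd x y = 1"
proof -
  assume "(x, q, y, s) \<in> carrier SL2"
  then have "x * s - q * y = 1" by simp
  moreover have "gcd x y dvd x * s - q * y" by (simp add: dvd_mult dvd_mult2)
  ultimately show ?thesis by simp
qed

lemma ex_matrix_first_column:
  fixes x y :: int
  assumes "gcd x y = 1"
  shows "\<exists>q s. (x, q, y, s) \<in> carrier SL2"
proof -
  obtain u v where "u * x + v * y = gcd x y" using bezout_int by blast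
  then have "(x, - v, y, u) \<in> carrier SL2" using assms by (simp add: algebra_simps)
  then show ?thesis by blast
qed

text \<open>\<open>L S R = S\<close> shows that \<open>L\<close> fixes the image under
  \<open>S\<close>; then \<open>L S L = R\<close> shows that \<open>S\<close> fixes
  \<open>c\<close>, and \<open>L\<close> and \<open>S\<close> generate everything.\<close>

lemma fixed_by_all:
  assumes "c \<in> curves" "curve_L c = c" "curve_R c = c" "M \<in> carrier SL2"
  shows "act M c = c"
proof -
  have S: "act mS c \<in> curves" using assms(1) act_closed gens_SL2(3) by blast
  have "curve_L (act mS c) = act mS c" using curve_L_S_R[OF assms(1)] assms(3) by simp
  then have "act mS c = c" using curve_L_S_L[OF assms(1)] assms(2,3) by simp
  then have s: "mS \<in> stab c" "mL \<in> stab c"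
    using act_gens(1)[OF assms(1)] assms(2) by (simp_all add: stab_def)
  have "subgroup (stab c) SL2"
  proof (rule SL2.subgroupI)
    show "stab c \<subseteq> carrier SL2" by (auto simp: stab_def)
    show "stab c \<noteq> {}" using s by blast
    show "inv\<^bsub>SL2\<^esub> M \<in> stab c" if "M \<in> stab c" for M
      using that act_act_inv[of M c] assms(1) by (simp add: stab_def)
    show "M \<otimes>\<^bsub>SL2\<^esub> N \<in> stab c" if "M \<in> stab c" "N \<in> stab c" for M N using stab_mult[OF assms(1) that] .
  qed
  then have "stab c = carrier SL2" using SL2_generated s by blast
  then show ?thesis using assms(4) unfolding stab_def by blast
qed

text \<open>The last assumption is the form in which essentiality enters: a translate fixed by both
  twists would be peripheral or trivial.\<close>

locale twist_fixed =
  fixes c :: "word set"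
  assumes c: "c \<in> curves" and fixed: "curve_L c = c" 
    and not_both_fixed: "\<And>M. M \<in> carrier SL2 \<Longrightarrow>
      \<not> (curve_L (act M c) = act M c \<and> curve_R (act M c) = act M c)"
begin

definition \<tau> :: int where "\<tau> = turns_c (curve_R c)"
definition P :: int where "P = num_a_c c - 2 * \<tau>"

lemma fixed_pow: "(curve_L ^^ n) c = c"
  by (induction n) (simp_all add: fixed)

lemma l_const: "torus.l_const c"
  unfolding torus.l_const_def fixed_pow by simp

lemma stable_R: "torus.stable (curve_R c)"
  using torus.stable_r_l[OF c l_const] fixed by simp

lemma leaf: "torus.leaf c \<tau>"
  unfolding torus.leaf_def
proof (intro conjI allI impI)
  show "torus.l_const c" by (rule l_const)
  fix b :: "bool list" assume "False \<in> set b"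
  then show "turns_c (torus.W b c) = \<tau>"
  proof (induction b)
    case (Cons x b)
    then show ?case using stable_R fixed unfolding torus.stable_def \<tau>_def by (cases x) auto
  qed auto
qed

text \<open>Because \<open>L\<close> fixes \<open>c\<close>, the slope
  \<open>num_b_c c - 2 * turns_c c\<close> is 0 and only the first weight survives.\<close>

lemma len_W: "False \<in> set b \<Longrightarrow> len_c (torus.W b c) = P * fst (wt b) + 4 * \<tau>"
proof -
  have "num_b_c c - 2 * turns_c c = 0" using torus.p_l[OF c] fixed by simp
  then show "False \<in> set b \<Longrightarrow> len_c (torus.W b c) = P * fst (wt b) + 4 * \<tau>"
    using torus.len_leaf[OF c leaf, of b] torus_len_W[OF c] unfolding P_def by simp
qed

lemma \<tau>_nonneg: "\<tau> \<ge> 0"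
  unfolding \<tau>_def using torus.t_nonneg torus.r_closed c by blast

text \<open>With \<open>P = 0\<close> all vertices below \<open>curve_R c\<close> have the same
  length, so both twists fix it.\<close>

lemma P_pos: "P \<ge> 1"
proof -
  have nonneg: "P \<ge> 0" unfolding P_def by (rule torus.leaf_first_slope(1)[OF c leaf])
  have "P \<noteq> 0"
  proof
    assume "P = 0"
    let ?v = "curve_R c"
    have v: "?v \<in> curves" using torus.r_closed[OF c] .
    have len: "len_c (torus.W b ?v) = 4 * \<tau>" for b
      using len_W[of "False # b"] \<open>P = 0\<close> by simp
    have pq: "num_a_c d + num_b_c d = len_c d" if "d \<in> curves" for d
      using torus_len[OF that] unfolding torus.len_def .
    have "curve_L ?v = ?v"
    proof (rule torus.fix_l[OF v])
      fix n show "num_a_c ((curve_L ^^ n) ?v) + num_b_c ((curve_L ^^ n) ?v) = num_a_c ?v + num_b_c ?v"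
        using len[of "replicate n True"] len[of "[]"] pq[OF v] pq[OF torus.lpow_closed[OF v]]
        by (simp add: torus.W_funpow)
    qed
    moreover have "curve_R ?v = ?v"
    proof (rule torus.fix_r[OF v])
      fix n show "num_a_c ((curve_R ^^ n) ?v) + num_b_c ((curve_R ^^ n) ?v) = num_a_c ?v + num_b_c ?v"
        using len[of "replicate n False"] len[of "[]"] pq[OF v] pq[OF torus.rpow_closed[OF v]]
        by (simp add: torus.W_funpow)
    qed
    ultimately show False using not_both_fixed[of mR] act_gens(2)[OF c] by simp
  qed
  then show ?thesis using nonneg by linarith
qed

lemma act_upper: "act (1, j, 0, 1) c = c"
proof -
  have L: "act mL c = c" using act_gens(1)[OF c] fixed by simp
  have pow: "act (1, int n, 0, 1) c = c" for n
  proof (induction n)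
    case 0
    then show ?case using act_one[OF c] by simp
  next
    case (Suc n)
    have "act (mL \<otimes>\<^bsub>SL2\<^esub> (1, int n, 0, 1)) c = c" using act_mult[of mL "(1, int n, 0, 1)" c] c Suc L by simp
    then show ?case by (simp add: add.commute)
  qed
  show ?thesis
  proof (cases "j \<ge> 0")
    case True
    then show ?thesis using pow[of "nat j"] by simp
  next
    case False
    have "act (inv\<^bsub>SL2\<^esub> (1, - j, 0, 1)) c = c"
      using act_act_inv[of "(1, - j, 0, 1)" c] pow[of "nat (- j)"] False c by simp
    then show ?thesis by (simp add: inv_SL2)
  qed
qed

lemma act_first_column:
  assumes "(x, q, y, s) \<in> carrier SL2" "(x, q', y, s') \<in> carrier SL2"
  shows "act (x, q', y, s') c = act (x, q, y, s) c"
proof -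
  obtain j where j: "(x, q', y, s') = (x, q, y, s) \<otimes>\<^bsub>SL2\<^esub> (1, j, 0, 1)" using same_first_column[OF assms] by blast
  have T: "(1, j, 0, 1) \<in> carrier SL2" by simp
  show ?thesis unfolding j act_mult[OF assms(1) T c] act_upper ..
qed

text \<open>The action depends only on the first column, so the matrix may be replaced by a product
  of twists; its first column sum is the first weight of the walk.\<close>

lemma len_positive:
  assumes "(x, q, y, s) \<in> carrier SL2" "x \<ge> 1" "y \<ge> 1"
  shows "len_c (act (x, q, y, s) c) = P * (x + y) + 4 * \<tau>"
proof -
  obtain b q' s' where b: "wmat b = (x, q', y, s')"
    using ex_first_column[OF assms(2,3) coprime_first_column[OF assms(1)]] by blast
  have "(x, q', y, s') \<in> carrier SL2" using wmat_closed[of b] unfolding b .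
  then have "act (x, q, y, s) c = act (wmat b) c" unfolding b by (rule act_first_column[OF _ assms(1)])
  then have "act (x, q, y, s) c = torus.W (rev b) c" using act_wmat[OF c] by simp
  moreover have w: "wt (rev b) = (x + y, q' + s')" using wt_wmat[of "rev b"] b by simp
  moreover have "False \<in> set (rev b)" using fst_wt_eq_1_iff[of "rev b"] w assms(2,3) by auto
  ultimately show ?thesis using len_W[of "rev b"] by simp
qed

lemma len_act_S:
  assumes "(x, q, y, s) \<in> carrier SL2"
  shows "len_c (act (x, q, y, s) c) = len_c (act (- y, - s, x, q) c)"
proof -
  have "act (- y, - s, x, q) c = act mS (act (x, q, y, s) c)"
    using act_mult[of mS "(x, q, y, s)" c] assms c by simp
  then show ?thesis using len_c_act_mS act_closed[OF assms c] by simp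
qed

text \<open>Powers of \<open>mS\<close> carry the first column into the open first quadrant. On an
  axis they lead back to a power of \<open>L\<close> acting on \<open>c\<close>.\<close>

lemma len_general:
  assumes "(x, q, y, s) \<in> carrier SL2"
  shows "x \<noteq> 0 \<Longrightarrow> y \<noteq> 0 \<Longrightarrow> len_c (act (x, q, y, s) c) = P * (\<bar>x\<bar> + \<bar>y\<bar>) + 4 * \<tau>"
    "x = 0 \<or> y = 0 \<Longrightarrow> len_c (act (x, q, y, s) c) = len_c c"
proof -
  have d: "x * s - q * y = 1" using assms by simp
  have 1: "(- y, - s, x, q) \<in> carrier SL2" using d by (simp add: algebra_simps)
  have 2: "(- x, - q, - y, - s) \<in> carrier SL2" using d by simp
  have 3: "(y, s, - x, - q) \<in> carrier SL2" using d by (simp add: algebra_simps)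
  have e1: "len_c (act (x, q, y, s) c) = len_c (act (- y, - s, x, q) c)" using len_act_S[OF assms] .
  have e2: "len_c (act (x, q, y, s) c) = len_c (act (- x, - q, - y, - s) c)" using e1 len_act_S[OF 1] by simp
  have e3: "len_c (act (x, q, y, s) c) = len_c (act (y, s, - x, - q) c)" using e2 len_act_S[OF 2] by simp
  show "len_c (act (x, q, y, s) c) = P * (\<bar>x\<bar> + \<bar>y\<bar>) + 4 * \<tau>" if xy: "x \<noteq> 0" "y \<noteq> 0"
  proof -
    consider "x \<ge> 1" "y \<ge> 1" | "x \<ge> 1" "y \<le> - 1" | "x \<le> - 1" "y \<ge> 1" | "x \<le> - 1" "y \<le> - 1"
      using xy by linarith
    then show ?thesis
    proof cases
      case 1 then show ?thesis using len_positive[OF assms] by simp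
    next
      case 2 then show ?thesis using len_positive[OF \<open>(- y, - s, x, q) \<in> carrier SL2\<close>] e1 by simp
    next
      case 3 then show ?thesis using len_positive[OF \<open>(y, s, - x, - q) \<in> carrier SL2\<close>] e3 by simp
    next
      case 4 then show ?thesis using len_positive[OF 2] e2 by simp
    qed
  qed
  assume "x = 0 \<or> y = 0"
  moreover have "y = 0 \<Longrightarrow> x = 1 \<or> x = - 1" "x = 0 \<Longrightarrow> y = 1 \<or> y = - 1"
    using d zmult_eq_1_iff[of x s] zmult_eq_1_iff[of "- q" y] by auto
  ultimately consider "y = 0" "x = 1" | "y = 0" "x = - 1" | "x = 0" "y = - 1" | "x = 0" "y = 1" by blast
  then show "len_c (act (x, q, y, s) c) = len_c c"
  proof cases
    case 1 then show ?thesis using act_upper[of q] d by simp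
  next
    case 2 then show ?thesis using act_upper[of "- q"] e2 d by simp
  next
    case 3 then show ?thesis using act_upper[of "- s"] e1 d by simp
  next
    case 4 then show ?thesis using act_upper[of s] e3 d by simp
  qed
qed

text \<open>Composing a stabilizing matrix with powers of \<open>L\<close>, which fix
  \<open>c\<close>, would make its first column, and hence a length, arbitrarily large unless the
  lower left entry is 0.\<close>

lemma stab_form:
  assumes "(x, q, y, s) \<in> stab c"
  shows "y = 0 \<and> (x = 1 \<or> x = - 1)"
proof -
  have M: "(x, q, y, s) \<in> carrier SL2" and fx: "act (x, q, y, s) c = c" using assms by (auto simp: stab_def)
  have "y = 0"
  proof (rule ccontr)
    assume y: "y \<noteq> 0"
    define m where "m = len_c c + \<bar>x\<bar> + 1"
    have lc: "len_c c \<ge> 0" by (simp add: len_c_def)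
    have "m * 1 \<le> m * \<bar>y\<bar>" by (rule mult_left_mono) (use y lc m_def in auto)
    then have my: "m \<le> \<bar>m * y\<bar>" using lc by (simp add: abs_mult m_def)
    then have big: "\<bar>x + m * y\<bar> \<ge> len_c c + 1" unfolding m_def by linarith
    have T: "(1, m, 0, 1) \<in> carrier SL2" by simp
    have "act ((1, m, 0, 1) \<otimes>\<^bsub>SL2\<^esub> (x, q, y, s)) c = c"
      using act_mult[OF T M c] fx act_upper by simp
    then have "len_c (act (x + m * y, q + m * s, y, s) c) = len_c c" by simp
    moreover have "(x + m * y, q + m * s, y, s) \<in> carrier SL2" using M by (simp add: algebra_simps)
    moreover have "x + m * y \<noteq> 0" using big lc by auto
    ultimately have "len_c c = P * (\<bar>x + m * y\<bar> + \<bar>y\<bar>) + 4 * \<tau>" using len_general(1) y by simp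
    moreover define A where "A = \<bar>x + m * y\<bar> + \<bar>y\<bar>"
    moreover have "1 * A \<le> P * A" by (rule mult_right_mono) (use P_pos A_def in auto)
    moreover have "A \<ge> len_c c + 1" using big unfolding A_def by linarith
    ultimately show False using \<tau>_nonneg by simp
  qed
  moreover then have "x * s = 1" using M by simp
  ultimately show ?thesis using zmult_eq_1_iff by auto
qed

text \<open>The stabilizer consists of upper triangular matrices with equal diagonal entries 1 or
  -1, among which only \<open>mN\<close> is nontrivial torsion.\<close>

lemma torsion_iff_mN: "mat_torsion c \<longleftrightarrow> mN \<in> stab c"
proof
  assume "mat_torsion c"
  then obtain M n where M: "M \<in> stab c" "M \<noteq> (1, 0, 0, 1)" "n \<ge> (1::nat)" "M [^]\<^bsub>SL2\<^esub> n = (1, 0, 0, 1)"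
    unfolding mat_torsion_def stab_def by blast
  obtain p q r s where pq: "M = (p, q, r, s)" by (cases M)
  have car: "(p, q, r, s) \<in> carrier SL2" using M(1) pq by (simp add: stab_def)
  have "r = 0 \<and> (p = 1 \<or> p = - 1)" using stab_form M(1) pq by blast
  then have "\<not> \<bar>p + s\<bar> \<le> 1" using car by auto
  then have "M = mN" using finite_order_trace[OF car M(3)] M(2,4) pq by auto
  then show "mN \<in> stab c" using M(1) by simp
next
  assume "mN \<in> stab c"
  moreover have "mN [^]\<^bsub>SL2\<^esub> (2::nat) = (1, 0, 0, 1)" by (simp add: eval_nat_numeral)
  ultimately show "mat_torsion c" unfolding mat_torsion_def stab_def
    by (intro bexI[of _ mN] conjI exI[of _ "2::nat"]) auto
qed

definition vectors :: "int \<Rightarrow> (int \<times> int) set" where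
  "vectors L = {(x, y). x \<noteq> 0 \<and> y \<noteq> 0 \<and> gcd x y = 1 \<and> P * \<bar>x\<bar> + P * \<bar>y\<bar> = L - 4 * \<tau>}"

text \<open>The solutions are distributed equally over the four open quadrants.\<close>

lemma card_vectors: "finite (vectors L)" "card (vectors L) = 4 * phi P P (L - 4 * \<tau>)"
proof -
  define A where "A = {(x, y). x \<ge> 1 \<and> y \<ge> 1 \<and> P * x + P * y = L - 4 * \<tau> \<and> gcd x y = 1}"
  have finA: "finite A"
    by (rule finite_subset[OF _ finite_positive_solutions[OF P_pos P_pos, of "L - 4 * \<tau>"]]) (auto simp: A_def)
  define f :: "(bool \<times> bool) \<times> int \<times> int \<Rightarrow> int \<times> int"
    where "f = (\<lambda>((e, e'), (x, y)). (if e then x else - x, if e' then y else - y))"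
  have "vectors L = f ` (UNIV \<times> A)"
  proof (intro equalityI subsetI)
    fix v assume "v \<in> vectors L"
    moreover obtain x y where v: "v = (x, y)" by (cases v)
    ultimately have xy: "x \<noteq> 0" "y \<noteq> 0" "gcd x y = 1" "P * \<bar>x\<bar> + P * \<bar>y\<bar> = L - 4 * \<tau>"
      by (simp_all add: vectors_def)
    have "\<bar>x\<bar> \<ge> 1" "\<bar>y\<bar> \<ge> 1" using xy(1,2) by linarith+
    then have "(\<bar>x\<bar>, \<bar>y\<bar>) \<in> A" using xy(3,4) by (simp add: A_def)
    then have "((x > 0, y > 0), (\<bar>x\<bar>, \<bar>y\<bar>)) \<in> UNIV \<times> A" by (rule SigmaI[OF UNIV_I])
    then have "f ((x > 0, y > 0), (\<bar>x\<bar>, \<bar>y\<bar>)) \<in> f ` (UNIV \<times> A)" by (rule imageI)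
    moreover have "f ((x > 0, y > 0), (\<bar>x\<bar>, \<bar>y\<bar>)) = v" unfolding f_def v by simp
    ultimately show "v \<in> f ` (UNIV \<times> A)" by (rule subst[rotated])
  next
    fix v assume "v \<in> f ` (UNIV \<times> A)"
    then obtain z where z: "z \<in> UNIV \<times> A" "v = f z" by blast
    obtain e e' x y where w: "z = ((e, e'), (x, y))" by (metis prod.exhaust)
    have "(x, y) \<in> A" using z(1) w by simp
    then show "v \<in> vectors L" unfolding z(2) w by (simp add: f_def vectors_def A_def)
  qed
  moreover have "inj_on f (UNIV \<times> A)"
    by (rule inj_on_inverseI[of _ "\<lambda>(x, y). ((x > 0, y > 0), (\<bar>x\<bar>, \<bar>y\<bar>))"]) (auto simp: f_def A_def split: if_splits)
  ultimately show "finite (vectors L)" "card (vectors L) = 4 * phi P P (L - 4 * \<tau>)"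
    using finA by (simp_all add: card_image card_cartesian_product phi_def flip: A_def UNIV_Times_UNIV)
qed

text \<open>The choice is immaterial: matrices with the same first column differ by a power of
  \<open>L\<close> on the right.\<close>

definition col_mat :: "int \<times> int \<Rightarrow> mat" where
  "col_mat v = (SOME M. \<exists>q s. M = (fst v, q, snd v, s) \<and> M \<in> carrier SL2)"

lemma col_mat:
  assumes "gcd x y = 1"
  shows "\<exists>q s. col_mat (x, y) = (x, q, y, s) \<and> (x, q, y, s) \<in> carrier SL2"
proof -
  have "\<exists>M q s. M = (x, q, y, s) \<and> M \<in> carrier SL2" using ex_matrix_first_column[OF assms] by blast
  then show ?thesis unfolding col_mat_def fst_conv snd_conv by (rule someI2_ex) blast
qed

lemma curves_of_length_fixed:
  assumes "L \<noteq> len_c c"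
  shows "curves_of_length c L = (\<lambda>v. act (col_mat v) c) ` vectors L"
proof (intro equalityI subsetI)
  fix \<alpha> assume "\<alpha> \<in> curves_of_length c L"
  then obtain M where M: "M \<in> carrier SL2" "len_c (act M c) = L" "\<alpha> = act M c"
    by (auto simp: curves_of_length_eq mats_of_length_def simp del: carrier_SL2)
  obtain x q y s where pq: "M = (x, q, y, s)" by (cases M)
  have xy: "x \<noteq> 0" "y \<noteq> 0" using len_general(2) M assms pq by blast+
  then have "L = P * (\<bar>x\<bar> + \<bar>y\<bar>) + 4 * \<tau>" using len_general(1) M pq by simp
  then have "(x, y) \<in> vectors L"
    using xy coprime_first_column[OF M(1)[unfolded pq]] by (simp add: vectors_def distrib_left)
  moreover obtain q' s' where q': "col_mat (x, y) = (x, q', y, s')" "(x, q', y, s') \<in> carrier SL2"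
    using col_mat[OF coprime_first_column[OF M(1)[unfolded pq]]] by blast
  have "\<alpha> = act (col_mat (x, y)) c"
    unfolding M(3) pq q'(1) by (rule act_first_column[OF q'(2) M(1)[unfolded pq]])
  ultimately show "\<alpha> \<in> (\<lambda>v. act (col_mat v) c) ` vectors L" by blast
next
  fix \<alpha> assume "\<alpha> \<in> (\<lambda>v. act (col_mat v) c) ` vectors L"
  then obtain v where "v \<in> vectors L" "\<alpha> = act (col_mat v) c" by blast
  moreover obtain x y where "v = (x, y)" by (cases v)
  ultimately have v: "(x, y) \<in> vectors L" "\<alpha> = act (col_mat (x, y)) c" by simp_all
  then have xy: "x \<noteq> 0" "y \<noteq> 0" "gcd x y = 1" "P * \<bar>x\<bar> + P * \<bar>y\<bar> = L - 4 * \<tau>" by (simp_all add: vectors_def)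
  then obtain q s where q: "col_mat (x, y) = (x, q, y, s)" "(x, q, y, s) \<in> carrier SL2" using col_mat[OF xy(3)] by blast
  have "len_c \<alpha> = L" unfolding v(2) q(1) len_general(1)[OF q(2) xy(1,2)] distrib_left xy(4) by simp
  then have "(x, q, y, s) \<in> mats_of_length c L" using q(2) unfolding v(2) q(1) mats_of_length_def by simp
  then show "\<alpha> \<in> curves_of_length c L" unfolding curves_of_length_eq v(2) q(1) by (rule imageI)
qed

text \<open>Two columns give the same curve when their matrices differ by a stabilizing element,
  whose first column is (1, 0) or (-1, 0); the latter occurs precisely when \<open>mN\<close>
  stabilizes \<open>c\<close>.\<close>

lemma act_col_mat_eq_iff:
  assumes "gcd x y = 1" "gcd x' y' = 1"
  shows "act (col_mat (x', y')) c = act (col_mat (x, y)) c \<longleftrightarrow>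
    (x', y') = (x, y) \<or> mN \<in> stab c \<and> (x', y') = (- x, - y)"
proof -
  obtain q s where M: "col_mat (x, y) = (x, q, y, s)" "(x, q, y, s) \<in> carrier SL2" using col_mat[OF assms(1)] by blast
  obtain q' s' where M': "col_mat (x', y') = (x', q', y', s')" "(x', q', y', s') \<in> carrier SL2" using col_mat[OF assms(2)] by blast
  have neg: "act (- x, - q, - y, - s) c = act (x, q, y, s) (act mN c)"
    using act_mult[OF M(2), of mN c] c by simp
  have i: "inv\<^bsub>SL2\<^esub> (x, q, y, s) \<in> carrier SL2" by (rule SL2.inv_closed[OF M(2)])
  show ?thesis
  proof
    assume eq: "act (col_mat (x', y')) c = act (col_mat (x, y)) c"
    obtain a b d e where N: "inv\<^bsub>SL2\<^esub> (x, q, y, s) \<otimes>\<^bsub>SL2\<^esub> (x', q', y', s') = (a, b, d, e)"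
      by (cases "inv\<^bsub>SL2\<^esub> (x, q, y, s) \<otimes>\<^bsub>SL2\<^esub> (x', q', y', s')")
    have "act (a, b, d, e) c = c"
      unfolding N[symmetric] act_mult[OF i M'(2) c] using eq M M' act_act_inv[OF M(2) c] by simp
    then have st: "(a, b, d, e) \<in> stab c"
      using SL2.m_closed[OF i M'(2)] N unfolding stab_def by simp
    have "(x, q, y, s) \<otimes>\<^bsub>SL2\<^esub> (inv\<^bsub>SL2\<^esub> (x, q, y, s) \<otimes>\<^bsub>SL2\<^esub> (x', q', y', s')) = (x', q', y', s')"
      unfolding SL2.m_assoc[OF M(2) i M'(2), symmetric] SL2.r_inv[OF M(2)] by (rule SL2.l_one[OF M'(2)])
    then have prod: "x * a + q * d = x'" "y * a + s * d = y'" unfolding N by simp_all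
    have ad: "d = 0" "a = 1 \<or> a = - 1" using stab_form[OF st] by auto
    show "(x', y') = (x, y) \<or> mN \<in> stab c \<and> (x', y') = (- x, - y)"
    proof (cases "a = 1")
      case True
      then show ?thesis using prod ad by simp
    next
      case False
      then have a: "a = - 1" using ad by simp
      have e: "e = - 1" using st ad(1) a by (simp add: stab_def)
      have U: "(1, b, 0, 1) \<in> stab c" using act_upper by (simp add: stab_def)
      have "(a, b, d, e) \<otimes>\<^bsub>SL2\<^esub> (1, b, 0, 1) \<in> stab c" using stab_mult[OF c st U] .
      then have "mN \<in> stab c" using a e ad(1) by simp
      then show ?thesis using prod ad(1) a by simp
    qed
  next
    assume "(x', y') = (x, y) \<or> mN \<in> stab c \<and> (x', y') = (- x, - y)"
    then show "act (col_mat (x', y')) c = act (col_mat (x, y)) c"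
    proof
      assume h: "mN \<in> stab c \<and> (x', y') = (- x, - y)"
      have "(- x, - q, - y, - s) \<in> carrier SL2" using M(2) by simp
      have xy: "x' = - x" "y' = - y" using h by simp_all
      have "act (x', q', y', s') c = act (- x, - q, - y, - s) c"
        unfolding xy by (rule act_first_column) (fact \<open>(- x, - q, - y, - s) \<in> carrier SL2\<close>, use M'(2) xy in simp)
      moreover have "act mN c = c" using h by (simp add: stab_def)
      ultimately show ?thesis unfolding M(1) M'(1) using neg by simp
    qed simp
  qed
qed

text \<open>Each curve comes from \<open>h\<close> columns, one or an opposite pair, and four
  quadrants divided by \<open>h\<close> give the factor 4 or 2. No periodic correction arises
  here.\<close>

theorem fixed_phi_like_orbit: "phi_like_orbit c"
proof -
  define h :: nat where "h = (if mN \<in> stab c then 2 else 1)"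
  have card: "card (vectors L) = h * card (curves_of_length c L)" if "L \<noteq> len_c c" for L
  proof -
    have eq: "curves_of_length c L = (\<lambda>v. act (col_mat v) c) ` vectors L" by (rule curves_of_length_fixed[OF that])
    have fib: "card {v \<in> vectors L. act (col_mat v) c = \<alpha>} = h" if \<alpha>: "\<alpha> \<in> curves_of_length c L" for \<alpha>
    proof -
      have "\<exists>v\<in>vectors L. \<alpha> = act (col_mat v) c" using \<alpha> unfolding eq by (rule imageE) (rule bexI)
      then obtain v where "v \<in> vectors L" "\<alpha> = act (col_mat v) c" by blast
      moreover obtain x y where "v = (x, y)" by (cases v)
      ultimately have v: "(x, y) \<in> vectors L" "\<alpha> = act (col_mat (x, y)) c" by simp_all
      have neg: "(- x, - y) \<in> vectors L" using v(1) by (simp add: vectors_def)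
      have gcd: "gcd x' y' = 1" if "(x', y') \<in> vectors L" for x' y' using that by (simp add: vectors_def)
      have "w \<in> {v \<in> vectors L. act (col_mat v) c = \<alpha>} \<longleftrightarrow>
          w \<in> (if mN \<in> stab c then {(x, y), (- x, - y)} else {(x, y)})" for w
      proof (cases w)
        case (Pair x' y')
        show ?thesis
        proof (cases "w \<in> vectors L")
          case True
          then show ?thesis using act_col_mat_eq_iff[OF gcd[OF v(1)] gcd[of x' y']] v(2) Pair by auto
        next
          case False
          then show ?thesis using v(1) neg by auto
        qed
      qed
      then have "{v \<in> vectors L. act (col_mat v) c = \<alpha>} = (if mN \<in> stab c then {(x, y), (- x, - y)} else {(x, y)})"
        by blast
      moreover have "(x, y) \<noteq> (- x, - y)" using v(1) by (auto simp: vectors_def)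
      ultimately show ?thesis by (simp add: h_def)
    qed
    have "card (vectors L) = (\<Sum>\<alpha>\<in>curves_of_length c L. card {v \<in> vectors L. act (col_mat v) c = \<alpha>})"
      using sum.image_gen[OF card_vectors(1)[of L], of "\<lambda>_. 1::nat" "\<lambda>v. act (col_mat v) c"]
      unfolding eq by simp
    then show ?thesis using fib by simp
  qed
  define F where "F L = int (phi P P (L - 4 * \<tau>))" for L
  have "phi_like F"
    unfolding phi_like_def using P_pos \<tau>_nonneg
    by (intro exI[of _ "[(P, P, \<tau>)]"] exI[of _ "\<lambda>_. 0"] exI[of _ 0]) (auto simp: phi_sum_def F_def)
  moreover have "int (card (curves_of_length c L)) = (if mN \<in> stab c then 2 else 4) * F L" if "L \<ge> len_c c + 1" for L
  proof -
    have "h * card (curves_of_length c L) = 4 * phi P P (L - 4 * \<tau>)" using card[of L] card_vectors(2)[of L] that by simp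
    then show ?thesis unfolding F_def h_def by (auto split: if_splits)
  qed
  moreover have "(if mN \<in> stab c then 2 else 4) = (if mat_torsion c then 2 else 4 :: int)"
    unfolding torsion_iff_mN ..
  ultimately show ?thesis by (rule phi_like_orbitI)
qed

end

lemma mat_torsion_act:
  assumes "Z \<in> carrier SL2" "\<gamma> \<in> curves"
  shows "mat_torsion (act Z \<gamma>) \<Longrightarrow> mat_torsion \<gamma>"
proof -
  assume "mat_torsion (act Z \<gamma>)"
  then obtain M n where M: "M \<in> carrier SL2" "act M (act Z \<gamma>) = act Z \<gamma>" "M \<noteq> (1, 0, 0, 1)"
    "n \<ge> (1::nat)" "M [^]\<^bsub>SL2\<^esub> n = (1, 0, 0, 1)" unfolding mat_torsion_def by blast
  let ?I = "inv\<^bsub>SL2\<^esub> Z"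
  define N where "N = ?I \<otimes>\<^bsub>SL2\<^esub> (M \<otimes>\<^bsub>SL2\<^esub> Z)"
  have i: "?I \<in> carrier SL2" using assms(1) by (rule SL2.inv_closed)
  have MZ: "M \<otimes>\<^bsub>SL2\<^esub> Z \<in> carrier SL2" using M(1) assms(1) by (rule SL2.m_closed)
  have N: "N \<in> carrier SL2" unfolding N_def using i MZ by (rule SL2.m_closed)
  have "act N \<gamma> = \<gamma>"
    unfolding N_def act_mult[OF i MZ assms(2)] act_mult[OF M(1) assms] M(2) by (rule act_act_inv[OF assms])
  moreover have ZN: "Z \<otimes>\<^bsub>SL2\<^esub> N = M \<otimes>\<^bsub>SL2\<^esub> Z"
    unfolding N_def SL2.m_assoc[OF assms(1) i MZ, symmetric] SL2.r_inv[OF assms(1)] by (rule SL2.l_one[OF MZ])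
  moreover have "N \<noteq> (1, 0, 0, 1)"
  proof
    assume "N = (1, 0, 0, 1)"
    then have "M \<otimes>\<^bsub>SL2\<^esub> Z = \<one>\<^bsub>SL2\<^esub> \<otimes>\<^bsub>SL2\<^esub> Z"
      using ZN SL2.r_one[OF assms(1)] SL2.l_one[OF assms(1)] by simp
    then have "M = \<one>\<^bsub>SL2\<^esub>" using SL2.right_cancel[OF assms(1) M(1) SL2.one_closed] by blast
    then show False using M(3) by simp
  qed
  moreover have "Z \<otimes>\<^bsub>SL2\<^esub> N [^]\<^bsub>SL2\<^esub> k = M [^]\<^bsub>SL2\<^esub> k \<otimes>\<^bsub>SL2\<^esub> Z" for k :: nat
  proof (induction k)
    case 0
    then show ?case using SL2.r_one[OF assms(1)] SL2.l_one[OF assms(1)] by (simp del: mult_SL2)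
  next
    case (Suc k)
    note pc = SL2.nat_pow_closed[OF N, of k] SL2.nat_pow_closed[OF M(1), of k]
    have "Z \<otimes>\<^bsub>SL2\<^esub> N [^]\<^bsub>SL2\<^esub> Suc k = (Z \<otimes>\<^bsub>SL2\<^esub> N [^]\<^bsub>SL2\<^esub> k) \<otimes>\<^bsub>SL2\<^esub> N"
      unfolding SL2.nat_pow_Suc SL2.m_assoc[OF assms(1) pc(1) N] ..
    also have "\<dots> = M [^]\<^bsub>SL2\<^esub> k \<otimes>\<^bsub>SL2\<^esub> (Z \<otimes>\<^bsub>SL2\<^esub> N)" unfolding Suc SL2.m_assoc[OF pc(2) assms(1) N] ..
    also have "\<dots> = M [^]\<^bsub>SL2\<^esub> Suc k \<otimes>\<^bsub>SL2\<^esub> Z"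
      unfolding ZN SL2.nat_pow_Suc SL2.m_assoc[OF pc(2) M(1) assms(1)] ..
    finally show ?case .
  qed
  then have "Z \<otimes>\<^bsub>SL2\<^esub> N [^]\<^bsub>SL2\<^esub> n = Z \<otimes>\<^bsub>SL2\<^esub> \<one>\<^bsub>SL2\<^esub>"
    using M(5) SL2.r_one[OF assms(1)] SL2.l_one[OF assms(1)] by simp
  then have "N [^]\<^bsub>SL2\<^esub> n = \<one>\<^bsub>SL2\<^esub>"
    using SL2.l_cancel[OF _ SL2.nat_pow_closed[OF N] SL2.one_closed assms(1)] by blast
  ultimately show "mat_torsion \<gamma>" unfolding mat_torsion_def using N M(4) by auto
qed

text \<open>If \<gamma> does not fill, pass to a translate fixed by \<open>L\<close>. A translate
  fixed by both twists would be fixed by all matrices, hence equal to \<gamma>, against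
  essentiality.\<close>

theorem essential_phi_like_orbit:
  assumes "\<gamma> \<in> curves" "essential \<gamma>"
  shows "phi_like_orbit \<gamma>"
proof (cases "fills \<gamma>")
  case True
  then show ?thesis by (rule fills_phi_like_orbit)
next
  case False
  then obtain M where M: "M \<in> carrier SL2" "curve_L (act M \<gamma>) = act M \<gamma>" using assms fills_def by blast
  let ?c = "act M \<gamma>"
  have c: "?c \<in> curves" using act_closed[OF M(1) assms(1)] .
  have i: "inv\<^bsub>SL2\<^esub> M \<in> carrier SL2" using M(1) by (rule SL2.inv_closed)
  have inv: "act (inv\<^bsub>SL2\<^esub> M) ?c = \<gamma>" by (rule act_act_inv[OF M(1) assms(1)])
  have "twist_fixed ?c"
  proof
    fix N assume N: "N \<in> carrier SL2"
    let ?d = "act N ?c"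
    have d: "?d \<in> curves" using act_closed[OF N c] .
    have iN: "inv\<^bsub>SL2\<^esub> N \<in> carrier SL2" using N by (rule SL2.inv_closed)
    show "\<not> (curve_L ?d = ?d \<and> curve_R ?d = ?d)"
    proof
      assume fixed: "curve_L ?d = ?d \<and> curve_R ?d = ?d"
      then have "act (inv\<^bsub>SL2\<^esub> M) (act (inv\<^bsub>SL2\<^esub> N) ?d) = ?d"
        using fixed_by_all[OF d] iN i by simp
      then have "\<gamma> = ?d" using act_act_inv[OF N c] inv by simp
      then show False using not_essential_if_fixed[OF assms(1)] assms(2) fixed by simp
    qed
  qed (use c M(2) in auto)
  then have "phi_like_orbit ?c" by (rule twist_fixed.fixed_phi_like_orbit)
  moreover have "mat_torsion ?c \<longleftrightarrow> mat_torsion \<gamma>"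
    using mat_torsion_act[OF M(1) assms(1)] mat_torsion_act[OF i c] inv by metis
  ultimately show ?thesis unfolding phi_like_orbit_def curves_of_length_act[OF M(1) assms(1)] by simp
qed

lemma sum_prod_list_nth:
  fixes g :: "'x \<Rightarrow> int"
  shows "(\<Sum>x\<leftarrow>xs. g x) = (\<Sum>i=1..length xs. g (xs ! (i - 1)))"
    "(\<Prod>x\<leftarrow>xs. g x) = (\<Prod>i=1..length xs. g (xs ! (i - 1)))"
proof -
  have "(\<Sum>i=1..length xs. g (xs ! (i - 1))) = (\<Sum>i<length xs. g (xs ! i))"
    using sum.atLeast1_atMost_eq[of "\<lambda>i. g (xs ! (i - 1))" "length xs"] by simp
  then show "(\<Sum>x\<leftarrow>xs. g x) = (\<Sum>i=1..length xs. g (xs ! (i - 1)))"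
    by (simp add: sum_list_sum_nth atLeast0LessThan)
  have "(\<Prod>i=1..length xs. g (xs ! (i - 1))) = (\<Prod>i<length xs. g (xs ! i))"
    using prod.atLeast1_atMost_eq[of "\<lambda>i. g (xs ! (i - 1))" "length xs"] by simp
  then show "(\<Prod>x\<leftarrow>xs. g x) = (\<Prod>i=1..length xs. g (xs ! (i - 1)))"
    by (simp add: prod.list_conv_set_nth atLeast0LessThan)
qed

theorem theorem1p1:
  fixes \<gamma> :: "word set"
  assumes "\<gamma> \<in> curves" and "essential \<gamma>"
  shows "\<exists>(N::nat) (P::nat \<Rightarrow> int) (Q::nat \<Rightarrow> int) (K::nat \<Rightarrow> int) (m::int) (L\<^sub>0::int) (C::int \<Rightarrow> int).
     N \<ge> 1 \<and>
     (\<forall>i\<in>{1..N}. P i \<ge> 1 \<and> Q i \<ge> 1 \<and> K i \<ge> 0) \<and>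
     m \<in> {2, 4} \<and>
     L\<^sub>0 \<ge> 1 \<and>
     (\<exists>p::int. 1 \<le> p \<and> p \<le> (\<Prod>i=1..N. lcm (P i) (Q i)) \<and> (\<forall>L. C (L + p) = C L)) \<and>
     (\<forall>L. \<bar>C L\<bar> \<le> 2 * int N) \<and>
     (\<forall>L\<ge>L\<^sub>0. int (card {\<alpha> \<in> orbit MCG mcg_act \<gamma>. int (curve_length \<alpha>) = L}) =
        m * ((\<Sum>i=1..N. int (phi (P i) (Q i) (L - 4 * K i))) + C L)) \<and>
     m = (if has_nontrivial_torsion MCG (stabilizer MCG mcg_act \<gamma>) then 2 else 4)"
proof -
  obtain F m M where F: "phi_like F" "\<forall>L\<ge>M. int (card (curves_of_length \<gamma> L)) = m * F L"
    "m = (if mat_torsion \<gamma> then 2 else 4)"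
    using essential_phi_like_orbit[OF assms] unfolding phi_like_orbit_def by blast
  obtain ps C L0 where ps: "ps \<noteq> []" "\<forall>(P, Q, K)\<in>set ps. P \<ge> 1 \<and> Q \<ge> 1 \<and> K \<ge> 0"
     "\<forall>L. C (L + lcm_prod ps) = C L" "\<forall>L. \<bar>C L\<bar> \<le> 2 * int (length ps)"
     "\<forall>L\<ge>L0. F L = phi_sum ps L + C L"
    using F(1) unfolding phi_like_def by blast
  define P Q K where "P i = fst (ps ! (i - 1))" and "Q i = fst (snd (ps ! (i - 1)))"
    and "K i = snd (snd (ps ! (i - 1)))" for i
  show ?thesis
  \<comment> \<open>The list is reindexed from 1, and the period exhibited is the full product of
    the least common multiples.\<close>
  proof (intro exI conjI ballI allI impI)
    fix i assume i: "i \<in> {1..length ps}"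
    then have "ps ! (i - 1) \<in> set ps" by auto
    then show "P i \<ge> 1" "Q i \<ge> 1" "K i \<ge> 0" using ps(2) unfolding P_def Q_def K_def by fastforce+
  next
    show "length ps \<ge> 1" using ps(1) by (cases ps) auto
    show "m \<in> {2, 4}" unfolding F(3) by simp
    show "max 1 (max M L0) \<ge> 1" by simp
    show "1 \<le> lcm_prod ps" using lcm_prod_pos[OF ps(2)] by linarith
    show "lcm_prod ps \<le> (\<Prod>i=1..length ps. lcm (P i) (Q i))"
      unfolding lcm_prod_def sum_prod_list_nth P_def Q_def by (simp add: case_prod_unfold)
    show "C (L + lcm_prod ps) = C L" for L by (rule ps(3)[rule_format])
    show "\<bar>C L\<bar> \<le> 2 * int (length ps)" for L by (rule ps(4)[rule_format])
    show "m = (if has_nontrivial_torsion MCG (stabilizer MCG mcg_act \<gamma>) then 2 else 4)"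
      unfolding F(3) torsion_iff ..
  next
    fix L assume L: "L \<ge> max 1 (max M L0)"
    have "phi_sum ps L = (\<Sum>i=1..length ps. int (phi (P i) (Q i) (L - 4 * K i)))"
      unfolding phi_sum_def sum_prod_list_nth P_def Q_def K_def by (simp add: case_prod_unfold)
    then show "int (card {\<alpha> \<in> orbit MCG mcg_act \<gamma>. int (curve_length \<alpha>) = L}) =
        m * ((\<Sum>i=1..length ps. int (phi (P i) (Q i) (L - 4 * K i))) + C L)"
      using F(2) ps(5) L unfolding curves_of_length_def by simp
  qed
qed

end
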